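(* Let $z\ge1$ be a fixed constant. Suppose there exists a $\beta$-approximation algorithm for $(k,z)$-Clustering with running time $T(n,k)$ for some constant $\beta\ge1$, and there exists a $\tau$-approximation algorithm for $(k,z)$-Clustering that runs in polynomial time, where $\tau=O(1)$. Then, for every $\epsilon>0$, there exists a $(\beta+\epsilon)$-approximation algorithm for $(k,z)$-Clustering with outliers, with running time $\left(\frac{k+m}{\epsilon}\right)^{O(m)} n^{O(1)}\cdot T(n,k)$, where $n$ is the instance size and $m$ is the number of outliers.
   Context: Let $z\ge1$ be a fixed real (not part of the input). Let $(\Gamma,d)$ be a metric space and, for a point $p$ and finite nonempty $C\subseteq\Gamma$, let $\mathsf{cost}(p,C)=(d(p,C))^z$ where $d(p,C)=\min_{c\in C}d(p,c)$. An instance of $(k,z)$-Clustering is $((\Gamma,d),X,F,k)$ with finite sets $X$ (clients) and $F$ (facilities) in $\Gamma$ and integer $k\ge1$; the goal is to find $C\subseteq F$ with $|C|\le k$ minimizing $\mathsf{cost}(X,C)=\sum_{p\in X}\mathsf{cost}(p,C)$. In $(k,z)$-Clustering with $m$ outliers, an additional integer $m$ is given and the goal is to minimize $\mathsf{cost}_m(X,C)$, the sum of the $|X|-m$ smallest values of $\mathsf{cost}(p,C)$, $p\in X$, over $C\subseteq F$ with $|C|\le k$. The instance size is $n=|X\cup F|$. An $\alpha$-approximation algorithm returns a feasible solution of cost at most $\alpha$ times the optimum (with high probability, if randomized). *)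

theory Defs
  imports "HOL-Analysis.Analysis" "HOL-Probability.Probability"
begin

section \<open>Clustering, with and without outliers\<close>

text \<open>
  Points are natural numbers and \<open>X \<union> F\<close> is an initial segment of them, so that an instance can be
  written into the memory of a machine. An algorithm sees the ambient space \<open>\<Gamma>\<close> only through the
  distances within \<open>X \<union> F\<close>.
\<close>

definition clustering_instance ::
  "nat set \<Rightarrow> (nat \<Rightarrow> nat \<Rightarrow> real) \<Rightarrow> nat set \<Rightarrow> nat set \<Rightarrow> nat \<Rightarrow> bool" where
  "clustering_instance \<Gamma> d X F k \<longleftrightarrow>
     Metric_space \<Gamma> d \<and> X \<subseteq> \<Gamma> \<and> F \<subseteq> \<Gamma> \<and> finite X \<and> finite F \<and> F \<noteq> {} \<and> k \<ge> 1 \<and>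
     X \<union> F = {..<card (X \<union> F)}"

definition outlier_instance ::
  "nat set \<Rightarrow> (nat \<Rightarrow> nat \<Rightarrow> real) \<Rightarrow> nat set \<Rightarrow> nat set \<Rightarrow> nat \<Rightarrow> nat \<Rightarrow> bool" where
  "outlier_instance \<Gamma> d X F k m \<longleftrightarrow> clustering_instance \<Gamma> d X F k \<and> m \<le> card X"

definition feasible :: "nat set \<Rightarrow> nat \<Rightarrow> nat set set" where
  "feasible F k = {C. C \<subseteq> F \<and> C \<noteq> {} \<and> card C \<le> k}"

definition point_cost :: "real \<Rightarrow> (nat \<Rightarrow> nat \<Rightarrow> real) \<Rightarrow> nat \<Rightarrow> nat set \<Rightarrow> real" where
  "point_cost z d p C = (MIN c\<in>C. d p c) powr z"

definition cost :: "real \<Rightarrow> (nat \<Rightarrow> nat \<Rightarrow> real) \<Rightarrow> nat set \<Rightarrow> nat set \<Rightarrow> real" where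
  "cost z d X C = (\<Sum>p\<in>X. point_cost z d p C)"

definition outlier_cost ::
  "real \<Rightarrow> (nat \<Rightarrow> nat \<Rightarrow> real) \<Rightarrow> nat \<Rightarrow> nat set \<Rightarrow> nat set \<Rightarrow> real" where
  "outlier_cost z d m X C =
     sum_list (take (card X - m)
       (sorted_list_of_multiset (image_mset (\<lambda>p. point_cost z d p C) (mset_set X))))"

definition opt ::
  "real \<Rightarrow> (nat \<Rightarrow> nat \<Rightarrow> real) \<Rightarrow> nat set \<Rightarrow> nat set \<Rightarrow> nat \<Rightarrow> real" where
  "opt z d X F k = (MIN C\<in>feasible F k. cost z d X C)"

definition outlier_opt ::
  "real \<Rightarrow> (nat \<Rightarrow> nat \<Rightarrow> real) \<Rightarrow> nat set \<Rightarrow> nat set \<Rightarrow> nat \<Rightarrow> nat \<Rightarrow> real" where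
  "outlier_opt z d X F k m = (MIN C\<in>feasible F k. outlier_cost z d m X C)"


section \<open>The machine model\<close>

text \<open>
  A real RAM with structured control flow and fair coin flips. The memory consists of arrays of
  natural numbers (one index) and arrays of reals (two indices); array names are fixed in the
  program text, indices are computed. Natural numbers can only be added, subtracted (truncated at 0)
  and compared, since unit-cost multiplication of unbounded integers would be unreasonably powerful.
  Reals support exact field arithmetic, comparison, and the map \<open>x \<mapsto> x powr z\<close> for the
  fixed exponent \<open>z\<close>, so that the cost of a point can be evaluated; there is no rounding of reals
  to integers, and the only literals are natural numbers.
\<close>

record memory =
  nats :: "nat \<Rightarrow> nat \<Rightarrow> nat"
  reals :: "nat \<Rightarrow> nat \<Rightarrow> nat \<Rightarrow> real"

datatype nexp =
    NLit nat
  | NGet nat nexp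
  | NAdd nexp nexp
  | NSub nexp nexp

datatype rexp =
    ROfNat nexp
  | RGet nat nexp nexp
  | RAdd rexp rexp
  | RSub rexp rexp
  | RMul rexp rexp
  | RDiv rexp rexp
  | RPow rexp

datatype bexp =
    NLess nexp nexp
  | RLess rexp rexp
  | BNot bexp
  | BAnd bexp bexp

datatype com =
    Skip
  | NSet nat nexp nexp
  | RSet nat nexp nexp rexp
  | Flip nat nexp
  | Seq com com
  | Cond bexp com com
  | While bexp com

primrec nval :: "nexp \<Rightarrow> memory \<Rightarrow> nat" where
  "nval (NLit i) s = i"
| "nval (NGet a e) s = nats s a (nval e s)"
| "nval (NAdd e f) s = nval e s + nval f s"
| "nval (NSub e f) s = nval e s - nval f s"

primrec rval :: "real \<Rightarrow> rexp \<Rightarrow> memory \<Rightarrow> real" where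
  "rval z (ROfNat e) s = real (nval e s)"
| "rval z (RGet a e f) s = reals s a (nval e s) (nval f s)"
| "rval z (RAdd e f) s = rval z e s + rval z f s"
| "rval z (RSub e f) s = rval z e s - rval z f s"
| "rval z (RMul e f) s = rval z e s * rval z f s"
| "rval z (RDiv e f) s = rval z e s / rval z f s"
| "rval z (RPow e) s = rval z e s powr z"

primrec bval :: "real \<Rightarrow> bexp \<Rightarrow> memory \<Rightarrow> bool" where
  "bval z (NLess e f) s \<longleftrightarrow> nval e s < nval f s"
| "bval z (RLess e f) s \<longleftrightarrow> rval z e s < rval z f s"
| "bval z (BNot b) s \<longleftrightarrow> \<not> bval z b s"
| "bval z (BAnd b c) s \<longleftrightarrow> bval z b s \<and> bval z c s"

text \<open>The time needed to evaluate an expression is its number of nodes.\<close>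

primrec ntime :: "nexp \<Rightarrow> nat" where
  "ntime (NLit i) = 1"
| "ntime (NGet a e) = 1 + ntime e"
| "ntime (NAdd e f) = 1 + ntime e + ntime f"
| "ntime (NSub e f) = 1 + ntime e + ntime f"

primrec rtime :: "rexp \<Rightarrow> nat" where
  "rtime (ROfNat e) = 1 + ntime e"
| "rtime (RGet a e f) = 1 + ntime e + ntime f"
| "rtime (RAdd e f) = 1 + rtime e + rtime f"
| "rtime (RSub e f) = 1 + rtime e + rtime f"
| "rtime (RMul e f) = 1 + rtime e + rtime f"
| "rtime (RDiv e f) = 1 + rtime e + rtime f"
| "rtime (RPow e) = 1 + rtime e"

primrec btime :: "bexp \<Rightarrow> nat" where
  "btime (NLess e f) = 1 + ntime e + ntime f"
| "btime (RLess e f) = 1 + rtime e + rtime f"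
| "btime (BNot b) = 1 + btime b"
| "btime (BAnd b c) = 1 + btime b + btime c"

definition nset :: "nat \<Rightarrow> nat \<Rightarrow> nat \<Rightarrow> memory \<Rightarrow> memory" where
  "nset a i v s = s\<lparr>nats := (nats s)(a := (nats s a)(i := v))\<rparr>"

definition rset :: "nat \<Rightarrow> nat \<Rightarrow> nat \<Rightarrow> real \<Rightarrow> memory \<Rightarrow> memory" where
  "rset a i j v s = s\<lparr>reals := (reals s)(a := (reals s a)(i := (reals s a i)(j := v)))\<rparr>"

text \<open>
  The semantics maps an initial memory to the joint distribution of running time and final memory;
  the missing mass is the probability of divergence.
\<close>

partial_function (spmf) while_spmf ::
  "(memory \<Rightarrow> bool) \<Rightarrow> nat \<Rightarrow> (memory \<Rightarrow> (nat \<times> memory) spmf) \<Rightarrow> memory \<Rightarrow> (nat \<times> memory) spmf" where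
  "while_spmf b t f s =
     (if b s then
        bind_spmf (f s) (\<lambda>(t1, s1).
          map_spmf (\<lambda>(t2, s2). (t + t1 + t2, s2)) (while_spmf b t f s1))
      else return_spmf (t, s))"

primrec exec :: "real \<Rightarrow> com \<Rightarrow> memory \<Rightarrow> (nat \<times> memory) spmf" where
  "exec z Skip = (\<lambda>s. return_spmf (1, s))"
| "exec z (NSet a e f) = (\<lambda>s.
     return_spmf (1 + ntime e + ntime f, nset a (nval e s) (nval f s) s))"
| "exec z (RSet a e f g) = (\<lambda>s.
     return_spmf (1 + ntime e + ntime f + rtime g,
       rset a (nval e s) (nval f s) (rval z g s) s))"
| "exec z (Flip a e) = (\<lambda>s.
     map_spmf (\<lambda>b. (1 + ntime e, nset a (nval e s) (of_bool b) s)) coin_spmf)"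
| "exec z (Seq c1 c2) = (\<lambda>s.
     bind_spmf (exec z c1 s) (\<lambda>(t1, s1).
       map_spmf (\<lambda>(t2, s2). (t1 + t2, s2)) (exec z c2 s1)))"
| "exec z (Cond b c1 c2) = (\<lambda>s.
     map_spmf (\<lambda>(t, s'). (1 + btime b + t, s'))
       (if bval z b s then exec z c1 s else exec z c2 s))"
| "exec z (While b c) = while_spmf (bval z b) (1 + btime b) (exec z c)"

primrec deterministic :: "com \<Rightarrow> bool" where
  "deterministic Skip \<longleftrightarrow> True"
| "deterministic (NSet a e f) \<longleftrightarrow> True"
| "deterministic (RSet a e f g) \<longleftrightarrow> True"
| "deterministic (Flip a e) \<longleftrightarrow> False"
| "deterministic (Seq c1 c2) \<longleftrightarrow> deterministic c1 \<and> deterministic c2"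
| "deterministic (Cond b c1 c2) \<longleftrightarrow> deterministic c1 \<and> deterministic c2"
| "deterministic (While b c) \<longleftrightarrow> deterministic c"


section \<open>Approximation algorithms and running time\<close>

text \<open>
  Array 0 of the naturals holds \<open>n\<close>, \<open>k\<close> and \<open>m\<close> (with \<open>m = 0\<close> if there are no outliers), arrays 1 and
  2 the characteristic functions of \<open>X\<close> and \<open>F\<close>; array 0 of the reals holds the distance matrix. All
  other cells are 0. The solution is returned as a characteristic function in array 3.
\<close>

definition encode ::
  "(nat \<Rightarrow> nat \<Rightarrow> real) \<Rightarrow> nat set \<Rightarrow> nat set \<Rightarrow> nat \<Rightarrow> nat \<Rightarrow> memory" where
  "encode d X F k m =
     \<lparr>nats = (\<lambda>a i.
        if a = 0 then (if i = 0 then card (X \<union> F) else if i = 1 then k else if i = 2 then m else 0)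
        else if a = 1 then of_bool (i \<in> X)
        else if a = 2 then of_bool (i \<in> F)
        else 0),
      reals = (\<lambda>a i j. if a = 0 \<and> i \<in> X \<union> F \<and> j \<in> X \<union> F then d i j else 0)\<rparr>"

definition returned :: "nat \<Rightarrow> memory \<Rightarrow> nat set" where
  "returned n s = {i. i < n \<and> nats s 3 i \<noteq> 0}"

text \<open>Success is certain for deterministic programs; otherwise it has probability at least
  \<open>1 - 1 / n\<close>, which is what ``with high probability'' stands for.\<close>

definition succeeds :: "real \<Rightarrow> com \<Rightarrow> nat \<Rightarrow> memory \<Rightarrow> (memory \<Rightarrow> bool) \<Rightarrow> bool" where
  "succeeds z P n s good \<longleftrightarrow>
     measure (measure_spmf (exec z P s)) {(t, s'). good s'}
       \<ge> (if deterministic P then 1 else 1 - 1 / real n)"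

definition halts_within :: "real \<Rightarrow> com \<Rightarrow> memory \<Rightarrow> real \<Rightarrow> bool" where
  "halts_within z P s b \<longleftrightarrow>
     lossless_spmf (exec z P s) \<and> (\<forall>(t, s') \<in> set_spmf (exec z P s). real t \<le> b)"

definition clustering_approx :: "real \<Rightarrow> real \<Rightarrow> com \<Rightarrow> bool" where
  "clustering_approx z \<alpha> P \<longleftrightarrow>
     (\<forall>\<Gamma> d X F k. clustering_instance \<Gamma> d X F k \<longrightarrow>
        succeeds z P (card (X \<union> F)) (encode d X F k 0)
          (\<lambda>s. let C = returned (card (X \<union> F)) s in
             C \<in> feasible F k \<and> cost z d X C \<le> \<alpha> * opt z d X F k))"

definition clustering_time :: "real \<Rightarrow> (nat \<Rightarrow> nat \<Rightarrow> real) \<Rightarrow> com \<Rightarrow> bool" where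
  "clustering_time z T P \<longleftrightarrow>
     (\<forall>\<Gamma> d X F k. clustering_instance \<Gamma> d X F k \<longrightarrow>
        halts_within z P (encode d X F k 0) (T (card (X \<union> F)) k))"

definition outlier_approx :: "real \<Rightarrow> real \<Rightarrow> com \<Rightarrow> bool" where
  "outlier_approx z \<alpha> P \<longleftrightarrow>
     (\<forall>\<Gamma> d X F k m. outlier_instance \<Gamma> d X F k m \<longrightarrow>
        succeeds z P (card (X \<union> F)) (encode d X F k m)
          (\<lambda>s. let C = returned (card (X \<union> F)) s in
             C \<in> feasible F k \<and> outlier_cost z d m X C \<le> \<alpha> * outlier_opt z d X F k m))"

definition outlier_time :: "real \<Rightarrow> (nat \<Rightarrow> nat \<Rightarrow> nat \<Rightarrow> real) \<Rightarrow> com \<Rightarrow> bool" where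
  "outlier_time z T P \<longleftrightarrow>
     (\<forall>\<Gamma> d X F k m. outlier_instance \<Gamma> d X F k m \<longrightarrow>
        halts_within z P (encode d X F k m) (T (card (X \<union> F)) k m))"

end

theory Submission
  imports Defs
begin

text \<open>
  Run the farthest-first traversal on the clients for \<open>K = min n (k + m + L * m)\<close> rounds, where \<open>L\<close>
  depends only on \<open>z\<close>, \<open>\<beta>\<close> and \<open>\<epsilon>\<close>, and let \<open>r\<close> be the largest distance of a client to the chosen
  centers. The centers and a farthest client are pairwise at distance at least \<open>r\<close>, at most \<open>m\<close> of them
  are outliers, and at most \<open>k\<close> are closer than \<open>r / 2\<close> to the optimal solution; hence the optimum is at
  least \<open>L * m * (r / 2) powr z\<close>. Two clients with the same nearest center are at distance at most
  \<open>2 * r\<close>, so replacing the optimal outliers by arbitrary clients of the same cells changes the optimum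
  by a factor \<open>1 + \<epsilon> / \<beta>\<close> only. It therefore suffices to try all \<open>K ^ m\<close> ways to distribute the outliers
  over the cells, and to call the given \<open>\<beta>\<close>-approximation for each of them; a single one of these calls
  has to succeed, so no amplification is needed.

  As \<open>T\<close> is not assumed to be monotone, every call must have size exactly \<open>n\<close>: deleted clients stay as
  facilities that are remote from everything else. As a call may leave arbitrary data in the memory,
  it is simulated in an address range that no earlier call has touched.
\<close>

section \<open>Reasoning about programs\<close>

text \<open>A guess only fixes how many clients each cell loses, so an unlucky guess or a failed
  randomized call must do no harm. The program trusts no call: it repairs the returned set to a
  nonempty subset of \<open>F\<close>, rejects it if it has more than \<open>k\<close> elements, and
  computes its cost on the undeleted clients itself. As at most \<open>m\<close> clients are
  deleted, this number bounds the outlier cost from above, so keeping the smallest one is safe.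
  Accordingly there are two calculi: \<open>wp\<close> for what holds on every run,
  \<open>pr\<close> for the one random event that matters.

  Naturals cannot be multiplied or divided. The number \<open>K ^ m\<close> of guesses is held as a
  real, and the base-\<open>K\<close> digits of a guess are found by repeated subtraction, in time
  linear in the guess. This is why the number of guesses enters the time bound squared; the exponent
  \<open>O(m)\<close> absorbs it.

  If \<open>n\<close> cuts off the number of rounds, a positive \<open>r\<close> would yield more
  than \<open>n\<close> distinct clients. Hence \<open>r = 0\<close> in that case, all cells have
  diameter 0 and swapping outliers costs nothing.\<close>

lemma nats_nset: "nats (nset a i v s) b j = (if b = a \<and> j = i then v else nats s b j)"
  by (simp add: nset_def)

lemma nats_nset_other: "b \<noteq> a \<Longrightarrow> nats (nset a i v s) b = nats s b"
  by (simp add: nset_def)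

lemma reals_nset [simp]: "reals (nset a i v s) = reals s"
  by (simp add: nset_def)

lemma reals_rset: "reals (rset a i j v s) b k l = (if b = a \<and> k = i \<and> l = j then v else reals s b k l)"
  by (simp add: rset_def)

lemma nats_rset [simp]: "nats (rset a i j v s) = nats s"
  by (simp add: rset_def)

text \<open>Total correctness with time: termination with probability 1, and \<open>R\<close> on
  every possible outcome. Being a statement about the support, it composes without
  probabilities.\<close>

definition wp :: "real \<Rightarrow> com \<Rightarrow> memory \<Rightarrow> (nat \<Rightarrow> memory \<Rightarrow> bool) \<Rightarrow> bool" where
  "wp z c s R \<longleftrightarrow>
     lossless_spmf (exec z c s) \<and> (\<forall>(t, s') \<in> set_spmf (exec z c s). R t s')"

lemma wp_Skip [simp]: "wp z Skip s R \<longleftrightarrow> R 1 s"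
  by (simp add: wp_def)

lemma wp_NSet [simp]:
  "wp z (NSet a e f) s R \<longleftrightarrow> R (1 + ntime e + ntime f) (nset a (nval e s) (nval f s) s)"
  by (simp add: wp_def)

lemma wp_RSet [simp]:
  "wp z (RSet a e f g) s R \<longleftrightarrow>
     R (1 + ntime e + ntime f + rtime g) (rset a (nval e s) (nval f s) (rval z g s) s)"
  by (simp add: wp_def)

lemma wp_Seq [simp]:
  "wp z (Seq c1 c2) s R \<longleftrightarrow> wp z c1 s (\<lambda>t1 s1. wp z c2 s1 (\<lambda>t2 s2. R (t1 + t2) s2))"
  by (fastforce simp: wp_def set_bind_spmf)

lemma wp_Cond [simp]:
  "wp z (Cond b c1 c2) s R \<longleftrightarrow>
     (if bval z b s then wp z c1 s (\<lambda>t. R (1 + btime b + t))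
      else wp z c2 s (\<lambda>t. R (1 + btime b + t)))"
  by (auto simp: wp_def)

lemma wp_mono: "wp z c s R \<Longrightarrow> (\<And>t s'. R t s' \<Longrightarrow> R' t s') \<Longrightarrow> wp z c s R'"
  by (fastforce simp: wp_def)

lemma wp_While:
  "wp z (While b c) s R \<longleftrightarrow>
     (if bval z b s
      then wp z c s (\<lambda>t1 s1. wp z (While b c) s1 (\<lambda>t2 s2. R (1 + btime b + t1 + t2) s2))
      else R (1 + btime b) s)"
proof -
  have "exec z (While b c) s =
     (if bval z b s then
        bind_spmf (exec z c s) (\<lambda>(t1, s1).
          map_spmf (\<lambda>(t2, s2). (1 + btime b + t1 + t2, s2)) (exec z (While b c) s1))
      else return_spmf (1 + btime b, s))"
    unfolding exec.simps by (simp only: while_spmf.simps[of "bval z b" _ _ s])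
  then show ?thesis
    by (fastforce simp: wp_def set_bind_spmf simp del: exec.simps(7))
qed

text \<open>The test is a parameter because loop bounds are not always naturals in memory: one is a
  real, one a conjunction, one a comparison of a shrinking remainder.\<close>

definition For :: "nat \<Rightarrow> bexp \<Rightarrow> com \<Rightarrow> com" where
  "For v b c =
     Seq (NSet v (NLit 0) (NLit 0))
       (While b (Seq c (NSet v (NLit 0) (NAdd (NGet v (NLit 0)) (NLit 1)))))"

text \<open>Each iteration pays \<open>1 + btime b\<close> for the test and 6 for the increment. The
  invariant is required after the increment, hence \<open>nset v 0 (Suc i) s'\<close> in the
  step.\<close>

lemma wp_counting_loop:
  assumes test: "\<And>i s. I i s \<Longrightarrow> nats s v 0 = i \<Longrightarrow> i \<le> N \<Longrightarrow> bval z b s \<longleftrightarrow> i < N"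
    and step: "\<And>i s. I i s \<Longrightarrow> nats s v 0 = i \<Longrightarrow> i < N \<Longrightarrow>
       wp z c s (\<lambda>t s'. t \<le> B \<and> nats s' v 0 = i \<and> I (Suc i) (nset v 0 (Suc i) s'))"
    and start: "I i s" "nats s v 0 = i" "i \<le> N"
  shows "wp z (While b (Seq c (NSet v (NLit 0) (NAdd (NGet v (NLit 0)) (NLit 1))))) s
    (\<lambda>t s'. t \<le> 1 + btime b + (N - i) * (B + btime b + 7) \<and> I N s' \<and> nats s' v 0 = N)"
  using start(3) start
proof (induction i arbitrary: s rule: inc_induct)
  case base
  with test[of N s] show ?case by (subst wp_While) simp
next
  let ?w = "While b (Seq c (NSet v (NLit 0) (NAdd (NGet v (NLit 0)) (NLit 1))))"
  case (step n)
  have b: "bval z b s" using test[of n s] step by simp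
  have ar: "1 + btime b + (N - Suc n) * q + (1 + btime b + t + 6) \<le> 1 + btime b + (N - n) * q"
    if "q = B + btime b + 7" "t \<le> B" for t q
  proof -
    have "N - n = Suc (N - Suc n)" using step by simp
    then show ?thesis using that by simp
  qed
  have IH: "wp z ?w s1 (\<lambda>t s'. t \<le> 1 + btime b + (N - Suc n) * (B + btime b + 7) \<and> I N s' \<and> nats s' v 0 = N)"
    if "I (Suc n) s1" "nats s1 v 0 = Suc n" for s1
    using step.IH[OF that] step.hyps by simp
  have body: "wp z c s (\<lambda>t s'. t \<le> B \<and> nats s' v 0 = n \<and> I (Suc n) (nset v 0 (Suc n) s'))"
    using assms(2)[of n s] step by simp
  show ?case
    unfolding wp_While[of z b _ s] using b
    apply (simp del: One_nat_def)
    apply (rule wp_mono[OF body])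
    apply (elim conjE)
    apply (simp del: One_nat_def)
    apply (rule wp_mono[OF IH])
      apply (simp_all add: nats_nset)
    subgoal for t s' t' s''
      using ar[OF refl, of t] by simp
    done
qed

lemma wp_For:
  assumes start: "I 0 (nset v 0 0 s)"
    and test: "\<And>i s. I i s \<Longrightarrow> nats s v 0 = i \<Longrightarrow> i \<le> N \<Longrightarrow> bval z b s \<longleftrightarrow> i < N"
    and step: "\<And>i s. I i s \<Longrightarrow> nats s v 0 = i \<Longrightarrow> i < N \<Longrightarrow>
       wp z c s (\<lambda>t s'. t \<le> B \<and> nats s' v 0 = i \<and> I (Suc i) (nset v 0 (Suc i) s'))"
    and fin: "\<And>t s. t \<le> 4 + btime b + N * (B + btime b + 7) \<Longrightarrow> I N s \<Longrightarrow> nats s v 0 = N \<Longrightarrow> R t s"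
  shows "wp z (For v b c) s R"
  unfolding For_def
  apply (simp del: One_nat_def)
  apply (rule wp_mono[OF wp_counting_loop[where I=I and i=0, OF test step]])
  using start apply (simp_all add: nats_nset)
  apply (rule fin)
    apply simp_all
  done

text \<open>Makes every valid time bound at least 1, so that a product with it can absorb the
  overhead of the reduction.\<close>

lemma exec_time_pos: "(t, s') \<in> set_spmf (exec z c s) \<Longrightarrow> t \<ge> 1"
proof (induction c arbitrary: t s s')
  case (While b c)
  then show ?case
    by (simp, subst (asm) while_spmf.simps) (auto simp: set_bind_spmf split: if_splits)
next
  case (Seq c1 c2)
  show ?case using Seq.prems by (auto simp: set_bind_spmf dest!: Seq.IH)
qed (auto simp: set_bind_spmf split: if_splits)

section \<open>Lower bounds on success probabilities\<close>

definition pr :: "real \<Rightarrow> com \<Rightarrow> memory \<Rightarrow> (memory \<Rightarrow> bool) \<Rightarrow> real" where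
  "pr z c s G = measure (measure_spmf (exec z c s)) {(t, s'). G s'}"

lemma pr_alt: "pr z c s G = measure (measure_spmf (exec z c s)) {x. G (snd x)}"
  by (simp add: pr_def case_prod_unfold)

text \<open>The mass of \<open>B\<close> under the bind is an integral whose integrand is at least
  \<open>q\<close> on \<open>A\<close> and nonnegative elsewhere.\<close>

lemma measure_bind_spmf_ge:
  assumes "measure (measure_spmf p) A \<ge> r"
    and "\<And>x. x \<in> A \<Longrightarrow> x \<in> set_spmf p \<Longrightarrow> measure (measure_spmf (f x)) B \<ge> q" and "q \<ge> 0"
  shows "measure (measure_spmf (bind_spmf p f)) B \<ge> r * q"
proof -
  \<comment> \<open>The mass of an event becomes \<open>spmf\<close> at a Boolean point, so that
    \<open>spmf_bind\<close> applies.\<close>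
  have eq: "measure (measure_spmf w) B = spmf (map_spmf (\<lambda>x. x \<in> B) w) True" for w
    by (simp add: spmf_conv_measure_spmf measure_map_spmf vimage_def)
  have "r * q \<le> q * measure (measure_spmf p) A" using assms(1,3) by (simp add: mult.commute mult_left_mono)
  also have "\<dots> = (\<integral>x. q * indicator A x \<partial>measure_spmf p)"
    by simp
  also have "\<dots> \<le> (\<integral>x. spmf (map_spmf (\<lambda>x. x \<in> B) (f x)) True \<partial>measure_spmf p)"
    apply (rule integral_mono_AE)
      apply (rule measure_spmf.integrable_const_bound[where B="q"])
       apply (use assms(3) in \<open>auto simp: indicator_def\<close>)
    apply (rule measure_spmf.integrable_const_bound[where B="1"])
       apply (auto simp: pmf_le_1 AE_measure_spmf_iff)
    using assms(2) unfolding eq by simp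
  also have "\<dots> = spmf (bind_spmf p (\<lambda>x. map_spmf (\<lambda>x. x \<in> B) (f x))) True"
    by (simp add: spmf_bind)
  also have "\<dots> = measure (measure_spmf (bind_spmf p f)) B"
    unfolding eq map_spmf_bind_spmf o_def by simp
  finally show ?thesis .
qed

lemma pr_wp: "wp z c s (\<lambda>t s'. G s') \<Longrightarrow> pr z c s G \<ge> 1"
proof -
  assume a: "wp z c s (\<lambda>t s'. G s')"
  then have "set_spmf (exec z c s) \<subseteq> {(t, s'). G s'}" by (auto simp: wp_def)
  then have "pr z c s G = weight_spmf (exec z c s)"
    unfolding pr_def weight_spmf_def
    by (intro measure_spmf.finite_measure_eq_AE) (auto simp: AE_measure_spmf_iff)
  with a show ?thesis by (simp add: wp_def lossless_spmf_def)
qed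

text \<open>Facts that hold on all runs can be added to an event for free; this is how invariants
  meet the random event.\<close>

lemma pr_wp_conj:
  assumes "pr z c s G \<ge> p" and "wp z c s (\<lambda>t s'. H s')"
  shows "pr z c s (\<lambda>s'. G s' \<and> H s') \<ge> p"
proof -
  have "pr z c s G = pr z c s (\<lambda>s'. G s' \<and> H s')"
    unfolding pr_alt using assms(2)
    by (intro measure_spmf.finite_measure_eq_AE) (auto simp: AE_measure_spmf_iff wp_def)
  then show ?thesis using assms(1) by simp
qed

lemma pr_Seq:
  assumes "pr z c1 s G1 \<ge> p" and "\<And>s'. G1 s' \<Longrightarrow> pr z c2 s' G \<ge> q" and "q \<ge> 0"
  shows "pr z (Seq c1 c2) s G \<ge> p * q"
  unfolding pr_alt exec.simps
proof (rule measure_bind_spmf_ge)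
  show "p \<le> measure (measure_spmf (exec z c1 s)) {x. G1 (snd x)}"
    using assms(1) by (simp add: pr_alt)
  show "q \<le> measure (measure_spmf (case x of (t1, s1) \<Rightarrow>
          map_spmf (\<lambda>(t2, s2). (t1 + t2, s2)) (exec z c2 s1))) {x. G (snd x)}"
    if "x \<in> {x. G1 (snd x)}" for x
    using that assms(2)[of "snd x"]
    by (auto simp: pr_alt measure_map_spmf vimage_def split_beta split: prod.splits)
qed fact

text \<open>The two programs differ only in running time, which \<open>pr\<close> ignores.\<close>

lemma pr_While:
  assumes "bval z b s"
  shows "pr z (While b c) s G = pr z (Seq c (While b c)) s G"
proof -
  have "exec z (While b c) s =
        bind_spmf (exec z c s) (\<lambda>(t1, s1).
          map_spmf (\<lambda>(t2, s2). (1 + btime b + t1 + t2, s2)) (exec z (While b c) s1))"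
    using assms unfolding exec.simps by (simp only: while_spmf.simps[of "bval z b" _ _ s] if_True)
  also have "\<dots> = map_spmf (\<lambda>(t, s). (1 + btime b + t, s)) (exec z (Seq c (While b c)) s)"
    by (simp add: map_spmf_bind_spmf o_def split_def spmf.map_comp add.assoc)
  finally show ?thesis
    unfolding pr_alt by (simp add: measure_map_spmf vimage_def split_beta)
qed

lemma pr_mono: "pr z c s G \<ge> p \<Longrightarrow> (\<And>s'. G s' \<Longrightarrow> G' s') \<Longrightarrow> pr z c s G' \<ge> p"
  unfolding pr_def by (erule order_trans, rule measure_spmf.finite_measure_mono) auto

section \<open>Simulation inside shifted arrays\<close>

text \<open>Array \<open>a\<close> becomes array \<open>a + 20\<close>, with its first index shifted
  by the base in array 4. Second indices of real arrays need no shift, as freshness concerns whole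
  rows.\<close>

primrec nsim :: "nexp \<Rightarrow> nexp" where
  "nsim (NLit i) = NLit i"
| "nsim (NGet a e) = NGet (a + 20) (NAdd (NGet 4 (NLit 0)) (nsim e))"
| "nsim (NAdd e f) = NAdd (nsim e) (nsim f)"
| "nsim (NSub e f) = NSub (nsim e) (nsim f)"

primrec rsim :: "rexp \<Rightarrow> rexp" where
  "rsim (ROfNat e) = ROfNat (nsim e)"
| "rsim (RGet a e f) = RGet (a + 20) (NAdd (NGet 4 (NLit 0)) (nsim e)) (nsim f)"
| "rsim (RAdd e f) = RAdd (rsim e) (rsim f)"
| "rsim (RSub e f) = RSub (rsim e) (rsim f)"
| "rsim (RMul e f) = RMul (rsim e) (rsim f)"
| "rsim (RDiv e f) = RDiv (rsim e) (rsim f)"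
| "rsim (RPow e) = RPow (rsim e)"

primrec bsim :: "bexp \<Rightarrow> bexp" where
  "bsim (NLess e f) = NLess (nsim e) (nsim f)"
| "bsim (RLess e f) = RLess (rsim e) (rsim f)"
| "bsim (BNot b) = BNot (bsim b)"
| "bsim (BAnd b c) = BAnd (bsim b) (bsim c)"

text \<open>Keeps the mark in array 5 above all written indices: the base never exceeds the mark, so
  \<open>base + e\<close> lies below the mark plus \<open>e + 1\<close>. The sum overshoots, which
  is harmless because time does not depend on the size of numbers.\<close>

definition bump :: "nexp \<Rightarrow> com" where
  "bump e = NSet 5 (NLit 0) (NAdd (NGet 5 (NLit 0)) (NAdd (nsim e) (NLit 1)))"

primrec sim :: "com \<Rightarrow> com" where
  "sim Skip = Skip"
| "sim (NSet a e f) =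
     Seq (bump e) (NSet (a + 20) (NAdd (NGet 4 (NLit 0)) (nsim e)) (nsim f))"
| "sim (RSet a e f g) =
     Seq (bump e) (RSet (a + 20) (NAdd (NGet 4 (NLit 0)) (nsim e)) (nsim f) (rsim g))"
| "sim (Flip a e) =
     Seq (bump e) (Flip (a + 20) (NAdd (NGet 4 (NLit 0)) (nsim e)))"
| "sim (Seq c1 c2) = Seq (sim c1) (sim c2)"
| "sim (Cond b c1 c2) = Cond (bsim b) (sim c1) (sim c2)"
| "sim (While b c) = While (bsim b) (sim c)"

lemma deterministic_sim [simp]: "deterministic (sim c) = deterministic c"
  by (induction c) (auto simp: bump_def)

definition fresh :: "memory \<Rightarrow> bool" where
  "fresh s \<longleftrightarrow> (\<forall>a i j. nats s 5 0 \<le> i \<longrightarrow> nats s (a + 20) i = 0 \<and> reals s (a + 20) i j = 0)"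

text \<open>\<open>s0\<close> is the memory at the start of the call. It supplies the base and those
  arrays of the caller that must survive; array 5 is exempt because the mark moves.\<close>

definition simulates :: "memory \<Rightarrow> memory \<Rightarrow> memory \<Rightarrow> bool" where
  "simulates s0 s s' \<longleftrightarrow>
     (\<forall>a i. nats s' (a + 20) (nats s0 4 0 + i) = nats s a i) \<and>
     (\<forall>a i j. reals s' (a + 20) (nats s0 4 0 + i) j = reals s a i j) \<and>
     (\<forall>a<20. a \<noteq> 5 \<longrightarrow> nats s' a = nats s0 a) \<and>
     (\<forall>a<20. reals s' a = reals s0 a) \<and>
     nats s0 4 0 \<le> nats s' 5 0 \<and> fresh s'"

lemma nval_nsim: "simulates s0 s s' \<Longrightarrow> nval (nsim e) s' = nval e s"
  by (induction e) (auto simp: simulates_def)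

lemma rval_rsim: "simulates s0 s s' \<Longrightarrow> rval z (rsim e) s' = rval z e s"
  by (induction e) (auto simp: nval_nsim, auto simp: simulates_def)

lemma bval_bsim: "simulates s0 s s' \<Longrightarrow> bval z (bsim b) s' = bval z b s"
  by (induction b) (auto simp: nval_nsim rval_rsim)

text \<open>The worst case is an array read, whose address gains three nodes: an addition and a read
  of the base.\<close>

lemma ntime_nsim: "ntime (nsim e) \<le> 4 * ntime e"
  by (induction e) auto

lemma rtime_rsim: "rtime (rsim e) \<le> 4 * rtime e"
proof (induction e)
  case (RGet a e f)
  then show ?case using ntime_nsim[of e] ntime_nsim[of f] by simp
next
  case (ROfNat e)
  then show ?case using ntime_nsim[of e] by simp
qed auto

lemma btime_bsim: "btime (bsim b) \<le> 4 * btime b"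
proof (induction b)
  case (NLess e f)
  then show ?case using ntime_nsim[of e] ntime_nsim[of f] by simp
next
  case (RLess e f)
  then show ?case using rtime_rsim[of e] rtime_rsim[of f] by simp
qed auto

text \<open>The mark is raised before the write, so the new cell lies below it and freshness
  survives.\<close>

lemma simulates_nset:
  assumes "simulates s0 s s'"
  shows "simulates s0 (nset a i v s)
    (nset (a + 20) (nats s0 4 0 + i) v (nset 5 0 (Suc (nats s' 5 0 + i)) s'))"
  using assms by (auto simp: simulates_def fresh_def nats_nset fun_eq_iff)

lemma simulates_rset:
  assumes "simulates s0 s s'"
  shows "simulates s0 (rset a i j v s)
    (rset (a + 20) (nats s0 4 0 + i) j v (nset 5 0 (Suc (nats s' 5 0 + i)) s'))"
  using assms by (auto simp: simulates_def fresh_def nats_nset reals_rset fun_eq_iff)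

lemma simulates_bump:
  assumes "simulates s0 s s'"
  shows "simulates s0 s (nset 5 0 (Suc (nats s' 5 0 + i)) s')"
  using assms by (auto simp: simulates_def fresh_def nats_nset fun_eq_iff)

lemma simulates_base: "simulates s0 s s' \<Longrightarrow> nats s' 4 0 = nats s0 4 0"
  by (simp add: simulates_def)

text \<open>Reachable outcomes of a loop admit rule induction: the support of every approximation of
  the fixpoint stays inside the set described by \<open>Q\<close>, and such inclusions are
  admissible.\<close>

lemma set_spmf_while_induct [consumes 1, case_names stop step]:
  assumes "x \<in> set_spmf (while_spmf b t f s)"
    and "\<And>s. \<not> b s \<Longrightarrow> Q s (t, s)"
    and "\<And>s t1 s1 t2 s2. b s \<Longrightarrow> (t1, s1) \<in> set_spmf (f s) \<Longrightarrow> Q s1 (t2, s2) \<Longrightarrow> Q s (t + t1 + t2, s2)"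
  shows "Q s x"
proof -
  have "\<forall>s. set_spmf (while_spmf b t f s) \<subseteq> {x. Q s x}"
  proof (induction rule: while_spmf.fixp_induct)
    case 1
    show ?case unfolding curry_def by (auto intro!: cont_intro)
  next
    case 2
    show ?case by simp
  next
    case (3 w)
    show ?case
    proof
      fix s
      have "Q s (t + t1 + t2, s2)"
        if "b s" "(t1, s1) \<in> set_spmf (f s)" "(t2, s2) \<in> set_spmf (w b t f s1)" for t1 s1 t2 s2
        using that 3 assms(3) by blast
      then show "set_spmf (if b s then bind_spmf (f s) (\<lambda>(t1, s1).
          map_spmf (\<lambda>(t2, s2). (t + t1 + t2, s2)) (w b t f s1)) else return_spmf (t, s)) \<subseteq> {x. Q s x}"
        using assms(2) by (auto simp: set_bind_spmf)
    qed
  qed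
  with assms(1) show ?thesis by blast
qed

text \<open>Compares two loops through a projection \<open>h\<close> of memories. Times are
  forgotten on both sides, since the bodies need not take equally long.\<close>

lemma map_spmf_while:
  assumes test: "\<And>s'. I s' \<Longrightarrow> b' s' = b (h s')"
    and body: "\<And>s'. I s' \<Longrightarrow> map_spmf (h \<circ> snd) (f' s') = map_spmf snd (f (h s'))"
    and inv: "\<And>s' x. I s' \<Longrightarrow> x \<in> set_spmf (f' s') \<Longrightarrow> I (snd x)"
    and "I s'"
  shows "map_spmf (h \<circ> snd) (while_spmf b' t' f' s') = map_spmf snd (while_spmf b t f (h s'))"
proof -
  have "\<forall>s'. I s' \<longrightarrow> map_spmf (h \<circ> snd) (while_spmf b' t' f' s') = map_spmf snd (while_spmf b t f (h s'))"
  \<comment> \<open>One induction treats both loops: test, time and body are arguments of the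
    recursive function, so the same approximation \<open>w\<close> occurs on either side.\<close>
  proof (induction rule: while_spmf.fixp_induct)
    case 1
    show ?case unfolding curry_def
      by (intro admissible_all admissible_imp
          admissible_eq_mcontI[where lub=lub_spmf and ord="ord_spmf (=)"] mcont_map_spmf mcont_call)
  next
    case 2
    show ?case by simp
  next
    case (3 w)
    have 1: "map_spmf (h \<circ> snd) (bind_spmf (f' s') (\<lambda>(t1, s1).
          map_spmf (\<lambda>(t2, s2). (t' + t1 + t2, s2)) (w b' t' f' s1)))
      = map_spmf snd (bind_spmf (f (h s')) (\<lambda>(t1, s1).
          map_spmf (\<lambda>(t2, s2). (t + t1 + t2, s2)) (w b t f s1)))" if "I s'" for s'
    proof -
      have "map_spmf (h \<circ> snd) (bind_spmf (f' s') (\<lambda>(t1, s1).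
          map_spmf (\<lambda>(t2, s2). (t' + t1 + t2, s2)) (w b' t' f' s1))) =
          bind_spmf (f' s') (\<lambda>x. map_spmf (h \<circ> snd) (w b' t' f' (snd x)))"
        by (simp add: map_spmf_bind_spmf o_def split_def spmf.map_comp)
      also have "\<dots> = bind_spmf (f' s') (\<lambda>x. map_spmf snd (w b t f (h (snd x))))"
        using 3 inv[OF that] by (intro bind_spmf_cong refl) blast
      also have "\<dots> = bind_spmf (map_spmf (h \<circ> snd) (f' s')) (\<lambda>s. map_spmf snd (w b t f s))"
        by (simp add: bind_map_spmf o_def)
      also have "\<dots> = bind_spmf (f (h s')) (\<lambda>x. map_spmf snd (w b t f (snd x)))"
        unfolding body[OF that] by (simp add: bind_map_spmf o_def)
      also have "\<dots> = map_spmf snd (bind_spmf (f (h s')) (\<lambda>(t1, s1).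
          map_spmf (\<lambda>(t2, s2). (t + t1 + t2, s2)) (w b t f s1)))"
        by (simp add: map_spmf_bind_spmf o_def split_def spmf.map_comp)
      finally show ?thesis .
    qed
    show ?case
    proof (intro allI impI)
      fix s' assume I: "I s'"
      show "map_spmf (h \<circ> snd) (if b' s' then bind_spmf (f' s') (\<lambda>(t1, s1).
          map_spmf (\<lambda>(t2, s2). (t' + t1 + t2, s2)) (w b' t' f' s1)) else return_spmf (t', s')) =
        map_spmf snd (if b (h s') then bind_spmf (f (h s')) (\<lambda>(t1, s1).
          map_spmf (\<lambda>(t2, s2). (t + t1 + t2, s2)) (w b t f s1)) else return_spmf (t, h s'))"
        unfolding test[OF I] using 1[OF I]
        by (cases "b (h s')") (simp_all only: if_True if_False, simp)
    qed
  qed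
  with assms(4) show ?thesis by blast
qed

text \<open>The factor 20 covers the dearest case, a write: the index is evaluated twice, each time
  at most 4 times as slowly as before, and 11 steps are added.\<close>

lemma sim_outcome:
  assumes "simulates s0 s s'" and "(t', s'') \<in> set_spmf (exec z (sim c) s')"
  shows "\<exists>t s1. (t, s1) \<in> set_spmf (exec z c s) \<and> t' \<le> 20 * t \<and> simulates s0 s1 s''"
  using assms
proof (induction c arbitrary: s s' t' s'')
  case Skip
  then show ?case by simp
next
  case (NSet a e f)
  then show ?case
    using simulates_nset[OF NSet(1), of a "nval e s" "nval f s"] ntime_nsim[of e] ntime_nsim[of f]
    by (simp add: bump_def nval_nsim[OF NSet(1)] nval_nsim[OF simulates_bump[OF NSet(1)]]
       simulates_base[OF NSet(1)] nats_nset)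
next
  case (RSet a e f g)
  then show ?case
    using simulates_rset[OF RSet(1), of a "nval e s" "nval f s" "rval z g s"] ntime_nsim[of e]
      ntime_nsim[of f] rtime_rsim[of g]
    by (simp add: bump_def nval_nsim[OF RSet(1)] nval_nsim[OF simulates_bump[OF RSet(1)]]
        rval_rsim[OF simulates_bump[OF RSet(1)]] simulates_base[OF RSet(1)] nats_nset)
next
  case (Flip a e)
  from Flip(2) obtain v where 1: "t' = 11 + 2 * ntime (nsim e)"
      "s'' = nset (a + 20) (nats s0 4 0 + nval e s) (of_bool v) (nset 5 0 (Suc (nats s' 5 0 + nval e s)) s')"
    by (auto simp: bump_def nval_nsim[OF Flip(1)] nval_nsim[OF simulates_bump[OF Flip(1)]]
       simulates_base[OF Flip(1)] nats_nset simp del: of_bool_eq split: if_splits)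
  have "(1 + ntime e, nset a (nval e s) (of_bool v) s) \<in> set_spmf (exec z (Flip a e) s)" by simp
  then show ?case
    using simulates_nset[OF Flip(1), of a "nval e s" "of_bool v"] ntime_nsim[of e] 1
    by (intro exI[of _ "1 + ntime e"] exI[of _ "nset a (nval e s) (of_bool v) s"]) auto
next
  case (Seq c1 c2)
  from Seq.prems(2) obtain t1 s1 t2 where
    1: "(t1, s1) \<in> set_spmf (exec z (sim c1) s')" "(t2, s'') \<in> set_spmf (exec z (sim c2) s1)"
      "t' = t1 + t2"
    by (auto simp: set_bind_spmf)
  from Seq.IH(1)[OF Seq.prems(1) 1(1)] obtain u1 r1 where
    2: "(u1, r1) \<in> set_spmf (exec z c1 s)" "t1 \<le> 20 * u1" "simulates s0 r1 s1" by blast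
  from Seq.IH(2)[OF 2(3) 1(2)] obtain u2 r2 where
    3: "(u2, r2) \<in> set_spmf (exec z c2 r1)" "t2 \<le> 20 * u2" "simulates s0 r2 s''" by blast
  have "(u1 + u2, r2) \<in> set_spmf (exec z (Seq c1 c2) s)"
    using 2(1) 3(1) by (force simp: set_bind_spmf)
  then show ?case using 1(3) 2(2) 3(2,3) by (intro exI[of _ "u1 + u2"] exI[of _ r2]) simp
next
  case (Cond b c1 c2)
  let ?c = "if bval z b s then c1 else c2"
  from Cond.prems obtain t1 where
    1: "(t1, s'') \<in> set_spmf (exec z (sim ?c) s')" "t' = 1 + btime (bsim b) + t1"
    by (auto simp: bval_bsim split: if_splits)
  then obtain u r where 2: "(u, r) \<in> set_spmf (exec z ?c s)" "t1 \<le> 20 * u" "simulates s0 r s''"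
    using Cond.IH Cond.prems(1) by (metis (full_types))
  have "(1 + btime b + u, r) \<in> set_spmf (exec z (Cond b c1 c2) s)"
    using 2(1) by (force split: if_splits)
  then show ?case using 1(2) 2(2,3) btime_bsim[of b]
    by (intro exI[of _ "1 + btime b + u"] exI[of _ r]) simp
next
  case (While b c)
  from While.prems(2)[unfolded sim.simps exec.simps]
  \<comment> \<open>The abstract memory is quantified inside because it changes from one iteration
    to the next.\<close>
  have "\<forall>s. simulates s0 s s' \<longrightarrow>
    (\<exists>t s1. (t, s1) \<in> set_spmf (exec z (While b c) s) \<and> fst (t', s'') \<le> 20 * t \<and> simulates s0 s1 (snd (t', s'')))"
  proof (induction rule: set_spmf_while_induct)
    case (stop s')
    have "(1 + btime b, s) \<in> set_spmf (exec z (While b c) s)" if "\<not> bval z b s" for s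
      unfolding exec.simps using that by (subst while_spmf.simps) simp
    then have "(1 + btime b, s) \<in> set_spmf (exec z (While b c) s)" if "simulates s0 s s'" for s
      using stop bval_bsim[OF that] by blast
    moreover have "1 + btime (bsim b) \<le> 20 * (1 + btime b)" using btime_bsim[of b] by simp
    ultimately show ?case by (metis fst_conv snd_conv)
  next
    case (step s' t1 s1 t2 s2)
    show ?case
    proof (intro allI impI)
      fix s assume S: "simulates s0 s s'"
      from While.IH[OF S step(2)] obtain u1 r1 where
        3: "(u1, r1) \<in> set_spmf (exec z c s)" "t1 \<le> 20 * u1" "simulates s0 r1 s1" by blast
      then obtain u2 r2 where
        4: "(u2, r2) \<in> set_spmf (exec z (While b c) r1)" "t2 \<le> 20 * u2" "simulates s0 r2 s2"
        using step(3) by fastforce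
      have "bval z b s" using step(1) bval_bsim[OF S] by simp
      then have "(1 + btime b + u1 + u2, r2) \<in> set_spmf (exec z (While b c) s)"
        using 3(1) 4(1) unfolding exec.simps
        by (subst while_spmf.simps) (force simp: set_bind_spmf)
      then show "\<exists>t s1. (t, s1) \<in> set_spmf (exec z (While b c) s) \<and>
          fst (1 + btime (bsim b) + t1 + t2, s2) \<le> 20 * t \<and>
          simulates s0 s1 (snd (1 + btime (bsim b) + t1 + t2, s2))"
        using 3(2) 4(2,3) btime_bsim[of b]
        by (intro exI[of _ "1 + btime b + u1 + u2"] exI[of _ r2]) simp
    qed
  qed
  with While.prems(1) show ?case by simp
qed

text \<open>Turns the relation \<open>simulates\<close> into a function, so that distributions can
  be compared by \<open>map_spmf\<close>.\<close>

definition abstraction :: "memory \<Rightarrow> memory" where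
  "abstraction s = \<lparr>nats = (\<lambda>a i. nats s (a + 20) (nats s 4 0 + i)),
     reals = (\<lambda>a i j. reals s (a + 20) (nats s 4 0 + i) j)\<rparr>"

lemma simulates_abstraction: "simulates s0 s s' \<Longrightarrow> s = abstraction s'"
  by (auto simp: simulates_def abstraction_def fun_eq_iff intro!: memory.equality)

text \<open>\<open>sim_outcome\<close> controls only the support; transferring a success probability
  requires equal distributions of final memories.\<close>

lemma sim_distribution:
  assumes "simulates s0 s s'"
  shows "map_spmf (abstraction \<circ> snd) (exec z (sim c) s') = map_spmf snd (exec z c s)"
  using assms
proof (induction c arbitrary: s s')
  case Skip
  then show ?case by (simp add: simulates_abstraction[symmetric])
next
  case (NSet a e f)
  then show ?case
    using simulates_abstraction[OF simulates_nset[OF NSet, of a "nval e s" "nval f s"]]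
    by (simp add: bump_def nval_nsim[OF NSet] nval_nsim[OF simulates_bump[OF NSet]]
       simulates_base[OF NSet] nats_nset)
next
  case (RSet a e f g)
  then show ?case
    using simulates_abstraction[OF simulates_rset[OF RSet, of a "nval e s" "nval f s" "rval z g s"]]
    by (simp add: bump_def nval_nsim[OF RSet] nval_nsim[OF simulates_bump[OF RSet]]
        rval_rsim[OF simulates_bump[OF RSet]] simulates_base[OF RSet] nats_nset)
next
  case (Flip a e)
  then show ?case
    using simulates_abstraction[OF simulates_nset[OF Flip, of a "nval e s"]]
    by (simp add: bump_def nval_nsim[OF Flip] nval_nsim[OF simulates_bump[OF Flip]]
       simulates_base[OF Flip] nats_nset spmf.map_comp o_def)
next
  case (Seq c1 c2)
  have "map_spmf (abstraction \<circ> snd) (exec z (sim (Seq c1 c2)) s')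
     = bind_spmf (exec z (sim c1) s') (\<lambda>x. map_spmf (abstraction \<circ> snd) (exec z (sim c2) (snd x)))"
    by (simp add: map_spmf_bind_spmf o_def split_def spmf.map_comp)
  also have "\<dots> = bind_spmf (exec z (sim c1) s') (\<lambda>x. map_spmf snd (exec z c2 (abstraction (snd x))))"
    using sim_outcome[OF Seq.prems] simulates_abstraction
    by (intro bind_spmf_cong[OF refl] Seq.IH(2)) (metis prod.collapse)
  also have "\<dots> = bind_spmf (map_spmf (abstraction \<circ> snd) (exec z (sim c1) s')) (\<lambda>s. map_spmf snd (exec z c2 s))"
    by (simp add: bind_map_spmf o_def)
  also have "\<dots> = map_spmf snd (exec z (Seq c1 c2) s)"
    unfolding Seq.IH(1)[OF Seq.prems]
    by (simp add: bind_map_spmf map_spmf_bind_spmf o_def split_def spmf.map_comp)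
  finally show ?case .
next
  case (Cond b c1 c2)
  then show ?case
    by (simp add: bval_bsim[OF Cond.prems] spmf.map_comp o_def split_def)
next
  case (While b c)
  have "map_spmf (abstraction \<circ> snd) (exec z (sim (While b c)) s') =
    map_spmf snd (exec z (While b c) (abstraction s'))"
    unfolding sim.simps exec.simps
  proof (rule map_spmf_while[where I="\<lambda>s'. simulates s0 (abstraction s') s'"])
    show "simulates s0 (abstraction s') s'" using While.prems simulates_abstraction by metis
    show "simulates s0 (abstraction (snd x)) (snd x)"
      if "simulates s0 (abstraction s') s'" "x \<in> set_spmf (exec z (sim c) s')" for s' x
      using sim_outcome[OF that(1)] that(2) simulates_abstraction by (metis prod.collapse)
  qed (simp_all add: bval_bsim While.IH)
  then show ?case using While.prems simulates_abstraction by metis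
qed

lemma sim_wp:
  assumes "simulates s0 s s'" and "wp z c s R"
  shows "wp z (sim c) s' (\<lambda>t' s''. \<exists>t s1. R t s1 \<and> t' \<le> 20 * t \<and> simulates s0 s1 s'')"
proof -
  \<comment> \<open>\<open>map_spmf\<close> preserves the total mass, so losslessness transfers
    along the equality of distributions.\<close>
  have "lossless_spmf (exec z (sim c) s')"
    using arg_cong[OF sim_distribution[OF assms(1), of z c], of lossless_spmf] assms(2)
    by (simp add: wp_def)
  then show ?thesis using assms(2) sim_outcome[OF assms(1)] unfolding wp_def by fast
qed

lemma sim_pr:
  assumes "simulates s0 s s'" and "pr z c s G \<ge> p"
  shows "pr z (sim c) s' (\<lambda>s''. G (abstraction s'')) \<ge> p"
proof -
  have "pr z (sim c) s' (\<lambda>s''. G (abstraction s''))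
     = measure (measure_spmf (map_spmf (abstraction \<circ> snd) (exec z (sim c) s'))) {s. G s}"
    by (simp add: pr_alt measure_map_spmf vimage_def)
  also have "\<dots> = pr z c s G"
    unfolding sim_distribution[OF assms(1)] by (simp add: pr_alt measure_map_spmf vimage_def)
  finally show ?thesis using assms(2) by simp
qed

section \<open>Costs\<close>

lemma point_cost_nonneg [simp]: "point_cost z d p C \<ge> 0"
  by (simp add: point_cost_def)

lemma cost_nonneg [simp]: "cost z d X C \<ge> 0"
  by (simp add: cost_def sum_nonneg)

text \<open>Exchange argument: values on \<open>A - B\<close> are at most their maximum
  \<open>v\<close>, values on \<open>B - A\<close> are at least \<open>v\<close>, and
  \<open>B - A\<close> has no fewer elements.\<close>

lemma sum_smallest_le:
  fixes f :: "'a \<Rightarrow> real"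
  assumes fin: "finite X" and AB: "A \<subseteq> X" "B \<subseteq> X" "card A \<le> card B"
    and le: "\<And>a x. a \<in> A \<Longrightarrow> x \<in> X - A \<Longrightarrow> f a \<le> f x" and nn: "\<And>x. x \<in> X \<Longrightarrow> f x \<ge> 0"
  shows "sum f A \<le> sum f B"
proof -
  have finA: "finite A" and finB: "finite B" using fin AB finite_subset by auto
  have sA: "sum f A = sum f (A \<inter> B) + sum f (A - B)" using finA
    by (metis Int_Diff_Un Int_Diff_disjoint finite_Diff finite_Int sum.union_disjoint)
  have sB: "sum f B = sum f (A \<inter> B) + sum f (B - A)" using finB
    by (metis Int_Diff_Un Int_Diff_disjoint finite_Diff finite_Int sum.union_disjoint Int_commute)
  have c: "card (A - B) \<le> card (B - A)"
    using AB(3) finA finB by (simp add: card_Diff_subset_Int Int_commute)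
  have "sum f (A - B) \<le> sum f (B - A)"
  proof (cases "A - B = {}")
    case True
    then have "sum f (A - B) = 0" by (simp only: sum.empty)
    moreover have "sum f (B - A) \<ge> 0" using nn AB(2) by (intro sum_nonneg) auto
    ultimately show ?thesis by simp
  next
    case False
    define v where "v = Max (f ` (A - B))"
    have v: "f x \<le> v" if "x \<in> A - B" for x using that finA by (simp add: v_def)
    have "v \<in> f ` (A - B)" unfolding v_def using False finA by (intro Max_in) auto
    then obtain a where a: "a \<in> A - B" "v = f a" by auto
    have "sum f (A - B) \<le> card (A - B) * v" using sum_bounded_above[of "A - B" f v] v by simp
    also have "\<dots> \<le> card (B - A) * v" using c a nn AB(1) by (intro mult_right_mono) auto
    also have "\<dots> \<le> sum f (B - A)"
      using sum_bounded_below[of "B - A" v f] le a AB(2) by auto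
    finally show ?thesis .
  qed
  then show ?thesis using sA sB by simp
qed

text \<open>Sorting the clients by cost, rather than the costs alone, shows which clients make up
  the sum of the smallest values.\<close>

lemma outlier_cost_as_subset:
  assumes "finite X"
  obtains A where "A \<subseteq> X" "card A = card X - m" "outlier_cost z d m X C = cost z d A C"
    "\<And>a x. a \<in> A \<Longrightarrow> x \<in> X - A \<Longrightarrow> point_cost z d a C \<le> point_cost z d x C"
proof -
  let ?f = "\<lambda>p. point_cost z d p C"
  define xs where "xs = sort_key ?f (sorted_list_of_set X)"
  have xs: "set xs = X" "distinct xs" "length xs = card X" "sorted (map ?f xs)"
    using assms by (auto simp: xs_def)
  have "sorted_list_of_multiset (image_mset ?f (mset_set X)) = sorted_list_of_multiset (mset (map ?f xs))"
    by (simp add: xs_def assms flip: mset_set_set)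
  also have "\<dots> = map ?f xs" using xs(4) by (simp only: sorted_list_of_multiset_mset sorted_sort_id)
  finally have eq: "sorted_list_of_multiset (image_mset ?f (mset_set X)) = map ?f xs" .
  define j where "j = card X - m"
  show thesis
  proof (rule that[of "set (take j xs)"])
    show "set (take j xs) \<subseteq> X" using xs(1) set_take_subset by metis
    show "card (set (take j xs)) = card X - m"
      using xs by (simp add: distinct_card j_def)
    show "outlier_cost z d m X C = cost z d (set (take j xs)) C"
      unfolding outlier_cost_def eq cost_def take_map j_def[symmetric]
      using xs(2) by (simp add: sum_list_distinct_conv_sum_set)
    fix a x assume a: "a \<in> set (take j xs)" and x: "x \<in> X - set (take j xs)"
    have "x \<in> set (drop j xs)" using x xs(1)
      by (metis Diff_iff Un_iff append_take_drop_id set_append)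
    with a show "?f a \<le> ?f x"
      using xs(4) sorted_append[of "map ?f (take j xs)" "map ?f (drop j xs)"]
      by (simp flip: map_append)
  qed
qed

text \<open>Fewer than \<open>m\<close> deletions are covered too, because a guess may ask a cell
  for more clients than it has.\<close>

lemma outlier_cost_le:
  assumes "finite X" "Y \<subseteq> X" "card Y \<le> m"
  shows "outlier_cost z d m X C \<le> cost z d (X - Y) C"
proof -
  obtain A where A: "A \<subseteq> X" "card A = card X - m" "outlier_cost z d m X C = cost z d A C"
    "\<And>a x. a \<in> A \<Longrightarrow> x \<in> X - A \<Longrightarrow> point_cost z d a C \<le> point_cost z d x C"
    using outlier_cost_as_subset[OF assms(1)] by metis
  have "card A \<le> card (X - Y)"
    using A(2) assms by (simp add: card_Diff_subset finite_subset)
  then show ?thesis unfolding A(3) cost_def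
    using sum_smallest_le[OF assms(1) A(1) _ _ A(4)] by (simp add: Diff_subset)
qed

lemma outlier_cost_attained:
  assumes "finite X" "m \<le> card X"
  obtains Y where "Y \<subseteq> X" "card Y = m" "outlier_cost z d m X C = cost z d (X - Y) C"
proof -
  obtain A where A: "A \<subseteq> X" "card A = card X - m" "outlier_cost z d m X C = cost z d A C"
    using outlier_cost_as_subset[OF assms(1)] by metis
  show thesis
    using A assms by (intro that[of "X - A"]) (auto simp: card_Diff_subset finite_subset double_diff)
qed

text \<open>Whichever of \<open>\<eta> * a\<close> and \<open>b\<close> is larger, the sum is at
  most a multiple of one summand. For small \<open>\<eta>\<close> the factor at \<open>a\<close> is
  close to 1, at the price of a large factor at \<open>b\<close>.\<close>

lemma powr_add_le:
  fixes a b \<eta> z :: real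
  assumes "a \<ge> 0" "b \<ge> 0" "\<eta> > 0" "z \<ge> 0"
  shows "(a + b) powr z \<le> (1 + \<eta>) powr z * a powr z + (1 + 1 / \<eta>) powr z * b powr z"
proof (cases "b \<le> \<eta> * a")
  case True
  then have "(a + b) powr z \<le> ((1 + \<eta>) * a) powr z"
    using assms by (intro powr_mono2) (auto simp: algebra_simps)
  then show ?thesis using assms by (simp add: powr_mult add_increasing2)
next
  case False
  then have "a + b \<le> (1 + 1 / \<eta>) * b" using assms by (simp add: field_simps)
  then have "(a + b) powr z \<le> ((1 + 1 / \<eta>) * b) powr z"
    using assms by (intro powr_mono2) auto
  then show ?thesis using assms by (simp add: powr_mult add_increasing)
qed

text \<open>The distance before taking the power; the triangle inequality is applied at this
  level.\<close>

definition setdist :: "(nat \<Rightarrow> nat \<Rightarrow> real) \<Rightarrow> nat \<Rightarrow> nat set \<Rightarrow> real" where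
  "setdist d p C = (MIN c\<in>C. d p c)"

lemma setdist_le: "finite C \<Longrightarrow> c \<in> C \<Longrightarrow> setdist d p C \<le> d p c"
  by (simp add: setdist_def)

lemma setdist_attained:
  assumes "finite C" "C \<noteq> {}"
  obtains c where "c \<in> C" "setdist d p C = d p c"
proof -
  have "Min (d p ` C) \<in> d p ` C" using assms by (intro Min_in) auto
  then show ?thesis using that by (auto simp: setdist_def)
qed

text \<open>Cell by cell, clients of \<open>Y\<close> that return are matched with clients of
  \<open>Y'\<close> that leave. A returning client uses the facility of its partner, at extra
  distance at most \<open>D\<close>; at most \<open>m\<close> such detours give the additive
  term.\<close>

lemma swap_outliers:
  fixes cell :: "nat \<Rightarrow> nat"
  assumes met: "Metric_space \<Gamma> d" and X: "X \<subseteq> \<Gamma>" "finite X" and C: "C \<subseteq> \<Gamma>" "finite C" "C \<noteq> {}"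
    and Y: "Y \<subseteq> X" "card Y \<le> m" and Y': "Y' \<subseteq> X"
    and count: "\<And>j. card {p \<in> Y. cell p = j} = card {p \<in> Y'. cell p = j}"
    and diam: "\<And>p q. p \<in> X \<Longrightarrow> q \<in> X \<Longrightarrow> cell p = cell q \<Longrightarrow> d p q \<le> D"
    and pos: "D \<ge> 0" "\<eta> > 0" "z \<ge> 0"
  shows "cost z d (X - Y') C
           \<le> (1 + \<eta>) powr z * cost z d (X - Y) C + (1 + 1 / \<eta>) powr z * (real m * D powr z)"
proof -
  interpret Metric_space \<Gamma> d by fact
  let ?f = "\<lambda>p. point_cost z d p C"
  have fin: "finite Y" "finite Y'" using X(2) Y(1) Y' by (auto intro: finite_subset)
  have "\<exists>h. bij_betw h {p \<in> Y - Y'. cell p = j} {p \<in> Y' - Y. cell p = j}" for j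
  proof (rule finite_same_card_bij)
    have e: "{p \<in> A - B. cell p = j} = {p \<in> A. cell p = j} - {p \<in> B. cell p = j}"
        for A B by auto
    \<comment> \<open>Removing the common part of \<open>Y\<close> and \<open>Y'\<close> keeps the
      counts equal within each cell.\<close>
    show "card {p \<in> Y - Y'. cell p = j} = card {p \<in> Y' - Y. cell p = j}"
      unfolding e using fin count[of j] by (simp add: card_Diff_subset_Int Int_commute)
  qed (use fin in auto)
  then obtain h where h: "\<And>j. bij_betw (h j) {p \<in> Y - Y'. cell p = j} {p \<in> Y' - Y. cell p = j}"
    by metis
  define g where "g p = h (cell p) p" for p
  have g: "g p \<in> Y' - Y" "cell (g p) = cell p" if "p \<in> Y - Y'" for p
    using bij_betwE[OF h[of "cell p"]] that by (auto simp: g_def)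
  have inj: "inj_on g (Y - Y')"
  proof (rule inj_onI)
    fix p q assume pq: "p \<in> Y - Y'" "q \<in> Y - Y'" "g p = g q"
    then have "cell p = cell q" using g by metis
    then show "p = q"
      using pq bij_betw_imp_inj_on[OF h[of "cell p"]] by (auto simp: g_def inj_on_def)
  qed
  have dist: "setdist d p C \<le> setdist d q C + D" "setdist d q C \<ge> 0"
    if pq: "p \<in> X" "q \<in> X" "cell p = cell q" for p q
  proof -
    obtain c where c: "c \<in> C" "setdist d q C = d q c" using C setdist_attained by metis
    have "setdist d p C \<le> d p c" using C c by (simp add: setdist_le)
    also have "\<dots> \<le> d p q + d q c" using X C c pq by (intro triangle) auto
    finally show "setdist d p C \<le> setdist d q C + D" using diam[OF pq] c by simp
    show "setdist d q C \<ge> 0" using c by simp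
  qed
  have pc: "?f p \<le> (1 + \<eta>) powr z * ?f (g p) + (1 + 1 / \<eta>) powr z * D powr z" if p: "p \<in> Y - Y'" for p
  proof -
    have pX: "p \<in> X" "g p \<in> X" using p g[OF p] Y Y' by auto
    have "?f p \<le> (setdist d (g p) C + D) powr z"
      unfolding point_cost_def setdist_def[symmetric]
      using dist[of p "g p"] dist(2)[of p p] pX g(2)[OF p] pos by (intro powr_mono2) auto
    also have "\<dots> \<le> (1 + \<eta>) powr z * setdist d (g p) C powr z + (1 + 1 / \<eta>) powr z * D powr z"
      using dist(2)[of "g p" "g p"] pX pos by (intro powr_add_le) auto
    finally show ?thesis by (simp add: point_cost_def setdist_def)
  qed
  have one: "(1 + \<eta>) powr z \<ge> 1" using pos by (simp add: ge_one_powr_ge_zero)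
  have "sum ?f (Y - Y') \<le> (\<Sum>p\<in>Y - Y'. (1 + \<eta>) powr z * ?f (g p) + (1 + 1 / \<eta>) powr z * D powr z)"
    by (intro sum_mono pc)
  also have "\<dots> = (1 + \<eta>) powr z * sum ?f (g ` (Y - Y'))
       + (1 + 1 / \<eta>) powr z * (card (Y - Y') * D powr z)"
    using inj by (simp add: sum.distrib sum_distrib_left sum.reindex)
  also have "\<dots> \<le> (1 + \<eta>) powr z * sum ?f (Y' - Y) + (1 + 1 / \<eta>) powr z * (real m * D powr z)"
  proof -
    have "sum ?f (g ` (Y - Y')) \<le> sum ?f (Y' - Y)"
      using g fin by (intro sum_mono2) auto
    moreover have "card (Y - Y') \<le> m" using Y(2) card_mono[OF fin(1), of "Y - Y'"] by auto
    ultimately show ?thesis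
      by (intro add_mono mult_left_mono mult_right_mono) auto
  qed
  finally have 1: "sum ?f (Y - Y') \<le> (1 + \<eta>) powr z * sum ?f (Y' - Y)
    + (1 + 1 / \<eta>) powr z * (real m * D powr z)" .
  have "cost z d (X - Y') C = sum ?f (X - (Y \<union> Y')) + sum ?f (Y - Y')"
  proof -
    have "X - Y' = (X - (Y \<union> Y')) \<union> (Y - Y')" using Y by auto
    then show ?thesis unfolding cost_def using X fin by (subst sum.union_disjoint[symmetric]) auto
  qed
  \<comment> \<open>Clients served in both solutions are charged the factor as well; it is at least
    1.\<close>
  also have "\<dots> \<le> (1 + \<eta>) powr z * sum ?f (X - (Y \<union> Y')) + ((1 + \<eta>) powr z * sum ?f (Y' - Y)
    + (1 + 1 / \<eta>) powr z * (real m * D powr z))"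
    using 1 one mult_right_mono[OF one, of "sum ?f (X - (Y \<union> Y'))"] by (simp add: sum_nonneg)
  also have "\<dots> = (1 + \<eta>) powr z * cost z d (X - Y) C + (1 + 1 / \<eta>) powr z * (real m * D powr z)"
  proof -
    have "X - Y = (X - (Y \<union> Y')) \<union> (Y' - Y)" using Y' by auto
    then have "cost z d (X - Y) C = sum ?f (X - (Y \<union> Y')) + sum ?f (Y' - Y)"
      unfolding cost_def using X fin by (subst sum.union_disjoint[symmetric]) auto
    then show ?thesis by (simp add: algebra_simps)
  qed
  finally show ?thesis .
qed

text \<open>Two points of \<open>U\<close> within \<open>r / 2\<close> of the same center would be
  closer than \<open>r\<close>, so mapping near points to their centers is injective and at most
  \<open>k\<close> points are near. \<open>N\<close> of the remaining non-outliers each pay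
  \<open>(r / 2) powr z\<close>.\<close>

lemma separated_lower_bound:
  assumes met: "Metric_space \<Gamma> d" and X: "X \<subseteq> \<Gamma>" "finite X" and C: "C \<subseteq> \<Gamma>" "finite C" "C \<noteq> {}" "card C \<le> k"
    and Y: "Y \<subseteq> X" "card Y \<le> m"
    and U: "U \<subseteq> X" "k + m + N \<le> card U"
    and sep: "\<And>u v. u \<in> U \<Longrightarrow> v \<in> U \<Longrightarrow> u \<noteq> v \<Longrightarrow> r \<le> d u v" and pos: "r \<ge> 0" "z \<ge> 0"
  shows "real N * (r / 2) powr z \<le> cost z d (X - Y) C"
proof -
  interpret Metric_space \<Gamma> d by fact
  have fin: "finite Y" "finite U" using X(2) Y(1) U(1) by (auto intro: finite_subset)
  define V where "V = {u \<in> U - Y. setdist d u C < r / 2}"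
  have "\<forall>u. \<exists>c. c \<in> C \<and> setdist d u C = d u c" using setdist_attained C by metis
  then obtain nc where nc: "\<And>u. nc u \<in> C" "\<And>u. setdist d u C = d u (nc u)" by metis
  have "inj_on nc V"
  proof (rule inj_onI, rule ccontr)
    fix u v assume uv: "u \<in> V" "v \<in> V" "nc u = nc v" "u \<noteq> v"
    have "d u v \<le> d u (nc u) + d (nc u) v"
      using uv U X C nc(1) unfolding V_def by (intro triangle) auto
    also have "\<dots> = setdist d u C + setdist d v C" using nc uv(3) commute by metis
    also have "\<dots> < r" using uv unfolding V_def by auto
    finally show False using sep[of u v] uv unfolding V_def by auto
  qed
  then have "card V \<le> card C" using nc C by (intro card_inj_on_le[of nc]) auto
  moreover have "card (U - Y) \<ge> card U - m"
    using diff_card_le_card_Diff[OF fin(1), of U] Y(2) by linarith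
  moreover have "card (U - Y - V) = card (U - Y) - card V"
    using fin by (intro card_Diff_subset) (auto simp: V_def)
  ultimately have N: "N \<le> card (U - Y - V)" using U C by linarith
  have "real N * (r / 2) powr z \<le> card (U - Y - V) * (r / 2) powr z"
    using N by (intro mult_right_mono) auto
  also have "\<dots> \<le> (\<Sum>p\<in>U - Y - V. point_cost z d p C)"
  proof (rule sum_bounded_below)
    fix p assume "p \<in> U - Y - V"
    then have "r / 2 \<le> setdist d p C" unfolding V_def by auto
    then show "(r / 2) powr z \<le> point_cost z d p C"
      unfolding point_cost_def setdist_def[symmetric] using pos by (intro powr_mono2) auto
  qed
  also have "\<dots> \<le> cost z d (X - Y) C"
    unfolding cost_def using X U by (intro sum_mono2) auto
  finally show ?thesis .
qed

lemma finite_feasible: "finite F \<Longrightarrow> finite (feasible F k)"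
  by (rule finite_subset[of _ "Pow F"]) (auto simp: feasible_def)

lemma feasible_nonempty: "F \<noteq> {} \<Longrightarrow> k \<ge> 1 \<Longrightarrow> feasible F k \<noteq> {}"
proof -
  assume "F \<noteq> {}" "k \<ge> 1"
  then obtain f where "{f} \<in> feasible F k" by (auto simp: feasible_def)
  then show ?thesis by blast
qed

lemma opt_le: "finite F \<Longrightarrow> C \<in> feasible F k \<Longrightarrow> opt z d X F k \<le> cost z d X C"
  by (simp add: opt_def finite_feasible)

text \<open>The slack \<open>\<eta>\<close> makes \<open>(1 + \<eta>) powr z\<close> at most \<open>1 + \<epsilon> / (2 * \<beta>)\<close>; the number \<open>L\<close> of extra centers
  per outlier then absorbs the additive error of \<open>swap_outliers\<close> into another \<open>\<epsilon> / (2 * \<beta>)\<close>.\<close>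

definition slack :: "real \<Rightarrow> real \<Rightarrow> real \<Rightarrow> real" where
  "slack z \<beta> \<epsilon> = \<epsilon> / (4 * \<beta> * z)"

definition extra_centers :: "real \<Rightarrow> real \<Rightarrow> real \<Rightarrow> nat" where
  "extra_centers z \<beta> \<epsilon> = nat \<lceil>(1 + 1 / slack z \<beta> \<epsilon>) powr z * 4 powr z * (2 * \<beta> / \<epsilon>)\<rceil>"

text \<open>With \<open>y = \<eta> * z\<close>, the left side is at most \<open>exp y\<close>, which
  is at most \<open>1 + y + y\<^sup>2\<close> and hence \<open>1 + 2 * y\<close> for
  \<open>y\<close> in the unit interval. The factor 2 explains the 4 in
  \<open>slack\<close>.\<close>

lemma slack_powr:
  assumes "z \<ge> 1" "\<beta> \<ge> 1" "0 < \<epsilon>" "\<epsilon> \<le> 1"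
  shows "(1 + slack z \<beta> \<epsilon>) powr z \<le> 1 + \<epsilon> / (2 * \<beta>)"
proof -
  let ?y = "slack z \<beta> \<epsilon> * z"
  have y: "?y = \<epsilon> / (4 * \<beta>)" using assms by (simp add: slack_def)
  have y01: "0 \<le> ?y" "?y \<le> 1" unfolding y using assms by (auto simp: field_simps)
  have e: "slack z \<beta> \<epsilon> > 0" using assms by (simp add: slack_def)
  have "(1 + slack z \<beta> \<epsilon>) powr z = exp (z * ln (1 + slack z \<beta> \<epsilon>))" using e by (simp add: powr_def)
  also have "\<dots> \<le> exp ?y"
    using ln_add_one_self_le_self[of "slack z \<beta> \<epsilon>"] e assms by (simp add: mult.commute)
  also have "\<dots> \<le> 1 + ?y + ?y\<^sup>2" using exp_bound[OF y01] .
  also have "\<dots> \<le> 1 + 2 * ?y" using mult_left_le[OF y01(2,1)] by (simp add: power2_eq_square mult.commute)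
  also have "\<dots> = 1 + \<epsilon> / (2 * \<beta>)" unfolding y by simp
  finally show ?thesis .
qed

text \<open>\<open>Y\<close> is the outlier set of an optimal solution. Keeping the centers of that
  solution bounds the optimum after any other deletion \<open>Y'\<close> with the same cell counts.
  About the cells only small diameter and a large separated set matter.\<close>

lemma good_guess:
  fixes cell :: "nat \<Rightarrow> nat"
  assumes inst: "outlier_instance \<Gamma> d X F k m" and par: "z \<ge> 1" "\<beta> \<ge> 1" "0 < \<epsilon>" "\<epsilon> \<le> 1"
    and diam: "\<And>p q. p \<in> X \<Longrightarrow> q \<in> X \<Longrightarrow> cell p = cell q \<Longrightarrow> d p q \<le> 2 * r" and r: "r \<ge> 0"
    and sep: "r = 0 \<or> (\<exists>U\<subseteq>X. k + m + extra_centers z \<beta> \<epsilon> * m \<le> card U \<and>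
       (\<forall>u\<in>U. \<forall>v\<in>U. u \<noteq> v \<longrightarrow> r \<le> d u v))"
  shows "\<exists>Y\<subseteq>X. card Y = m \<and> (\<forall>Y'\<subseteq>X. (\<forall>j. card {p \<in> Y. cell p = j} = card {p \<in> Y'. cell p = j}) \<longrightarrow>
           \<beta> * opt z d (X - Y') F k \<le> (\<beta> + \<epsilon>) * outlier_opt z d X F k m)"
proof -
  let ?L = "extra_centers z \<beta> \<epsilon>" and ?\<eta> = "slack z \<beta> \<epsilon>" and ?OPT = "outlier_opt z d X F k m"
  have I: "Metric_space \<Gamma> d" "X \<subseteq> \<Gamma>" "F \<subseteq> \<Gamma>" "finite X" "finite F" "F \<noteq> {}" "k \<ge> 1" "m \<le> card X"
    using inst by (auto simp: outlier_instance_def clustering_instance_def)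
  have "?OPT \<in> outlier_cost z d m X ` feasible F k"
    unfolding outlier_opt_def using I by (intro Min_in) (auto simp: finite_feasible feasible_nonempty)
  then obtain C where C: "C \<in> feasible F k" "?OPT = outlier_cost z d m X C" by auto
  obtain Y where Y: "Y \<subseteq> X" "card Y = m" "outlier_cost z d m X C = cost z d (X - Y) C"
    using outlier_cost_attained I(4,8) by metis
  have Cf: "C \<subseteq> \<Gamma>" "finite C" "C \<noteq> {}" "card C \<le> k"
    using C(1) I finite_subset[of C F] by (auto simp: feasible_def)
  have \<eta>: "?\<eta> > 0" using par by (simp add: slack_def)
  \<comment> \<open>The packing bound with \<open>?L * m\<close> surplus points; for
    \<open>r = 0\<close> the left side vanishes.\<close>
  have low: "real ?L * real m * (r / 2) powr z \<le> ?OPT"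
  proof (cases "r = 0")
    case True
    then show ?thesis using C Y by simp
  next
    case False
    with sep obtain U where U: "U \<subseteq> X" "k + m + ?L * m \<le> card U"
      "\<And>u v. u \<in> U \<Longrightarrow> v \<in> U \<Longrightarrow> u \<noteq> v \<Longrightarrow> r \<le> d u v" by blast
    show ?thesis
      using separated_lower_bound[OF I(1,2,4) Cf Y(1) _ U r, of z] Y C par by simp
  qed
  have L: "(1 + 1 / ?\<eta>) powr z * 4 powr z * (2 * \<beta> / \<epsilon>) \<le> ?L"
    unfolding extra_centers_def by linarith
  show ?thesis
  proof (intro exI[of _ Y] conjI allI impI Y(1,2))
    fix Y' assume Y': "Y' \<subseteq> X" "\<forall>j. card {p \<in> Y. cell p = j} = card {p \<in> Y'. cell p = j}"
    have "\<beta> * opt z d (X - Y') F k \<le> \<beta> * cost z d (X - Y') C"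
      using opt_le[OF I(5) C(1)] par by (intro mult_left_mono) auto
    also have "\<dots> \<le> \<beta> * ((1 + ?\<eta>) powr z * cost z d (X - Y) C
        + (1 + 1 / ?\<eta>) powr z * (real m * (2 * r) powr z))"
      using par r \<eta> Y Y' diam Cf I by (intro mult_left_mono swap_outliers[of \<Gamma> d _ _ _ _ _ cell]) auto
    also have "cost z d (X - Y) C = ?OPT" using C Y by simp
    \<comment> \<open>Cells have diameter \<open>2 * r\<close> while surplus points pay for distance
      \<open>r / 2\<close>; the ratio 4 is the origin of \<open>4 powr z\<close> in
      \<open>extra_centers\<close>.\<close>
    also have "(2 * r) powr z = 4 powr z * (r / 2) powr z"
      using r by (simp flip: powr_mult)
    also have "\<beta> * ((1 + ?\<eta>) powr z * ?OPT
        + (1 + 1 / ?\<eta>) powr z * (real m * (4 powr z * (r / 2) powr z)))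
      = \<beta> * (1 + ?\<eta>) powr z * ?OPT
        + ((1 + 1 / ?\<eta>) powr z * 4 powr z * (2 * \<beta> / \<epsilon>)) * (\<epsilon> / 2) * (real m * (r / 2) powr z)"
      using par by (simp add: field_simps)
    also have "\<dots> \<le> \<beta> * (1 + \<epsilon> / (2 * \<beta>)) * ?OPT + real ?L * (\<epsilon> / 2) * (real m * (r / 2) powr z)"
      using par slack_powr[OF par] L C Y
      by (intro add_mono mult_right_mono mult_left_mono) auto
    also have "\<dots> \<le> \<beta> * (1 + \<epsilon> / (2 * \<beta>)) * ?OPT + \<epsilon> / 2 * ?OPT"
      using mult_left_mono[OF low, of "\<epsilon> / 2"] par by (simp add: mult.assoc mult.left_commute)
    also have "\<dots> = (\<beta> + \<epsilon>) * ?OPT" using par by (simp add: field_simps)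
    finally show "\<beta> * opt z d (X - Y') F k \<le> (\<beta> + \<epsilon>) * ?OPT" .
  qed
qed

section \<open>Deleted clients as remote facilities\<close>

definition remote :: "(nat \<Rightarrow> nat \<Rightarrow> real) \<Rightarrow> real \<Rightarrow> nat set \<Rightarrow> nat \<Rightarrow> nat \<Rightarrow> real" where
  "remote d D R a b = (if (a \<in> R \<or> b \<in> R) \<and> a \<noteq> b then D else d a b)"

text \<open>\<open>D\<close> bounds all distances, so no detour through a remote point is shorter
  than the direct way. Only \<open>Y - F\<close> becomes remote, since a deleted client that is also
  a facility must stay usable as one. The union of clients and facilities does not change, hence
  neither does \<open>n\<close>.\<close>

lemma remote_instance:
  assumes inst: "clustering_instance \<Gamma> d X F k" and "Y \<subseteq> X"
    and D: "D > 0" "\<And>a b. a \<in> X \<union> F \<Longrightarrow> b \<in> X \<union> F \<Longrightarrow> d a b \<le> D"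
  shows "clustering_instance (X \<union> F) (remote d D (Y - F)) (X - Y) (F \<union> Y) k"
proof -
  interpret Metric_space \<Gamma> d using inst by (simp add: clustering_instance_def)
  have sub: "X \<union> F \<subseteq> \<Gamma>" using inst by (auto simp: clustering_instance_def)
  have "Metric_space (X \<union> F) (remote d D (Y - F))"
  proof
    show "0 \<le> remote d D (Y - F) x y" for x y using D by (simp add: remote_def)
    show "remote d D (Y - F) x y = remote d D (Y - F) y x" for x y by (auto simp: remote_def commute)
    show "remote d D (Y - F) x y = 0 \<longleftrightarrow> x = y" if "x \<in> X \<union> F" "y \<in> X \<union> F" for x y
      using zero[OF subsetD[OF sub that(1)] subsetD[OF sub that(2)]] D(1) by (simp add: remote_def)
    show "remote d D (Y - F) x w \<le> remote d D (Y - F) x y + remote d D (Y - F) y w"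
      if xyw: "x \<in> X \<union> F" "y \<in> X \<union> F" "w \<in> X \<union> F" for x y w
    proof -
      have M: "x \<in> \<Gamma>" "y \<in> \<Gamma>" "w \<in> \<Gamma>" using xyw sub by auto
      note facts = triangle[OF M] D(1) D(2)[OF xyw(1,3)] nonneg[of x y] nonneg[of y w] M
      show ?thesis
      proof (cases "x = y \<or> y = w \<or> x = w")
        case True
        then show ?thesis using facts by (auto simp: remote_def)
      next
        case False
        then show ?thesis using facts by (simp add: remote_def)
      qed
    qed
  qed
  moreover have "X - Y \<union> (F \<union> Y) = X \<union> F" using \<open>Y \<subseteq> X\<close> by auto
  ultimately show ?thesis
    using inst \<open>Y \<subseteq> X\<close> finite_subset[of Y X] by (auto simp: clustering_instance_def)
qed

lemma remote_eq:
  assumes "p \<in> X - Y" "c \<in> F"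
  shows "remote d D (Y - F) p c = d p c"
  using assms by (auto simp: remote_def)

text \<open>Solutions inside \<open>F\<close> remain feasible, and the distances that they use are
  not altered.\<close>

lemma remote_opt_le:
  assumes "finite F" "F \<noteq> {}" "k \<ge> 1" "finite Y"
  shows "opt z (remote d D (Y - F)) (X - Y) (F \<union> Y) k \<le> opt z d (X - Y) F k"
proof -
  have "opt z d (X - Y) F k \<in> cost z d (X - Y) ` feasible F k"
    unfolding opt_def using assms by (intro Min_in) (auto simp: finite_feasible feasible_nonempty)
  then obtain C where C: "C \<in> feasible F k" "opt z d (X - Y) F k = cost z d (X - Y) C" by auto
  have "opt z (remote d D (Y - F)) (X - Y) (F \<union> Y) k \<le> cost z (remote d D (Y - F)) (X - Y) C"
    using C assms by (intro opt_le) (auto simp: feasible_def)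
  also have "\<dots> = cost z d (X - Y) C"
    unfolding cost_def point_cost_def
    using C(1) remote_eq[of _ X Y _ F d D]
    by (intro sum.cong refl arg_cong[of _ _ "\<lambda>x. x powr z"] arg_cong[of _ _ Min] image_cong)
      (auto simp: feasible_def)
  finally show ?thesis using C by simp
qed

text \<open>The facility \<open>f\<close> steps in when only remote facilities were opened; any
  facility would do, as none is farther from a client than \<open>D\<close>.\<close>

definition repair :: "nat set \<Rightarrow> nat \<Rightarrow> nat set \<Rightarrow> nat set" where
  "repair F f C = (if F \<inter> C = {} then {f} else F \<inter> C)"

lemma repair_subset: "f \<in> F \<Longrightarrow> repair F f C \<subseteq> F" "repair F f C \<noteq> {}"
  by (auto simp: repair_def)

text \<open>A remote facility is at distance \<open>D\<close> from every remaining client, no closer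
  than any element of the repaired set, so dropping it loses nothing. The fallback to a single
  facility needs \<open>k \<ge> 1\<close>.\<close>

lemma repair_remote:
  assumes inst: "clustering_instance \<Gamma> d X F k" and "Y \<subseteq> X" and z: "z \<ge> 0" and f: "f \<in> F"
    and D: "\<And>a b. a \<in> X \<union> F \<Longrightarrow> b \<in> X \<union> F \<Longrightarrow> d a b \<le> D"
    and C: "C \<in> feasible (F \<union> Y) k"
  shows "card (repair F f C) \<le> k"
    and "cost z d (X - Y) (repair F f C) \<le> cost z (remote d D (Y - F)) (X - Y) C"
proof -
  have I: "Metric_space \<Gamma> d" "X \<subseteq> \<Gamma>" "F \<subseteq> \<Gamma>" "finite X" "finite F" "F \<noteq> {}" "k \<ge> 1"
    using inst by (auto simp: clustering_instance_def)
  interpret Metric_space \<Gamma> d by fact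
  have fin: "finite C" "finite (repair F f C)" "C \<noteq> {}"
    using C I \<open>Y \<subseteq> X\<close> finite_subset[of C "F \<union> Y"] finite_subset[of Y X]
    by (auto simp: feasible_def repair_def)
  have "card (F \<inter> C) \<le> card C" using fin by (intro card_mono) auto
  then show "card (repair F f C) \<le> k"
    using C I by (auto simp: repair_def feasible_def)
  show "cost z d (X - Y) (repair F f C) \<le> cost z (remote d D (Y - F)) (X - Y) C"
    unfolding cost_def
  proof (rule sum_mono)
    fix p assume p: "p \<in> X - Y"
    obtain c0 where c0: "c0 \<in> repair F f C" using repair_subset(2) by blast
    have "setdist d p (repair F f C) \<le> remote d D (Y - F) p c" if c: "c \<in> C" for c
    proof (cases "c \<in> F")
      case True
      then have "c \<in> repair F f C" using c by (auto simp: repair_def)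
      then show ?thesis using setdist_le[OF fin(2)] remote_eq[OF p True] by metis
    next
      case False
      then have "remote d D (Y - F) p c = D" using c C p by (auto simp: remote_def feasible_def)
      moreover have "d p c0 \<le> D" using D p c0 repair_subset(1)[OF f] by blast
      ultimately show ?thesis using setdist_le[OF fin(2) c0, of d p] by simp
    qed
    then have "setdist d p (repair F f C) \<le> setdist (remote d D (Y - F)) p C"
      using setdist_attained[OF fin(1,3)] by metis
    moreover have "0 \<le> setdist d p (repair F f C)"
      using setdist_attained[OF fin(2) repair_subset(2)] nonneg by metis
    ultimately show "point_cost z d p (repair F f C) \<le> point_cost z (remote d D (Y - F)) p C"
      unfolding point_cost_def setdist_def[symmetric] using z by (intro powr_mono2) auto
  qed
qed

section \<open>The program\<close>

text \<open>Every scalar variable is cell 0 of its own array. Arrays from 20 on belong to the simulated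
  program; the region of the current call starts at index \<open>vBase\<close> (array 4, read by \<open>sim\<close>), and
  everything from index \<open>vTop\<close> (array 5) on is still 0.\<close>

abbreviation (input) "vBase \<equiv> 4 :: nat"
abbreviation (input) "vTop \<equiv> 5 :: nat"
abbreviation (input) "vI \<equiv> 6 :: nat"
abbreviation (input) "vJ \<equiv> 7 :: nat"
abbreviation (input) "vP \<equiv> 8 :: nat"
abbreviation (input) "vV \<equiv> 9 :: nat"
abbreviation (input) "vQ \<equiv> 10 :: nat"
abbreviation (input) "vT \<equiv> 11 :: nat"
abbreviation (input) "vK \<equiv> 12 :: nat"
abbreviation (input) "vF \<equiv> 13 :: nat"
abbreviation (input) "vSize \<equiv> 14 :: nat"
abbreviation (input) "aCell \<equiv> 15 :: nat"
abbreviation (input) "aCount \<equiv> 16 :: nat"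
abbreviation (input) "aDel \<equiv> 17 :: nat"
abbreviation (input) "aCand \<equiv> 18 :: nat"

abbreviation (input) "rD \<equiv> 1 :: nat"
abbreviation (input) "rBest \<equiv> 2 :: nat"
abbreviation (input) "rCost \<equiv> 3 :: nat"
abbreviation (input) "rMin \<equiv> 4 :: nat"
abbreviation (input) "rDist \<equiv> 5 :: nat"
abbreviation (input) "rM \<equiv> 6 :: nat"

abbreviation "var a \<equiv> NGet a (NLit 0)"
abbreviation "rvar a \<equiv> RGet a (NLit 0) (NLit 0)"
abbreviation "assign a e \<equiv> NSet a (NLit 0) e"
abbreviation "rassign a e \<equiv> RSet a (NLit 0) (NLit 0) e"
abbreviation "inputN \<equiv> NGet 0 (NLit 0)"
abbreviation "inputK \<equiv> NGet 0 (NLit 1)"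
abbreviation "inputM \<equiv> NGet 0 (NLit 2)"
abbreviation "loopN v c \<equiv> For v (NLess (var v) inputN) c"
abbreviation "pos e \<equiv> NLess (NLit 0) e"

text \<open>One plus the sum of all distances serves as \<open>D\<close>. It strictly exceeds each
  distance, and the strictness lets the first center claim every client.\<close>

definition compute_bound :: com where
  "compute_bound =
     Seq (rassign rD (ROfNat (NLit 1)))
       (loopN vI (loopN vJ (rassign rD (RAdd (rvar rD) (RGet 0 (var vI) (var vJ))))))"

definition find_facility :: com where
  "find_facility = loopN vI (Cond (pos (NGet 2 (var vI))) (assign vF (var vI)) Skip)"

text \<open>Yields \<open>D\<close> for clients and -1 for other points without a branch. The value
  -1 keeps the latter from being selected as farthest while there is a client.\<close>

definition init_dist :: com where
  "init_dist = loopN vI (RSet rDist (var vI) (NLit 0)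
     (RSub (RMul (ROfNat (NGet 1 (var vI))) (RAdd (rvar rD) (ROfNat (NLit 1)))) (ROfNat (NLit 1))))"

definition farthest :: com where
  "farthest = Seq (assign vP (NLit 0))
     (loopN vI (Cond (RLess (RGet rDist (var vP) (NLit 0)) (RGet rDist (var vI) (NLit 0)))
        (assign vP (var vI)) Skip))"

definition add_center :: com where
  "add_center = loopN vI (Cond (RLess (RGet 0 (var vI) (var vP)) (RGet rDist (var vI) (NLit 0)))
     (Seq (RSet rDist (var vI) (NLit 0) (RGet 0 (var vI) (var vP))) (NSet aCell (var vI) (var vJ))) Skip)"

text \<open>The product \<open>L * m\<close> is formed in the reals, as naturals admit no
  multiplication.\<close>

definition more_centers :: "nat \<Rightarrow> bexp" where
  "more_centers L = BAnd (NLess (var vJ) inputN)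
     (RLess (ROfNat (var vJ))
       (RAdd (ROfNat (NAdd inputK inputM)) (RMul (ROfNat (NLit L)) (ROfNat inputM))))"

definition farthest_first :: "nat \<Rightarrow> com" where
  "farthest_first L = Seq init_dist
     (Seq (For vJ (more_centers L) (Seq farthest add_center)) (assign vK (var vJ)))"

definition compute_power :: com where
  "compute_power = Seq (rassign rM (ROfNat (NLit 1)))
     (For vI (NLess (var vI) inputM) (rassign rM (RMul (rvar rM) (ROfNat (var vK)))))"

text \<open>A best cost of -1 means that no solution is stored yet; real costs are
  nonnegative.\<close>

definition preprocess :: "nat \<Rightarrow> com" where
  "preprocess L = Seq compute_bound (Seq find_facility (Seq (farthest_first L)
     (Seq compute_power (rassign rBest (RSub (ROfNat (NLit 0)) (ROfNat (NLit 1)))))))"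

definition clear_counts :: com where
  "clear_counts = loopN vI (NSet aCount (var vI) (NLit 0))"

definition decode :: com where
  "decode = Seq (assign vV (var vT)) (For vI (NLess (var vI) inputM)
     (Seq (For vQ (BNot (NLess (var vV) (var vK))) (assign vV (NSub (var vV) (var vK))))
       (Seq (NSet aCount (var vV) (NAdd (NGet aCount (var vV)) (NLit 1))) (assign vV (var vQ)))))"

definition delete_clients :: com where
  "delete_clients = loopN vI
     (Cond (BAnd (pos (NGet 1 (var vI))) (pos (NGet aCount (NGet aCell (var vI)))))
       (Seq (NSet aDel (var vI) (NLit 1))
         (NSet aCount (NGet aCell (var vI)) (NSub (NGet aCount (NGet aCell (var vI))) (NLit 1))))
       (NSet aDel (var vI) (NLit 0)))"

text \<open>Truncation makes this difference the indicator of \<open>Y - F\<close>.\<close>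

definition is_remote :: "nat \<Rightarrow> nexp" where
  "is_remote v = NSub (NGet aDel (var v)) (NGet 2 (var v))"

text \<open>A disjunction is tested as positivity of a sum, and \<open>i \<noteq> j\<close> as
  positivity of the sum of both truncated differences.\<close>

definition write_row :: com where
  "write_row = loopN vJ
     (Cond (BAnd (pos (NAdd (is_remote vI) (is_remote vJ)))
               (pos (NAdd (NSub (var vI) (var vJ)) (NSub (var vJ) (var vI)))))
       (RSet 20 (NAdd (var vBase) (var vI)) (var vJ) (rvar rD))
       (RSet 20 (NAdd (var vBase) (var vI)) (var vJ) (RGet 0 (var vI) (var vJ))))"

text \<open>Arrays 20 to 22 are arrays 0 to 2 of the simulated program. The cell for the number of
  outliers is not written because a fresh region already holds 0 there.\<close>

definition write_instance :: com where
  "write_instance =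
     Seq (loopN vI
       (Seq (NSet 21 (NAdd (var vBase) (var vI)) (NSub (NGet 1 (var vI)) (NGet aDel (var vI))))
       (Seq (NSet 22 (NAdd (var vBase) (var vI)) (NAdd (NGet 2 (var vI)) (is_remote vI)))
         write_row)))
     (Seq (NSet 20 (var vBase) inputN)
     (Seq (NSet 20 (NAdd (var vBase) (NLit 1)) inputK)
       (assign vTop (NAdd (var vBase) (NAdd inputN (NLit 2))))))"

definition read_candidate :: com where
  "read_candidate =
     Seq (assign vSize (NLit 0))
     (Seq (loopN vI (Cond (BAnd (pos (NGet 2 (var vI))) (pos (NGet 23 (NAdd (var vBase) (var vI)))))
       (Seq (NSet aCand (var vI) (NLit 1)) (assign vSize (NAdd (var vSize) (NLit 1))))
       (NSet aCand (var vI) (NLit 0))))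
     (Cond (pos (var vSize)) Skip (Seq (NSet aCand (var vF) (NLit 1)) (assign vSize (NLit 1)))))"

text \<open>Evaluates with the original distances, not with the modified ones given to the
  call.\<close>

definition compute_cost :: com where
  "compute_cost =
     Seq (rassign rCost (ROfNat (NLit 0)))
     (loopN vI (Cond (NLess (NGet aDel (var vI)) (NGet 1 (var vI)))
       (Seq (rassign rMin (rvar rD))
       (Seq (loopN vJ (Cond (BAnd (pos (NGet aCand (var vJ)))
               (RLess (RGet 0 (var vI) (var vJ)) (rvar rMin)))
            (rassign rMin (RGet 0 (var vI) (var vJ))) Skip))
         (rassign rCost (RAdd (rvar rCost) (RPow (rvar rMin)))))) Skip))"

text \<open>The size test guards against failed calls that return too many facilities. The
  disjunction "nothing stored yet or cheaper" is spelled with negations and a conjunction.\<close>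

definition update_best :: com where
  "update_best =
     Cond (BAnd (BNot (NLess inputK (var vSize)))
        (BNot (BAnd (BNot (RLess (rvar rBest) (ROfNat (NLit 0)))) (BNot (RLess (rvar rCost) (rvar rBest))))))
       (Seq (rassign rBest (rvar rCost)) (loopN vI (NSet 3 (var vI) (NGet aCand (var vI))))) Skip"

definition prepare :: com where
  "prepare = Seq (assign vBase (var vTop)) (Seq clear_counts (Seq decode
     (Seq delete_clients write_instance)))"

definition evaluate :: com where
  "evaluate = Seq read_candidate (Seq compute_cost update_best)"

definition outlier_program :: "nat \<Rightarrow> com \<Rightarrow> com" where
  "outlier_program L P = Seq (preprocess L)
     (For vT (RLess (ROfNat (var vT)) (rvar rM)) (Seq prepare (Seq (sim P) evaluate)))"

lemma deterministic_outlier_program: "deterministic (outlier_program L P) = deterministic P"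
  by (simp add: outlier_program_def preprocess_def compute_bound_def find_facility_def farthest_first_def
      init_dist_def farthest_def add_center_def compute_power_def prepare_def clear_counts_def
      decode_def delete_clients_def write_instance_def write_row_def evaluate_def read_candidate_def
      compute_cost_def update_best_def For_def)

section \<open>Frame conditions, input data and the single steps of the preprocessing\<close>

definition agree :: "nat set \<Rightarrow> nat set \<Rightarrow> memory \<Rightarrow> memory \<Rightarrow> bool" where
  "agree A R s s' \<longleftrightarrow> (\<forall>a. a \<notin> A \<longrightarrow> nats s' a = nats s a) \<and> (\<forall>a. a \<notin> R \<longrightarrow> reals s' a = reals s a)"

lemma agree_refl: "agree A R s s"
  by (simp add: agree_def)

lemma agree_nset [simp]: "a \<in> A \<Longrightarrow> agree A R s s' \<Longrightarrow> agree A R s (nset a i v s')"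
  by (auto simp: agree_def nset_def)

lemma agree_rset [simp]: "a \<in> R \<Longrightarrow> agree A R s s' \<Longrightarrow> agree A R s (rset a i j v s')"
  by (auto simp: agree_def rset_def)

lemma agree_trans: "agree A R s s' \<Longrightarrow> agree A' R' s' s'' \<Longrightarrow> A \<subseteq> B \<Longrightarrow> A' \<subseteq> B \<Longrightarrow> R \<subseteq> Q \<Longrightarrow> R' \<subseteq> Q \<Longrightarrow>
  agree B Q s s''"
  unfolding agree_def by (metis subsetD)

lemma agree_nats: "agree A R s s' \<Longrightarrow> a \<notin> A \<Longrightarrow> nats s' a = nats s a"
  by (simp add: agree_def)

lemma agree_reals: "agree A R s s' \<Longrightarrow> a \<notin> R \<Longrightarrow> reals s' a = reals s a"
  by (simp add: agree_def)

lemma less_add_nonneg: "x < y \<Longrightarrow> 0 \<le> e \<Longrightarrow> x < y + (e :: real)"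
  by simp

locale outlier_problem =
  fixes z :: real and \<Gamma> :: "nat set" and d :: "nat \<Rightarrow> nat \<Rightarrow> real" and X F :: "nat set" and k m n :: nat
  assumes inst: "outlier_instance \<Gamma> d X F k m" and n: "n = card (X \<union> F)" and z: "z \<ge> 1"
begin

lemma inst_facts:
  "Metric_space \<Gamma> d" "X \<subseteq> \<Gamma>" "F \<subseteq> \<Gamma>" "finite X" "finite F" "F \<noteq> {}" "k \<ge> 1" "m \<le> card X"
  "X \<union> F = {..<n}" "clustering_instance \<Gamma> d X F k"
  using inst unfolding outlier_instance_def clustering_instance_def n[symmetric] by simp_all

sublocale Metric_space \<Gamma> d by (rule inst_facts)

lemma X_less: "p \<in> X \<Longrightarrow> p < n" and F_less: "p \<in> F \<Longrightarrow> p < n"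
  using inst_facts(9) by auto

lemma X_sub: "X \<subseteq> {..<n}"
  using inst_facts(9) by auto

lemma n_pos: "n > 0"
  using inst_facts(6) F_less by fastforce

lemma m_le_n: "m \<le> n"
  using inst_facts(8) card_mono[OF _ X_sub] by simp

definition data :: "memory \<Rightarrow> bool" where
  "data s \<longleftrightarrow> nats s 0 0 = n \<and> nats s 0 1 = k \<and> nats s 0 2 = m \<and>
     (\<forall>i. nats s 1 i = of_bool (i \<in> X)) \<and> (\<forall>i. nats s 2 i = of_bool (i \<in> F)) \<and>
     (\<forall>i<n. \<forall>j<n. reals s 0 i j = d i j)"

lemma data_nset [simp]: "data s \<Longrightarrow> a \<noteq> 0 \<Longrightarrow> a \<noteq> Suc 0 \<Longrightarrow> a \<noteq> 2 \<Longrightarrow> data (nset a i v s)"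
  by (auto simp: data_def nats_nset)

lemma data_rset [simp]: "data s \<Longrightarrow> a \<noteq> 0 \<Longrightarrow> data (rset a i j v s)"
  by (auto simp: data_def reals_rset)

lemma data_agree: "data s \<Longrightarrow> agree A R s s' \<Longrightarrow> {0, 1, 2} \<inter> A = {} \<Longrightarrow> 0 \<notin> R \<Longrightarrow> data s'"
  by (auto simp: data_def agree_def)

lemma data_simps [simp]:
  assumes "data s"
  shows "nats s 0 0 = n" "nats s 0 (Suc 0) = k" "nats s 0 2 = m"
    "nats s (Suc 0) i = of_bool (i \<in> X)" "nats s 2 i = of_bool (i \<in> F)"
    "i < n \<Longrightarrow> j < n \<Longrightarrow> reals s 0 i j = d i j"
  using assms by (simp_all add: data_def)

lemma wp_compute_bound:
  assumes "data s"
  shows "wp z compute_bound s (\<lambda>t s'. t \<le> 100 * (n + 1)\<^sup>2 \<and> agree {vI, vJ} {rD} s s' \<and>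
    reals s' rD 0 0 \<ge> 1 \<and> (\<forall>i<n. \<forall>j<n. d i j < reals s' rD 0 0))"
  unfolding compute_bound_def
  apply simp
  apply (rule wp_For[where N=n and B="100 * (n + 1)" and
        I="\<lambda>i s'. data s' \<and> agree {vI, vJ} {rD} s s' \<and> reals s' rD 0 0 \<ge> 1 \<and>
           (\<forall>i'<i. \<forall>j<n. d i' j < reals s' rD 0 0)"])
     apply (use assms in \<open>simp add: agree_refl reals_rset\<close>)
    apply simp
  subgoal for i s1
    apply (rule wp_For[where N=n and B="50" and
        I="\<lambda>j s'. data s' \<and> agree {vI, vJ} {rD} s s' \<and> reals s' rD 0 0 \<ge> 1 \<and> nats s' vI 0 = i \<and>
           (\<forall>i'<i. \<forall>j<n. d i' j < reals s' rD 0 0) \<and> (\<forall>j'<j. d i j' < reals s' rD 0 0)"])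
       apply (simp add: reals_rset nats_nset)
      apply simp
     apply (auto simp: reals_rset nats_nset less_Suc_eq intro: less_add_nonneg add_increasing2)[1]
    apply (auto simp: less_Suc_eq)
    done
  apply (auto simp: power2_eq_square algebra_simps)
  done

lemma wp_find_facility:
  assumes "data s"
  shows "wp z find_facility s (\<lambda>t s'. t \<le> 100 * (n + 1) \<and> agree {vI, vF} {} s s' \<and> nats s' vF 0 \<in> F)"
  unfolding find_facility_def
  apply (rule wp_For[where N=n and B=50 and
        I="\<lambda>i s'. data s' \<and> agree {vI, vF} {} s s' \<and> ((\<exists>j<i. j \<in> F) \<longrightarrow> nats s' vF 0 \<in> F)"])
     apply (use assms in \<open>simp add: agree_refl nats_nset\<close>)
    apply simp
   apply (auto simp: nats_nset less_Suc_eq)[1]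
  using inst_facts(6) F_less apply (auto; blast)
  done

lemma wp_init_dist:
  assumes "data s"
  shows "wp z init_dist s (\<lambda>t s'. t \<le> 100 * (n + 1) \<and> agree {vI} {rDist} s s' \<and>
    (\<forall>i<n. reals s' rDist i 0 = (if i \<in> X then reals s rD 0 0 else -1)))"
  unfolding init_dist_def
  apply (rule wp_For[where N=n and B=50 and
        I="\<lambda>i s'. data s' \<and> agree {vI} {rDist} s s' \<and>
           (\<forall>i'<i. reals s' rDist i' 0 = (if i' \<in> X then reals s rD 0 0 else -1))"])
     apply (use assms in \<open>simp add: agree_refl\<close>)
    apply simp
   apply (auto simp: reals_rset less_Suc_eq agree_reals[of "{vI}" "{rDist}" s])[1]
  apply auto
  done

lemma wp_farthest:
  assumes "data s"
  shows "wp z farthest s (\<lambda>t s'. t \<le> 100 * (n + 1) \<and> agree {vI, vP} {} s s' \<and>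
    nats s' vP 0 < n \<and> (\<forall>i<n. reals s' rDist i 0 \<le> reals s' rDist (nats s' vP 0) 0))"
  unfolding farthest_def
  apply simp
  apply (rule wp_For[where N=n and B=50 and
        I="\<lambda>i s'. data s' \<and> agree {vI, vP} {} s s' \<and> nats s' vP 0 < n \<and>
           (\<forall>i'<i. reals s' rDist i' 0 \<le> reals s' rDist (nats s' vP 0) 0)"])
     apply (use assms n_pos in \<open>simp add: agree_refl nats_nset\<close>)
    apply simp
   apply (clarsimp simp: nats_nset less_Suc_eq)
   apply (metis less_imp_le order_refl order_trans)
  apply auto
  done

lemma wp_add_center:
  assumes "data s" "nats s vP 0 = c" "c < n"
  shows "wp z add_center s (\<lambda>t s'. t \<le> 100 * (n + 1) \<and> agree {vI, aCell} {rDist} s s' \<and>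
    (\<forall>i<n. reals s' rDist i 0 = min (reals s rDist i 0) (d i c) \<and>
       nats s' aCell i = (if d i c < reals s rDist i 0 then nats s vJ 0 else nats s aCell i)))"
  unfolding add_center_def
  apply (rule wp_For[where N=n and B=50 and
        I="\<lambda>i s'. data s' \<and> agree {vI, aCell} {rDist} s s' \<and>
           (\<forall>i'<n. if i' < i then reals s' rDist i' 0 = min (reals s rDist i' 0) (d i' c) \<and>
               nats s' aCell i' = (if d i' c < reals s rDist i' 0 then nats s vJ 0 else nats s aCell i')
             else reals s' rDist i' 0 = reals s rDist i' 0 \<and> nats s' aCell i' = nats s aCell i')"])
     apply (use assms in \<open>simp add: agree_refl nats_nset\<close>)
    apply simp
  subgoal for i s'
    using assms
    apply (auto simp: reals_rset nats_nset less_Suc_eq agree_nats[of "{vI, aCell}" "{rDist}" s] min_def)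
    done
  apply auto
  done

end

section \<open>Farthest-first traversal\<close>

context outlier_problem
begin

text \<open>The last clause is the greedy invariant: the centers so far are pairwise separated by at
  least every current radius.\<close>

definition center_sequence :: "real \<Rightarrow> nat \<Rightarrow> (nat \<Rightarrow> real) \<Rightarrow> (nat \<Rightarrow> nat) \<Rightarrow> (nat \<Rightarrow> nat) \<Rightarrow> bool" where
  "center_sequence D j rad cell cen \<longleftrightarrow> (\<forall>l<j. cen l \<in> X) \<and>
     (\<forall>p\<in>X. if j = 0 then rad p = D else cell p < j \<and> rad p = d p (cen (cell p))) \<and>
     (\<forall>p\<in>X. \<forall>l<j. rad p \<le> d p (cen l)) \<and>
     (\<forall>p\<in>X. \<forall>l<j. \<forall>l'<l. rad p \<le> d (cen l) (cen l'))"

text \<open>Without clients nothing is claimed about a center sequence, as \<open>farthest\<close>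
  then picks a point that is no client.\<close>

definition centers :: "real \<Rightarrow> nat \<Rightarrow> (nat \<Rightarrow> real) \<Rightarrow> (nat \<Rightarrow> nat) \<Rightarrow> bool" where
  "centers D j rad cell \<longleftrightarrow> (\<forall>i<n. i \<notin> X \<longrightarrow> rad i = -1) \<and>
     (X \<noteq> {} \<longrightarrow> (\<exists>cen. center_sequence D j rad cell cen))"

text \<open>Separation survives because the new center is at distance at least \<open>rad c\<close>
  from the old ones, \<open>rad c\<close> is the largest radius, and radii only shrink.\<close>

lemma centers_step:
  assumes cen: "centers D j rad cell" and c: "c < n" "\<And>i. i < n \<Longrightarrow> rad i \<le> rad c"
    and D: "D \<ge> 1" "\<And>i j. i < n \<Longrightarrow> j < n \<Longrightarrow> d i j < D"
    and upd: "\<And>i. i < n \<Longrightarrow> rad' i = min (rad i) (d i c)"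
      "\<And>i. i < n \<Longrightarrow> cell' i = (if d i c < rad i then j else cell i)"
  shows "centers D (Suc j) rad' cell'"
proof -
  have out: "rad i = -1" if "i < n" "i \<notin> X" for i
    using cen that unfolding centers_def by blast
  then have "rad' i = -1" if "i < n" "i \<notin> X" for i
    using that upd(1)[OF that(1)] nonneg[of i c] by simp
  moreover have "\<exists>cen. center_sequence D (Suc j) rad' cell' cen" if ne: "X \<noteq> {}"
  proof -
    from cen ne obtain e where "center_sequence D j rad cell e" unfolding centers_def by auto
    then have e: "\<And>l. l < j \<Longrightarrow> e l \<in> X"
      "\<And>p. p \<in> X \<Longrightarrow> if j = 0 then rad p = D else cell p < j \<and> rad p = d p (e (cell p))"
      "\<And>p l. p \<in> X \<Longrightarrow> l < j \<Longrightarrow> rad p \<le> d p (e l)"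
      "\<And>p l l'. p \<in> X \<Longrightarrow> l < j \<Longrightarrow> l' < l \<Longrightarrow> rad p \<le> d (e l) (e l')"
      unfolding center_sequence_def by blast+
    obtain x where x: "x \<in> X" using ne by blast
    have "rad x \<ge> 0" using e(2)[OF x] D(1) by (auto split: if_splits)
    then have "rad c \<ge> 0" using c(2)[OF X_less[OF x]] by simp
    \<comment> \<open>Points outside \<open>X\<close> have radius -1, below that of any
      client.\<close>
    then have cX: "c \<in> X" using out[OF c(1)] by force
    have le: "rad' p \<le> rad p" "rad' p \<le> d p c" if "p \<in> X" for p
      using upd(1)[OF X_less[OF that]] by auto
    let ?e = "e(j := c)"
    have "cell' p < Suc j \<and> rad' p = d p (?e (cell' p))" if p: "p \<in> X" for p
    proof (cases "d p c < rad p")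
      case True
      then show ?thesis using upd(1)[OF X_less[OF p]] upd(2)[OF X_less[OF p]] by simp
    next
      case False
      \<comment> \<open>In the first round the test cannot fail, since \<open>D\<close> exceeds all
        distances.\<close>
      then have "j \<noteq> 0" using e(2)[OF p] D(2)[OF X_less[OF p] c(1)] by (cases "j = 0") auto
      with False show ?thesis
        using upd(1)[OF X_less[OF p]] upd(2)[OF X_less[OF p]] e(2)[OF p] by simp
    qed
    moreover have "rad' p \<le> d p (?e l)" if "p \<in> X" "l < Suc j" for p l
    proof (cases "l = j")
      case False
      then have "rad p \<le> d p (e l)" using e(3) that by simp
      then show ?thesis using False order_trans[OF le(1)[OF that(1)]] by simp
    qed (simp add: le(2)[OF that(1)])
    moreover have "rad' p \<le> d (?e l) (?e l')" if "p \<in> X" "l < Suc j" "l' < l" for p l l'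
    proof (cases "l = j")
      case True
      have "rad' p \<le> rad c" using order_trans[OF le(1)[OF that(1)] c(2)[OF X_less[OF that(1)]]] .
      also have "\<dots> \<le> d c (e l')" using e(3) cX that True by simp
      finally show ?thesis using True that by simp
    next
      case False
      then have "rad p \<le> d (e l) (e l')" using e(4)[of p l l'] that by simp
      then show ?thesis using False that order_trans[OF le(1)[OF that(1)]] by simp
    qed
    moreover have "?e l \<in> X" if "l < Suc j" for l using e(1)[of l] that cX by (cases "l = j") auto
    ultimately have "center_sequence D (Suc j) rad' cell' ?e"
      unfolding center_sequence_def by simp
    then show ?thesis by blast
  qed
  ultimately show ?thesis unfolding centers_def by simp
qed

lemma centers_cell_less: "centers D j rad cell \<Longrightarrow> 0 < j \<Longrightarrow> p \<in> X \<Longrightarrow> cell p < j"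
  unfolding centers_def center_sequence_def by (metis equals0D less_numeral_extra(3))

lemma centers_final:
  assumes cen: "centers D N rad cell" and N: "N = min n (k + m + L * m)"
  obtains r where "r \<ge> 0" "\<And>p q. p \<in> X \<Longrightarrow> q \<in> X \<Longrightarrow> cell p = cell q \<Longrightarrow> d p q \<le> 2 * r"
    "r = 0 \<or> (\<exists>U\<subseteq>X. k + m + L * m \<le> card U \<and> (\<forall>u\<in>U. \<forall>v\<in>U. u \<noteq> v \<longrightarrow> r \<le> d u v))"
proof (cases "X = {}")
  case True
  then show thesis using that[of 0] by simp
next
  case False
  have Npos: "N > 0" using N n_pos inst_facts(7) by auto
  from cen False obtain e where "center_sequence D N rad cell e" unfolding centers_def by auto
  then have "\<forall>p\<in>X. if N = 0 then rad p = D else cell p < N \<and> rad p = d p (e (cell p))"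
    and e': "\<And>l. l < N \<Longrightarrow> e l \<in> X"
      "\<And>p l. p \<in> X \<Longrightarrow> l < N \<Longrightarrow> rad p \<le> d p (e l)"
      "\<And>p l l'. p \<in> X \<Longrightarrow> l < N \<Longrightarrow> l' < l \<Longrightarrow> rad p \<le> d (e l) (e l')"
    unfolding center_sequence_def by blast+
  then have "\<And>p. p \<in> X \<Longrightarrow> cell p < N \<and> rad p = d p (e (cell p))" using Npos by simp
  note e = e'(1) this e'(2,3)
  define r where "r = Max (rad ` X)"
  have fin: "finite (rad ` X)" using inst_facts(4) by simp
  have "r \<in> rad ` X" unfolding r_def using False fin by (intro Max_in) auto
  then obtain p0 where p0: "p0 \<in> X" "r = rad p0" by auto
  have le: "rad p \<le> r" if "p \<in> X" for p unfolding r_def using that fin by simp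
  have r0: "r \<ge> 0" using p0 e(2) by simp
  have diam: "d p q \<le> 2 * r" if pq: "p \<in> X" "q \<in> X" "cell p = cell q" for p q
  proof -
    have c: "e (cell p) \<in> X" using e(1,2) pq by blast
    have "d p q \<le> d p (e (cell p)) + d (e (cell p)) q"
      using pq c inst_facts(2) by (intro triangle) auto
    also have "\<dots> = rad p + rad q" using e(2) pq commute by metis
    also have "\<dots> \<le> 2 * r" using le pq by (smt (verit))
    finally show ?thesis .
  qed
  have sep: "r = 0 \<or> (\<exists>U\<subseteq>X. k + m + L * m \<le> card U \<and> (\<forall>u\<in>U. \<forall>v\<in>U. u \<noteq> v \<longrightarrow> r \<le> d u v))"
  proof (cases "r = 0")
    case False
    then have rpos: "r > 0" using r0 by simp
    let ?U = "insert p0 (e ` {..<N})"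
    have s: "r \<le> d (e l) (e l')" if "l < N" "l' < N" "l \<noteq> l'" for l l'
      using that e(4)[OF p0(1)] p0(2) commute[of "e l" "e l'"] by (metis linorder_neqE_nat)
    have s0: "r \<le> d p0 (e l)" if "l < N" for l using e(3)[OF p0(1) that] p0(2) by simp
    have z0: "d u u = 0" if "u \<in> X" for u using that inst_facts(2) by auto
    have "inj_on e {..<N}" using s e(1) z0 rpos by (intro inj_onI) (metis lessThan_iff not_less)
    moreover have "p0 \<notin> e ` {..<N}" using s0 e(1) z0 rpos by (metis imageE lessThan_iff not_less)
    ultimately have card: "card ?U = Suc N" by (simp add: card_image)
    have sub: "?U \<subseteq> X" using e(1) p0 by auto
    \<comment> \<open>\<open>N + 1\<close> distinct clients fit into \<open>n\<close> points only if
      \<open>N < n\<close>, so the minimum defining \<open>N\<close> is its second argument.\<close>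
    then have "Suc N \<le> n" using card card_mono[of "{..<n}" ?U] X_sub by auto
    then have "N = k + m + L * m" using N by auto
    then show ?thesis using card sub s s0 commute by (intro disjI2 exI[of _ ?U]) auto
  qed simp
  show thesis using that[OF r0 diam sep] .
qed

lemma wp_farthest_first:
  assumes s: "data s" and D: "reals s rD 0 0 = D" "D \<ge> 1" "\<And>i j. i < n \<Longrightarrow> j < n \<Longrightarrow> d i j < D"
    and N: "N = min n (k + m + L * m)"
  shows "wp z (farthest_first L) s (\<lambda>t s'. t \<le> 1000 * (n + 1)\<^sup>2 \<and>
    agree {vI, vJ, vP, vK, aCell} {rDist} s s' \<and> nats s' vK 0 = N \<and>
    centers D N (\<lambda>i. reals s' rDist i 0) (nats s' aCell))"
proof -
  have loop: "wp z (For vJ (more_centers L) (Seq farthest add_center)) s1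
    (\<lambda>t s'. t \<le> 100 + n * (200 * (n + 1) + 100) \<and>
    agree {vI, vJ, vP, vK, aCell} {rDist} s s' \<and> nats s' vJ 0 = N \<and>
    centers D N (\<lambda>i. reals s' rDist i 0) (nats s' aCell))"
    if s1: "agree {vI} {rDist} s s1" "\<And>i. i < n \<Longrightarrow> reals s1 rDist i 0 = (if i \<in> X then D else -1)" for s1
  proof (rule wp_For[where N=N and B="200 * (n + 1)" and I="\<lambda>j s'. data s' \<and>
    agree {vI, vJ, vP, vK, aCell} {rDist} s s' \<and> centers D j (\<lambda>i. reals s' rDist i 0) (nats s' aCell)"], goal_cases)
    case 1
    have "agree {vI, vJ, vP, vK, aCell} {rDist} s s1" using s1(1) by (auto simp: agree_def)
    moreover have "centers D 0 (\<lambda>i. reals s1 rDist i 0) (nats s1 aCell)"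
      using s1(2) X_less by (auto simp: centers_def center_sequence_def)
    moreover have "data s1" using data_agree[OF s s1(1)] by simp
    moreover have "nats (nset vJ 0 0 s1) aCell = nats s1 aCell" by (simp add: nset_def)
    ultimately show ?case by simp
  next
    case (2 j s')
    have "real j < real (k + m) + real L * real m \<longleftrightarrow> j < k + m + L * m"
      by (simp flip: of_nat_mult of_nat_add)
    then show ?case using 2 N by (simp add: more_centers_def)
  next
    case (3 j s')
    then have "data s'" by simp
    from wp_farthest[OF this] show ?case
      unfolding wp_Seq
    proof (rule wp_mono, elim conjE, goal_cases)
      case (1 t1 s2)
      note a2 = \<open>agree {vI, vP} {} s' s2\<close>
      have s2: "data s2" using data_agree[OF \<open>data s'\<close> a2] by simp
      have s2': "nats s2 aCell = nats s' aCell" "nats s2 vJ = nats s' vJ" "reals s2 rDist = reals s' rDist"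
        using agree_nats[OF a2] agree_reals[OF a2] by auto
      show ?case using wp_add_center[OF s2 refl \<open>nats s2 vP 0 < n\<close>]
      proof (rule wp_mono, elim conjE, goal_cases)
        case (1 t2 s3)
        note a3 = \<open>agree {vI, aCell} {rDist} s2 s3\<close>
        have s3: "data s3" using data_agree[OF s2 a3] by simp
        have "agree {vI, vJ, vP, vK, aCell} {rDist} s' s3" by (rule agree_trans[OF a2 a3]) auto
        then have "agree {vI, vJ, vP, vK, aCell} {rDist} s s3"
          using 3 by (auto intro: agree_trans)
        moreover have "centers D (Suc j) (\<lambda>i. reals s3 rDist i 0) (nats s3 aCell)"
          using 3 1 \<open>nats s2 vP 0 < n\<close> \<open>\<forall>i<n. reals s2 rDist i 0 \<le> reals s2 rDist (nats s2 vP 0) 0\<close> s2'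
          by (intro centers_step[of D j "\<lambda>i. reals s' rDist i 0" "nats s' aCell" "nats s2 vP 0"] D) auto
        moreover have "nats (nset vJ 0 (Suc j) s3) aCell = nats s3 aCell" by (simp add: nset_def)
        moreover have "nats s3 vJ 0 = j" using agree_nats[OF a3, of vJ] s2' 3 by simp
        ultimately show ?case using s3 \<open>t2 \<le> 100 * (n + 1)\<close> \<open>t1 \<le> 100 * (n + 1)\<close> by simp
      qed
    qed
  next
    case (4 t s')
    have "N \<le> n" using N by simp
    then have "N * (200 * (n + 1) + btime (more_centers L) + 7) \<le> n * (200 * (n + 1) + btime (more_centers L) + 7)"
      by (rule mult_right_mono) simp
    moreover have "btime (more_centers L) \<le> 50" by (simp add: more_centers_def)
    moreover have "n * (200 * (n + 1) + btime (more_centers L) + 7) \<le> n * (200 * (n + 1) + 100)"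
      using calculation(2) by (intro mult_left_mono) auto
    ultimately have "t \<le> 100 + n * (200 * (n + 1) + 100)" using 4(1) by linarith
    then show ?case using 4 by blast
  qed
  show ?thesis
    unfolding farthest_first_def wp_Seq
    using wp_init_dist[OF s]
  proof (rule wp_mono, elim conjE, goal_cases)
    case (1 t1 s1)
    show ?case
      using loop[of s1] 1 unfolding D(1)
      apply simp
      apply (erule wp_mono)
      apply (auto simp: nats_nset power2_eq_square algebra_simps)
      apply (simp add: nset_def)
      done
  qed
qed

section \<open>Number of guesses, digits of a guess, deletion of clients\<close>

lemma wp_compute_power:
  assumes "data s"
  shows "wp z compute_power s (\<lambda>t s'. t \<le> 100 * (n + 1) \<and> agree {vI} {rM} s s' \<and>
    reals s' rM 0 0 = real (nats s vK 0) ^ m)"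
  unfolding compute_power_def
  apply simp
  apply (rule wp_For[where N=m and B=50 and
        I="\<lambda>i s'. data s' \<and> agree {vI} {rM} s s' \<and> reals s' rM 0 0 = real (nats s vK 0) ^ i"])
     apply (use assms in \<open>simp add: agree_refl reals_rset\<close>)
    apply simp
   apply (auto simp: reals_rset agree_nats[of "{vI}" "{rM}" s])[1]
  using m_le_n apply auto
  done

lemma wp_clear_counts:
  assumes "data s"
  shows "wp z clear_counts s (\<lambda>t s'. t \<le> 100 * (n + 1) \<and> agree {vI, aCount} {} s s' \<and>
    (\<forall>j<n. nats s' aCount j = 0))"
  unfolding clear_counts_def
  apply (rule wp_For[where N=n and B=50 and
        I="\<lambda>i s'. data s' \<and> agree {vI, aCount} {} s s' \<and> (\<forall>j<i. nats s' aCount j = 0)"])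
     apply (use assms in \<open>simp add: agree_refl\<close>)
    apply simp
   apply (auto simp: nats_nset less_Suc_eq)[1]
  apply auto
  done

lemma card_less_Suc_filter:
  "card {i'. i' < Suc i \<and> P i'} = card {i'. i' < i \<and> P i'} + of_bool (P i)"
proof -
  have "{i'. i' < Suc i \<and> P i'} = (if P i then insert i {i'. i' < i \<and> P i'} else {i'. i' < i \<and> P i'})"
    by (auto simp: less_Suc_eq)
  then show ?thesis by simp
qed

text \<open>Each round subtracts \<open>K \<ge> 1\<close>, so at most \<open>v\<close> rounds occur
  and the time is linear in the value \<open>v\<close>.\<close>

lemma wp_divide:
  assumes K: "nats s vK 0 = K" "1 \<le> K" and v: "nats s vV 0 = v"
  shows "wp z (For vQ (BNot (NLess (var vV) (var vK))) (assign vV (NSub (var vV) (var vK)))) s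
    (\<lambda>t s'. t \<le> 20 + 40 * v \<and> agree {vV, vQ} {} s s' \<and> nats s' vV 0 = v mod K \<and> nats s' vQ 0 = v div K)"
proof (rule wp_For[where N="v div K" and B=20 and
        I="\<lambda>q s'. agree {vV, vQ} {} s s' \<and> nats s' vV 0 = v - q * K"], goal_cases)
  case 1
  then show ?case using v by (simp add: agree_refl nats_nset)
next
  case (2 q s')
  have "nats s' vK 0 = K" using agree_nats[of _ _ s s' vK] 2 K by auto
  moreover have "K \<le> v - q * K \<longleftrightarrow> Suc q \<le> v div K"
    using K(2) less_eq_div_iff_mult_less_eq[of K "Suc q" v] by auto
  ultimately show ?case using 2 by (simp add: not_less Suc_le_eq)
next
  case (3 q s')
  have "nats s' vK 0 = K" using agree_nats[of _ _ s s' vK] 3 K by auto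
  with 3 show ?case by (simp add: nats_nset)
next
  case (4 t s')
  have "t \<le> 10 + v div K * 33" using 4(1) by simp
  then have "t \<le> 20 + 40 * v" using div_le_dividend[of v K] by linarith
  then show ?case using 4(2,3) by (simp add: minus_div_mult_eq_mod)
qed

lemma wp_decode:
  assumes s: "data s" and K: "nats s vK 0 = K" "1 \<le> K" "K \<le> n"
    and T: "nats s vT 0 = T" and zero: "\<And>j. j < n \<Longrightarrow> nats s aCount j = 0"
  shows "wp z decode s (\<lambda>t s'. t \<le> 100 * (n + 1) * (T + 1) \<and> agree {vI, vV, vQ, aCount} {} s s' \<and>
    (\<forall>j<n. nats s' aCount j = card {i. i < m \<and> T div K ^ i mod K = j}))"
  unfolding decode_def wp_Seq wp_NSet
proof (rule wp_For[where N=m and B="80 * (T + 1)" and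
        I="\<lambda>i s'. data s' \<and> agree {vI, vV, vQ, aCount} {} s s' \<and> nats s' vV 0 = T div K ^ i \<and>
          (\<forall>j<n. nats s' aCount j = card {i'. i' < i \<and> T div K ^ i' mod K = j})"], goal_cases)
  case 1
  then show ?case using s T zero by (simp add: agree_refl nats_nset)
next
  case (2 i s1)
  then show ?case by simp
next
  case (3 i s1)
  then have a1: "agree {vI, vV, vQ, aCount} {} s s1" and d1: "data s1" by auto
  have K1: "nats s1 vK 0 = K" using agree_nats[OF a1, of vK] K by simp
  have "nats s1 vV 0 = T div K ^ i" using 3 by simp
  from wp_divide[OF K1 K(2) this] show ?case
    unfolding wp_Seq
  proof (rule wp_mono, elim conjE, goal_cases)
    case (1 t s2)
    note a2 = \<open>agree {vV, vQ} {} s1 s2\<close>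
    have "agree {vI, vV, vQ, aCount} {} s s2" by (rule agree_trans[OF a1 a2]) auto
    moreover have "data s2" using data_agree[OF d1 a2] by simp
    moreover have "nats s2 aCount = nats s1 aCount" "nats s2 vI = nats s1 vI" using agree_nats[OF a2] by auto
    moreover have "T div K ^ i \<le> T" by simp
    moreover have q: "T div K ^ i div K = T div K ^ Suc i"
      by (simp only: power_Suc2 div_mult2_eq)
    moreover have "t \<le> 20 + 40 * T" using \<open>t \<le> 20 + 40 * (T div K ^ i)\<close> div_le_dividend[of T "K ^ i"] by linarith
    ultimately show ?case using 1[unfolded q] 3 by (auto simp: nats_nset card_less_Suc_filter simp del: power_Suc)
  qed
next
  case (4 t s')
  have "m * (80 * (T + 1) + 12) \<le> n * (92 * (T + 1))"
    using m_le_n by (intro mult_mono) auto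
  then have "t \<le> 9 + n * (92 * (T + 1))" using 4(1) by simp
  then have "t + 7 \<le> 100 * (n + 1) * (T + 1)" by (simp add: algebra_simps)
  then show ?case using 4 by simp
qed

text \<open>Deletion is greedy in index order. If a count exceeds the size of its cell, only the
  upper bound is claimed for that cell.\<close>

lemma wp_delete_clients:
  assumes s: "data s"
  shows "wp z delete_clients s (\<lambda>t s'. t \<le> 100 * (n + 1) \<and> agree {vI, aCount, aDel} {} s s' \<and>
    (\<exists>Y\<subseteq>X. (\<forall>p<n. nats s' aDel p = of_bool (p \<in> Y)) \<and>
      (\<forall>j. card {p \<in> Y. nats s aCell p = j} \<le> nats s aCount j \<and>
         (nats s aCount j \<le> card {p \<in> X. nats s aCell p = j} \<longrightarrow>
            card {p \<in> Y. nats s aCell p = j} = nats s aCount j))))"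
  unfolding delete_clients_def
\<comment> \<open>A positive remaining count means that no client of this cell has been spared so
  far; this forces equality at the end when the cell is large enough.\<close>
proof (rule wp_For[where N=n and B=50 and
   I="\<lambda>i s'. data s' \<and> agree {vI, aCount, aDel} {} s s' \<and>
     (\<exists>Y\<subseteq>X. Y \<subseteq> {..<i} \<and> (\<forall>p<i. nats s' aDel p = of_bool (p \<in> Y)) \<and>
       (\<forall>j. card {p \<in> Y. nats s aCell p = j} + nats s' aCount j = nats s aCount j \<and>
         (0 < nats s' aCount j \<longrightarrow> (\<forall>p\<in>X. p < i \<longrightarrow> nats s aCell p = j \<longrightarrow> p \<in> Y))))"], goal_cases)
  case 1
  then show ?case using s by (simp add: agree_refl nats_nset)
next
  case (2 i s')
  then show ?case by simp
next
  case (3 i s')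
  then obtain Y where Y: "Y \<subseteq> X" "Y \<subseteq> {..<i}" "\<And>p. p < i \<Longrightarrow> nats s' aDel p = of_bool (p \<in> Y)"
    "\<And>j. card {p \<in> Y. nats s aCell p = j} + nats s' aCount j = nats s aCount j"
    "\<And>j p. 0 < nats s' aCount j \<Longrightarrow> p \<in> X \<Longrightarrow> p < i \<Longrightarrow> nats s aCell p = j \<Longrightarrow> p \<in> Y" by blast
  have c: "nats s' aCell = nats s aCell" using 3 agree_nats[of "{vI, aCount, aDel}" "{}" s s' aCell] by simp
  have finY: "finite Y" using Y(2) finite_subset by blast
  have d: "data s'" and a: "agree {vI, aCount, aDel} {} s s'" and v: "nats s' vI 0 = i" using 3 by auto
  show ?case
  proof (cases "i \<in> X \<and> 0 < nats s' aCount (nats s aCell i)")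
    case True
    let ?Y = "insert i Y"
    have card: "card {p \<in> ?Y. nats s aCell p = j} = card {p \<in> Y. nats s aCell p = j} + of_bool (nats s aCell i = j)" for j
    proof -
      have "{p \<in> ?Y. nats s aCell p = j} = (if nats s aCell i = j then insert i {p \<in> Y. nats s aCell p = j} else {p \<in> Y. nats s aCell p = j})"
        by auto
      moreover have "i \<notin> Y" using Y(2) by auto
      ultimately show ?thesis using finY by simp
    qed
    have ex: "\<exists>Z\<subseteq>X. Z \<subseteq> {..<Suc i} \<and> (\<forall>p<Suc i. f p = of_bool (p \<in> Z)) \<and>
       (\<forall>j. card {p \<in> Z. nats s aCell p = j} + g j = nats s aCount j \<and>
         (0 < g j \<longrightarrow> (\<forall>p\<in>X. p < Suc i \<longrightarrow> nats s aCell p = j \<longrightarrow> p \<in> Z)))"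
      if "\<And>p. p < i \<Longrightarrow> f p = nats s' aDel p" "f i = 1"
        "\<And>j. g j = nats s' aCount j - of_bool (nats s aCell i = j)" for f g :: "nat \<Rightarrow> nat"
    proof (intro exI[of _ ?Y] conjI allI impI)
      fix j
      show "card {p \<in> ?Y. nats s aCell p = j} + g j = nats s aCount j"
        unfolding card using Y(4)[of j] True that(3)[of j] by (cases "nats s aCell i = j") auto
      show "\<forall>p\<in>X. p < Suc i \<longrightarrow> nats s aCell p = j \<longrightarrow> p \<in> ?Y" if "0 < g j"
        using Y(5)[of j] that \<open>\<And>j. g j = nats s' aCount j - of_bool (nats s aCell i = j)\<close>[of j]
        by (auto simp: less_Suc_eq)
      fix p assume "p < Suc i"
      then show "f p = of_bool (p \<in> ?Y)" using that(1,2) Y(3) by (auto simp: less_Suc_eq)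
    qed (use Y True in auto)
    let ?s = "nset vI 0 (Suc i) (nset aCount (nats s aCell i) (nats s' aCount (nats s aCell i) - 1) (nset aDel i 1 s'))"
    have "\<exists>Z\<subseteq>X. Z \<subseteq> {..<Suc i} \<and> (\<forall>p<Suc i. nats ?s aDel p = of_bool (p \<in> Z)) \<and>
       (\<forall>j. card {p \<in> Z. nats s aCell p = j} + nats ?s aCount j = nats s aCount j \<and>
         (0 < nats ?s aCount j \<longrightarrow> (\<forall>p\<in>X. p < Suc i \<longrightarrow> nats s aCell p = j \<longrightarrow> p \<in> Z)))"
      by (rule ex) (auto simp: nats_nset)
    then show ?thesis using d a v True by (simp add: nats_nset_other c)
  next
    case False
    have ex: "\<exists>Z\<subseteq>X. Z \<subseteq> {..<Suc i} \<and> (\<forall>p<Suc i. f p = of_bool (p \<in> Z)) \<and>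
       (\<forall>j. card {p \<in> Z. nats s aCell p = j} + nats s' aCount j = nats s aCount j \<and>
         (0 < nats s' aCount j \<longrightarrow> (\<forall>p\<in>X. p < Suc i \<longrightarrow> nats s aCell p = j \<longrightarrow> p \<in> Z)))"
      if "\<And>p. p < i \<Longrightarrow> f p = nats s' aDel p" "f i = 0" for f :: "nat \<Rightarrow> nat"
    proof (intro exI[of _ Y] conjI allI impI)
      fix p assume "p < Suc i"
      then show "f p = of_bool (p \<in> Y)" using that(1,2) Y(2,3) by (auto simp: less_Suc_eq)
    qed (use Y False in \<open>auto simp: less_Suc_eq\<close>)
    let ?s = "nset vI 0 (Suc i) (nset aDel i 0 s')"
    have "\<exists>Z\<subseteq>X. Z \<subseteq> {..<Suc i} \<and> (\<forall>p<Suc i. nats ?s aDel p = of_bool (p \<in> Z)) \<and>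
       (\<forall>j. card {p \<in> Z. nats s aCell p = j} + nats s' aCount j = nats s aCount j \<and>
         (0 < nats s' aCount j \<longrightarrow> (\<forall>p\<in>X. p < Suc i \<longrightarrow> nats s aCell p = j \<longrightarrow> p \<in> Z)))"
      by (rule ex) (auto simp: nats_nset)
    moreover have "\<not> bval z (BAnd (pos (NGet 1 (var vI))) (pos (NGet aCount (NGet aCell (var vI))))) s'"
      using d v False by (auto simp: c)
    ultimately show ?thesis using d a v by (simp add: nats_nset_other c del: bval.simps)
  qed
next
  case (4 t s')
  then obtain Y where Y: "Y \<subseteq> X" "Y \<subseteq> {..<n}" "\<And>p. p < n \<Longrightarrow> nats s' aDel p = of_bool (p \<in> Y)"
    "\<And>j. card {p \<in> Y. nats s aCell p = j} + nats s' aCount j = nats s aCount j"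
    "\<And>j p. 0 < nats s' aCount j \<Longrightarrow> p \<in> X \<Longrightarrow> p < n \<Longrightarrow> nats s aCell p = j \<Longrightarrow> p \<in> Y" by blast
  have "card {p \<in> Y. nats s aCell p = j} = nats s aCount j"
    if "nats s aCount j \<le> card {p \<in> X. nats s aCell p = j}" for j
  proof (cases "nats s' aCount j = 0")
    case True
    then show ?thesis using Y(4)[of j] by simp
  next
    case False
    then have "{p \<in> X. nats s aCell p = j} \<subseteq> {p \<in> Y. nats s aCell p = j}" using Y(5) X_less by auto
    then have "card {p \<in> X. nats s aCell p = j} \<le> card {p \<in> Y. nats s aCell p = j}"
      using Y(2) finite_subset[of Y "{..<n}"] by (intro card_mono) auto
    then show ?thesis using that Y(4)[of j] by simp
  qed
  moreover have "card {p \<in> Y. nats s aCell p = j} \<le> nats s aCount j" for j using Y(4)[of j] by simp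
  moreover have "t \<le> 100 * (n + 1)" using 4(1) by simp
  ultimately show ?case using 4(2) Y(1,3) by (intro conjI exI[of _ Y] allI impI) simp_all
qed

end

section \<open>One guess\<close>

context outlier_problem
begin

lemma wp_write_row:
  assumes s: "data s" and del: "\<And>p. p < n \<Longrightarrow> nats s aDel p = of_bool (p \<in> Y)"
    and i: "nats s vI 0 = i" "i < n" and D: "reals s rD 0 0 = D" and B: "nats s vBase 0 = B"
  shows "wp z write_row s (\<lambda>t s'. t \<le> 100 * (n + 1) \<and> agree {vJ} {20} s s' \<and>
    reals s' 20 = (reals s 20)(B + i := (\<lambda>j. if j < n then remote d D (Y - F) i j else reals s 20 (B + i) j)))"
  unfolding write_row_def
proof (rule wp_For[where N=n and B=60 and I="\<lambda>j s'. agree {vJ} {20} s s' \<and>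
    reals s' 20 = (reals s 20)(B + i := (\<lambda>j'. if j' < j then remote d D (Y - F) i j' else reals s 20 (B + i) j'))"], goal_cases)
  case 1
  then show ?case by (simp add: agree_refl)
next
  case (2 j s')
  have "data s'" using data_agree[OF s conjunct1[OF 2(1)]] by simp
  then show ?case using 2 by simp
next
  case (3 j s')
  then have a: "agree {vJ} {20} s s'" by simp
  have d: "data s'" using data_agree[OF s a] by simp
  have e: "nats s' aDel = nats s aDel" "nats s' vI = nats s vI" "nats s' vBase = nats s vBase" "reals s' rD = reals s rD"
    using agree_nats[OF a] agree_reals[OF a] by auto
  have upd: "(f(x := (\<lambda>j'. if j' < j then g j' else h j')))(x := ((f(x := (\<lambda>j'. if j' < j then g j' else h j'))) x)(j := g j))
     = f(x := (\<lambda>j'. if j' < Suc j then g j' else h j'))" for f :: "nat \<Rightarrow> nat \<Rightarrow> real" and g h x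
    by (auto simp: fun_eq_iff less_Suc_eq)
  have r: "reals (rset 20 (B + i) j v s') 20 = (reals s' 20)(B + i := (reals s' 20 (B + i))(j := v))" for v
    by (simp add: rset_def)
  have cond: "bval z (BAnd (pos (NAdd (is_remote vI) (is_remote vJ)))
               (pos (NAdd (NSub (var vI) (var vJ)) (NSub (var vJ) (var vI))))) s'
     \<longleftrightarrow> (i \<in> Y - F \<or> j \<in> Y - F) \<and> i \<noteq> j"
    using d e i 3 del[of i] del[of j] by (auto simp: is_remote_def)
  have "wp z (RSet 20 (NAdd (var vBase) (var vI)) (var vJ) (rvar rD)) s'
      (\<lambda>t s''. t \<le> 20 \<and> s'' = rset 20 (B + i) j D s')"
    "wp z (RSet 20 (NAdd (var vBase) (var vI)) (var vJ) (RGet 0 (var vI) (var vJ))) s'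
      (\<lambda>t s''. t \<le> 20 \<and> s'' = rset 20 (B + i) j (d i j) s')"
    using d e i B D 3 by simp_all
  then have w: "wp z (Cond (BAnd (pos (NAdd (is_remote vI) (is_remote vJ)))
               (pos (NAdd (NSub (var vI) (var vJ)) (NSub (var vJ) (var vI)))))
       (RSet 20 (NAdd (var vBase) (var vI)) (var vJ) (rvar rD))
       (RSet 20 (NAdd (var vBase) (var vI)) (var vJ) (RGet 0 (var vI) (var vJ)))) s'
     (\<lambda>t s''. t \<le> 60 \<and> s'' = rset 20 (B + i) j (remote d D (Y - F) i j) s')"
    unfolding wp_Cond cond by (auto simp: remote_def is_remote_def elim!: wp_mono)
  show ?case
    using w
  proof (rule wp_mono, elim conjE, goal_cases)
    case (1 t s'')
    have "reals s'' 20 = (reals s 20)(B + i := (\<lambda>j'. if j' < Suc j then remote d D (Y - F) i j' else reals s 20 (B + i) j'))"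
      unfolding \<open>s'' = _\<close> r using 3 by (simp only: upd)
    then show ?case using 1 3 a by simp
  qed
next
  case (4 t s')
  then show ?case by (simp add: is_remote_def)
qed

text \<open>The same memory in both outer positions of \<open>simulates\<close> says that the call
  is about to start on its encoded input.\<close>

lemma wp_write_instance:
  assumes s: "data s" and del: "\<And>p. p < n \<Longrightarrow> nats s aDel p = of_bool (p \<in> Y)" and Y: "Y \<subseteq> X"
    and D: "reals s rD 0 0 = D" and B: "nats s vBase 0 = B"
    and fresh: "\<And>a q j. nats s (a + 20) (B + q) = 0 \<and> reals s (a + 20) (B + q) j = 0"
  shows "wp z write_instance s (\<lambda>t s'. t \<le> 300 * (n + 1)\<^sup>2 \<and> agree {vI, vJ, vTop, 20, 21, 22} {20} s s' \<and>
    simulates s' (encode (remote d D (Y - F)) (X - Y) (F \<union> Y) k 0) s')"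
  unfolding write_instance_def wp_Seq
proof (rule wp_For[where N=n and B="100 * (n + 1) + 100" and I="\<lambda>i s'. agree {vI, vJ, 21, 22} {20} s s' \<and>
    (\<forall>q. nats s' 21 (B + q) = of_bool (q < i \<and> q \<in> X - Y)) \<and>
    (\<forall>q. nats s' 22 (B + q) = of_bool (q < i \<and> q \<in> F \<union> Y)) \<and>
    (\<forall>q j. reals s' 20 (B + q) j = (if q < i \<and> j < n then remote d D (Y - F) q j else 0))"], goal_cases)
  case 1
  then show ?case using fresh[of 1] fresh[of 2] fresh[of 0] by (simp add: agree_refl nats_nset)
next
  case (2 i s')
  have "data s'" using data_agree[OF s conjunct1[OF 2(1)]] by simp
  then show ?case using 2 by simp
next
  case (3 i s1)
  then have a1: "agree {vI, vJ, 21, 22} {20} s s1" by simp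
  have d1: "data s1" using data_agree[OF s a1] by simp
  have e1: "nats s1 aDel = nats s aDel" "nats s1 vBase = nats s vBase" "reals s1 rD = reals s rD"
    using agree_nats[OF a1] agree_reals[OF a1] by auto
  define s2 where "s2 = nset 22 (B + i) (of_bool (i \<in> F \<union> Y)) (nset 21 (B + i) (of_bool (i \<in> X - Y)) s1)"
  have v21: "nats s1 (Suc 0) i - nats s1 aDel i = of_bool (i \<in> X - Y)"
    and v22: "nats s1 2 i + (nats s1 aDel i - nats s1 2 i) = of_bool (i \<in> F \<union> Y)"
    using d1 e1 del[of i] 3 by auto
  have d2: "data s2" using d1 by (simp add: s2_def)
  have e2: "nats s2 aDel = nats s aDel" "nats s2 vBase = nats s vBase" "reals s2 rD = reals s rD"
    "nats s2 vI = nats s1 vI" "reals s2 = reals s1"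
    using e1 by (auto simp: s2_def nats_nset_other)
  have row: "wp z write_row s2 (\<lambda>t s'. t \<le> 100 * (n + 1) \<and> agree {vJ} {20} s2 s' \<and>
    reals s' 20 = (reals s2 20)(B + i := (\<lambda>j. if j < n then remote d D (Y - F) i j else reals s2 20 (B + i) j)))"
    using del e2 3 D B by (intro wp_write_row[OF d2]) auto
  have row': "wp z write_row s2 (\<lambda>t s'. t + 40 \<le> 100 * (n + 1) + 100 \<and> nats s' vI 0 = i \<and>
     agree {vI, vJ, 21, 22} {20} s s' \<and>
    (\<forall>q. nats s' 21 (B + q) = of_bool (q < Suc i \<and> q \<in> X - Y)) \<and>
    (\<forall>q. nats s' 22 (B + q) = of_bool (q < Suc i \<and> q \<in> F \<union> Y)) \<and>
    (\<forall>q j. reals s' 20 (B + q) j = (if q < Suc i \<and> j < n then remote d D (Y - F) q j else 0)))"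
    using row
  proof (rule wp_mono, elim conjE, goal_cases)
    case (1 t s')
    note a2 = \<open>agree {vJ} {20} s2 s'\<close>
    have "agree {vI, vJ, 21, 22} {20} s s2" using a1 by (simp add: s2_def)
    then have "agree {vI, vJ, 21, 22} {20} s s'" by (rule agree_trans[OF _ a2]) auto
    moreover have "nats s' 21 = nats s2 21" "nats s' 22 = nats s2 22" "nats s' vI = nats s2 vI"
      using agree_nats[OF a2] by auto
    moreover have "nats s2 21 (B + q) = of_bool (q < Suc i \<and> q \<in> X - Y)"
      "nats s2 22 (B + q) = of_bool (q < Suc i \<and> q \<in> F \<union> Y)" for q
      using 3 by (auto simp: s2_def nats_nset less_Suc_eq)
    moreover have "reals s' 20 (B + q) j = (if q < Suc i \<and> j < n then remote d D (Y - F) q j else 0)" for q j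
      using 3 e2(5) \<open>reals s' 20 = _\<close> by (auto simp: less_Suc_eq)
    ultimately show ?case using 1 3 e2 by simp
  qed
  let ?s1 = "nset 21 (B + i) (of_bool (i \<in> X - Y)) s1"
  have v: "nval (NAdd (var vBase) (var vI)) s1 = B + i"
    "nval (NSub (NGet 1 (var vI)) (NGet aDel (var vI))) s1 = of_bool (i \<in> X - Y)"
    "nval (NAdd (var vBase) (var vI)) ?s1 = B + i"
    "nval (NAdd (NGet 2 (var vI)) (is_remote vI)) ?s1 = of_bool (i \<in> F \<union> Y)"
    using 3 e1 B v21 v22 by (simp_all add: is_remote_def nats_nset_other)
  show ?case
    unfolding wp_Seq wp_NSet v s2_def[symmetric]
    by (rule wp_mono[OF row']) (simp add: is_remote_def nats_nset_other)
next
  case (4 t s1)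
  then have a1: "agree {vI, vJ, 21, 22} {20} s s1" by simp
  have d1: "data s1" using data_agree[OF s a1] by simp
  have B1: "nats s1 vBase 0 = B" using agree_nats[OF a1, of vBase] B by simp
  define s' where "s' = nset vTop 0 (B + (n + 2)) (nset 20 (Suc B) k (nset 20 B n s1))"
  have t: "t + 100 \<le> 300 * (n + 1)\<^sup>2" using 4(1) by (simp add: power2_eq_square algebra_simps)
  have "agree {vI, vJ, vTop, 20, 21, 22} {20} s s1" using a1 by (auto simp: agree_def)
  then have a': "agree {vI, vJ, vTop, 20, 21, 22} {20} s s'" by (simp add: s'_def)
  have n20: "nats s1 20 (B + q) = 0" for q using agree_nats[OF a1, of 20] fresh[of 0 q] by simp
  have n': "nats s' (a + 20) (B + q) = nats (encode (remote d D (Y - F)) (X - Y) (F \<union> Y) k 0) a q" for a q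
  proof -
    have XF: "X - Y \<union> (F \<union> Y) = {..<n}" using Y inst_facts(9) by auto
    consider "a = 0" | "a = 1" | "a = 2" | "a \<ge> 3" by linarith
    then show ?thesis
    proof cases
      case 1
      then show ?thesis using n20 by (auto simp: s'_def encode_def nats_nset XF)
    next
      case 2
      then show ?thesis using 4 X_less by (auto simp: s'_def encode_def nats_nset)
    next
      case 3
      then show ?thesis using 4 F_less X_less Y by (auto simp: s'_def encode_def nats_nset)
    next
      case 4
      then have "nats s1 (a + 20) = nats s (a + 20)" by (intro agree_nats[OF a1]) auto
      then show ?thesis using 4 fresh[of a q] by (auto simp: s'_def encode_def nats_nset)
    qed
  qed
  have r': "reals s' (a + 20) (B + q) j = reals (encode (remote d D (Y - F)) (X - Y) (F \<union> Y) k 0) a q j" for a q j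
  proof -
    have XF: "X - Y \<union> (F \<union> Y) = {..<n}" using Y inst_facts(9) by auto
    show ?thesis
    proof (cases "a = 0")
      case True
      then show ?thesis using 4 by (simp add: s'_def encode_def XF)
    next
      case False
      then have "reals s1 (a + 20) = reals s (a + 20)" by (intro agree_reals[OF a1]) auto
      then show ?thesis using fresh[of a q j] False by (simp add: s'_def encode_def)
    qed
  qed
  have B': "nats s' vBase 0 = B" and top: "nats s' vTop 0 = B + (n + 2)" using B1 by (simp_all add: s'_def nats_nset)
  have "fresh s'"
    unfolding fresh_def top
  proof (intro allI impI)
    fix a i j assume "B + (n + 2) \<le> i"
    then obtain q where q: "i = B + q" "q \<ge> n + 2" by (metis add.assoc le_add1 le_iff_add nat_add_left_cancel_le)
    have "q \<notin> X" "q \<notin> F" using q X_less[of q] F_less[of q] by auto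
    then have "nats s' (a + 20) (B + q) = 0" "reals s' (a + 20) (B + q) j = 0"
      unfolding n' r' using q Y by (auto simp: encode_def)
    then show "nats s' (a + 20) i = 0 \<and> reals s' (a + 20) i j = 0" using q by simp
  qed
  then have "simulates s' (encode (remote d D (Y - F)) (X - Y) (F \<union> Y) k 0) s'"
    using n' r' top by (simp add: simulates_def B')
  then show ?case
    using d1 B1 a' t by (simp add: nats_nset_other s'_def)
qed

lemma wp_read_candidate:
  assumes s: "data s" and f: "nats s vF 0 = f" "f \<in> F" and B: "nats s vBase 0 = B"
    and C': "C' = {i. i < n \<and> nats s 23 (B + i) \<noteq> 0}"
  shows "wp z read_candidate s (\<lambda>t s'. t \<le> 200 * (n + 1) \<and> agree {vI, vSize, aCand} {} s s' \<and>
    (\<forall>i<n. nats s' aCand i = of_bool (i \<in> repair F f C')) \<and> nats s' vSize 0 = card (repair F f C'))"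
  unfolding read_candidate_def wp_Seq wp_NSet
proof (rule wp_For[where N=n and B=60 and I="\<lambda>i s'. agree {vI, vSize, aCand} {} s s' \<and>
    (\<forall>p<i. nats s' aCand p = of_bool (p \<in> F \<inter> C')) \<and> nats s' vSize 0 = card {p. p < i \<and> p \<in> F \<inter> C'}"], goal_cases)
  case 1
  then show ?case by (simp add: agree_refl nats_nset)
next
  case (2 i s')
  have "data s'" using data_agree[OF s conjunct1[OF 2(1)]] by simp
  then show ?case using 2 by simp
next
  case (3 i s')
  then have a: "agree {vI, vSize, aCand} {} s s'" by simp
  have d: "data s'" using data_agree[OF s a] by simp
  have e: "nats s' vBase = nats s vBase" "nats s' 23 = nats s 23" using agree_nats[OF a] by auto
  have cond: "bval z (BAnd (pos (NGet 2 (var vI))) (pos (NGet 23 (NAdd (var vBase) (var vI))))) s' \<longleftrightarrow> i \<in> F \<inter> C'"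
    using d e B 3 C' by auto
  have cs: "card {p. p < Suc i \<and> p \<in> F \<inter> C'} = card {p. p < i \<and> p \<in> F \<inter> C'} + of_bool (i \<in> F \<inter> C')"
    by (rule card_less_Suc_filter)
  show ?case
  proof (cases "i \<in> F \<inter> C'")
    case True
    then have "card {p. p < Suc i \<and> p \<in> F \<inter> C'} = Suc (card {p. p < i \<and> p \<in> F \<inter> C'})" using cs by simp
    then show ?thesis unfolding wp_Cond cond if_P[OF True] using 3 True by (simp add: nats_nset All_less_Suc)
  next
    case False
    then have "card {p. p < Suc i \<and> p \<in> F \<inter> C'} = card {p. p < i \<and> p \<in> F \<inter> C'}" using cs by simp
    then show ?thesis unfolding wp_Cond cond if_not_P[OF False] using 3 False by (simp add: nats_nset All_less_Suc)
  qed
next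
  case (4 t s')
  then have a: "agree {vI, vSize, aCand} {} s s'" by simp
  have e: "nats s' vF 0 = f" using agree_nats[OF a, of vF] f by simp
  have c: "{p. p < n \<and> p \<in> F \<inter> C'} = F \<inter> C'" using F_less by auto
  have fin: "finite (F \<inter> C')" using inst_facts(5) by simp
  show ?case
  proof (cases "F \<inter> C' = {}")
    case True
    then show ?thesis using 4 e a c by (simp add: repair_def nats_nset)
  next
    case False
    then have "card (F \<inter> C') > 0" using fin by (simp add: card_gt_0_iff)
    then show ?thesis using 4 False a c by (simp add: repair_def)
  qed
qed

lemma wp_compute_cost:
  assumes s: "data s" and del: "\<And>p. p < n \<Longrightarrow> nats s aDel p = of_bool (p \<in> Y)"
    and D: "reals s rD 0 0 = D" "\<And>i j. i < n \<Longrightarrow> j < n \<Longrightarrow> d i j < D"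
    and C: "\<And>i. i < n \<Longrightarrow> nats s aCand i = of_bool (i \<in> C)" "C \<subseteq> F" "C \<noteq> {}"
  shows "wp z compute_cost s (\<lambda>t s'. t \<le> 200 * (n + 1)\<^sup>2 \<and> agree {vI, vJ} {rCost, rMin} s s' \<and>
    reals s' rCost 0 0 = cost z d (X - Y) C)"
  unfolding compute_cost_def wp_Seq wp_RSet
proof (rule wp_For[where N=n and B="100 * (n + 1)" and I="\<lambda>i s'. agree {vI, vJ} {rCost, rMin} s s' \<and>
    reals s' rCost 0 0 = cost z d {p. p < i \<and> p \<in> X - Y} C"], goal_cases)
  case 1
  then show ?case by (simp add: agree_refl reals_rset cost_def)
next
  case (2 i s')
  have "data s'" using data_agree[OF s conjunct1[OF 2(1)]] by simp
  then show ?case using 2 by simp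
next
  case (3 i s1)
  then have a1: "agree {vI, vJ} {rCost, rMin} s s1" by simp
  have d1: "data s1" using data_agree[OF s a1] by simp
  have e1: "nats s1 aDel = nats s aDel" "reals s1 rD = reals s rD" using agree_nats[OF a1] agree_reals[OF a1] by auto
  have set: "{p. p < Suc i \<and> p \<in> X - Y} = (if i \<in> X - Y then insert i {p. p < i \<and> p \<in> X - Y} else {p. p < i \<and> p \<in> X - Y})"
    by (auto simp: less_Suc_eq)
  have cond: "bval z (NLess (NGet aDel (var vI)) (NGet 1 (var vI))) s1 \<longleftrightarrow> i \<in> X - Y"
    using 3 d1 e1 del[of i] by auto
  show ?case
  proof (cases "i \<in> X - Y")
    case False
    then have "{p. p < Suc i \<and> p \<in> X - Y} = {p. p < i \<and> p \<in> X - Y}" by (auto simp: less_Suc_eq)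
    then show ?thesis unfolding wp_Cond cond if_not_P[OF False] using 3 by simp
  next
    case True
    have fin: "finite C" using C(2) inst_facts(5) finite_subset by blast
    \<comment> \<open>\<open>D\<close> is a safe initial value: it exceeds all distances, and
      \<open>C\<close> is nonempty.\<close>
    define mn where "mn j = Min (insert D (d i ` {c. c < j \<and> c \<in> C}))" for j
    have mn0: "mn 0 = D" by (simp add: mn_def)
    have mnS: "mn (Suc j) = (if j \<in> C then min (d i j) (mn j) else mn j)" for j
    proof -
      have "{c. c < Suc j \<and> c \<in> C} = (if j \<in> C then insert j {c. c < j \<and> c \<in> C} else {c. c < j \<and> c \<in> C})"
        by (auto simp: less_Suc_eq)
      then show ?thesis unfolding mn_def by (simp add: insert_commute[of D])
    qed
    have mnn: "mn n = (MIN c\<in>C. d i c)"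
    proof -
      have c: "{c. c < n \<and> c \<in> C} = C" using C(2) F_less by auto
      obtain c where "c \<in> C" using C(3) by blast
      then have "Min (d i ` C) \<le> d i c" "d i c < D" using fin D(2) \<open>i < n\<close> C(2) F_less by auto
      moreover have "Min (insert D (d i ` C)) = min D (Min (d i ` C))" using fin C(3) by simp
      ultimately show ?thesis unfolding mn_def c by linarith
    qed
    have loop: "wp z (loopN vJ (Cond (BAnd (pos (NGet aCand (var vJ)))
               (RLess (RGet 0 (var vI) (var vJ)) (rvar rMin)))
            (rassign rMin (RGet 0 (var vI) (var vJ))) Skip)) (rset rMin 0 0 D s1)
         (\<lambda>t s'. t \<le> 70 * n + 20 \<and> agree {vJ} {rMin} s1 s' \<and> reals s' rMin 0 0 = (MIN c\<in>C. d i c))"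
    proof (rule wp_For[where N=n and B=40 and I="\<lambda>j s'. agree {vJ} {rMin} s1 s' \<and>
        reals s' rMin 0 0 = mn j"], goal_cases)
      case 1
      then show ?case by (simp add: agree_refl reals_rset mn0)
    next
      case (2 j s')
      have "data s'" using data_agree[OF d1 conjunct1[OF 2(1)]] by simp
      then show ?case using 2 by simp
    next
      case (3 j s2)
      then have a2: "agree {vJ} {rMin} s1 s2" by simp
      have d2: "data s2" using data_agree[OF d1 a2] by simp
      have e2: "nats s2 aCand j = of_bool (j \<in> C)" "nats s2 vI 0 = i"
        using agree_nats[OF a2] agree_nats[OF a1] C(1) 3 \<open>nats s1 vI 0 = i\<close> by auto
      show ?case
        using 3 d2 e2 \<open>i < n\<close> by (auto simp: reals_rset min_def nats_nset_other mnS)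
    next
      case (4 t s2)
      then show ?case using mnn by simp
    qed
    have D1: "reals s1 (Suc 0) 0 0 = D" using e1 D by simp
    have cost: "cost z d {p. p < Suc i \<and> p \<in> X - Y} C = cost z d {p. p < i \<and> p \<in> X - Y} C + (MIN c\<in>C. d i c) powr z"
      unfolding set using True by (simp add: cost_def point_cost_def)
    have "wp z (Seq (rassign rMin (rvar rD))
       (Seq (loopN vJ (Cond (BAnd (pos (NGet aCand (var vJ)))
               (RLess (RGet 0 (var vI) (var vJ)) (rvar rMin)))
            (rassign rMin (RGet 0 (var vI) (var vJ))) Skip))
         (rassign rCost (RAdd (rvar rCost) (RPow (rvar rMin)))))) s1
       (\<lambda>t s'. t + 10 \<le> 100 * (n + 1) \<and> nats s' vI 0 = i \<and> agree {vI, vJ} {rCost, rMin} s s' \<and>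
          reals s' rCost 0 0 = cost z d {p. p < Suc i \<and> p \<in> X - Y} C)"
      unfolding wp_Seq wp_RSet
      apply (simp add: D1)
      apply (rule wp_mono[OF loop])
    proof (elim conjE, goal_cases)
      case (1 t s')
      note a2 = \<open>agree {vJ} {rMin} s1 s'\<close>
      have "agree {vI, vJ} {rCost, rMin} s s'" by (rule agree_trans[OF a1 a2]) auto
      then show ?case using 1 3 cost agree_nats[OF a2, of vI] agree_reals[OF a2, of rCost]
        by (simp add: reals_rset)
    qed
    then show ?thesis
      unfolding wp_Cond cond if_P[OF True] by (rule wp_mono) auto
  qed
next
  case (4 t s')
  have "{p. p < n \<and> p \<in> X - Y} = X - Y" using X_less by auto
  moreover have "t + 10 \<le> 200 * (n + 1)\<^sup>2" using 4(1) by (simp add: power2_eq_square algebra_simps)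
  ultimately show ?case using 4 by simp
qed

lemma wp_update_best:
  assumes s: "data s" and c: "reals s rCost 0 0 = c"
    and C: "\<And>i. i < n \<Longrightarrow> nats s aCand i = of_bool (i \<in> C)" "C \<subseteq> F" and size: "nats s vSize 0 = card C"
  shows "wp z update_best s (\<lambda>t s'. t \<le> 100 * (n + 1) \<and> agree {vI, 3} {rBest} s s' \<and>
    (if card C \<le> k \<and> (reals s rBest 0 0 < 0 \<or> c < reals s rBest 0 0)
     then reals s' rBest 0 0 = c \<and> returned n s' = C
     else reals s' rBest 0 0 = reals s rBest 0 0 \<and> returned n s' = returned n s))"
proof -
  have loop: "wp z (loopN vI (NSet 3 (var vI) (NGet aCand (var vI)))) s1
     (\<lambda>t s'. t \<le> 50 * (n + 1) \<and> agree {vI, 3} {} s1 s' \<and> returned n s' = C)" 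
    if s1: "s1 = rset rBest 0 0 c s" for s1
  proof (rule wp_For[where N=n and B=20 and I="\<lambda>i s'. data s' \<and> agree {vI, 3} {} s1 s' \<and>
     (\<forall>p<i. nats s' 3 p = of_bool (p \<in> C))"], goal_cases)
    case 1
    then show ?case using s s1 by (simp add: agree_refl)
  next
    case (2 i s')
    then show ?case by simp
  next
    case (3 i s')
    then show ?case using agree_nats[of "{vI, 3}" "{}" s1 s' aCand] C(1)[of i] s1 by (auto simp: nats_nset less_Suc_eq)
  next
    case (4 t s')
    then show ?case using C(2) F_less by (auto simp: returned_def)
  qed
  have cond: "bval z (BAnd (BNot (NLess inputK (var vSize)))
        (BNot (BAnd (BNot (RLess (rvar rBest) (ROfNat (NLit 0)))) (BNot (RLess (rvar rCost) (rvar rBest)))))) s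
     \<longleftrightarrow> card C \<le> k \<and> (reals s rBest 0 0 < 0 \<or> c < reals s rBest 0 0)"
    using s size c by auto
  show ?thesis
  proof (cases "card C \<le> k \<and> (reals s rBest 0 0 < 0 \<or> c < reals s rBest 0 0)")
    case True
    then show ?thesis
      unfolding update_best_def wp_Cond cond if_P[OF True]
      apply (simp add: c)
      apply (rule wp_mono[OF loop[OF refl]])
      apply (elim conjE)
      subgoal for t s'
        using agree_reals[of "{vI, 3}" "{}" "rset rBest 0 0 c s" s'] agree_trans[of "{}" "{rBest}" s "rset rBest 0 0 c s" "{vI, 3}" "{}" s' "{vI, 3}" "{rBest}"]
        by (auto simp: reals_rset agree_refl)
      done
  next
    case False
    then show ?thesis
      unfolding update_best_def wp_Cond cond if_not_P[OF False] by (simp add: agree_refl)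
  qed
qed

end

lemma card_fibers:
  assumes "finite A" "finite J" "f ` A \<subseteq> J"
  shows "card A = (\<Sum>j\<in>J. card {a \<in> A. f a = j})"
  using sum.group[OF assms, of "\<lambda>_. 1 :: nat"] by simp

text \<open>Induction on the number of digits, prefixing the lowest digit: the witness is
  \<open>g 0 + K * T\<close>.\<close>

lemma digits_exist:
  fixes K :: nat
  assumes "\<And>i. i < m \<Longrightarrow> g i < K"
  shows "\<exists>T<K ^ m. \<forall>i<m. T div K ^ i mod K = g i"
  using assms
proof (induction m arbitrary: g)
  case 0
  then show ?case by simp
next
  case (Suc m)
  obtain T where T: "T < K ^ m" "\<And>i. i < m \<Longrightarrow> T div K ^ i mod K = g (Suc i)"
    using Suc.IH[of "\<lambda>i. g (Suc i)"] Suc.prems by auto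
  have g0: "g 0 < K" using Suc.prems by simp
  have "g 0 + K * T < K * Suc T" using g0 by simp
  also have "\<dots> \<le> K ^ Suc m" using T(1) by (metis Suc_leI mult_le_mono2 power_Suc)
  finally have "g 0 + K * T < K ^ Suc m" .
  moreover have "(g 0 + K * T) div K ^ i mod K = g i" if "i < Suc m" for i
  proof (cases i)
    case 0
    then show ?thesis using g0 by simp
  next
    case (Suc i')
    have "(g 0 + K * T) div K ^ i = (g 0 + K * T) div K div K ^ i'"
      unfolding Suc power_Suc by (rule div_mult2_eq)
    also have "(g 0 + K * T) div K = T" using g0 by simp
    finally show ?thesis using T(2)[of i'] Suc that by simp
  qed
  ultimately show ?case by blast
qed

text \<open>Fixes the outcome of the preprocessing, so that the loop over the guesses can be
  analysed without knowing how the cells arose.\<close>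

locale guessing = outlier_problem +
  fixes D :: real and f K :: nat and cell :: "nat \<Rightarrow> nat"
  assumes D_pos: "D \<ge> 1" and D_bound: "\<And>i j. i < n \<Longrightarrow> j < n \<Longrightarrow> d i j < D"
    and f: "f \<in> F" and K: "1 \<le> K" "K \<le> n" and cell: "\<And>p. p \<in> X \<Longrightarrow> cell p < K"
begin

definition static :: "memory \<Rightarrow> bool" where
  "static s \<longleftrightarrow> data s \<and> reals s rD 0 0 = D \<and> nats s vF 0 = f \<and> nats s vK 0 = K \<and>
     nats s aCell = cell \<and> reals s rM 0 0 = real K ^ m"

lemma static_agree:
  "static s \<Longrightarrow> agree A R s s' \<Longrightarrow> {0, 1, 2, vF, vK, aCell} \<inter> A = {} \<Longrightarrow> {0, rD, rM} \<inter> R = {} \<Longrightarrow> static s'"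
  using data_agree[of s A R s'] by (auto simp: static_def agree_def)

definition count :: "nat \<Rightarrow> nat \<Rightarrow> nat" where
  "count T j = card {i. i < m \<and> T div K ^ i mod K = j}"

text \<open>A relation and not a function: which clients of a cell are deleted is irrelevant for the
  approximation, only their number counts.\<close>

definition guessed :: "nat \<Rightarrow> nat set \<Rightarrow> bool" where
  "guessed T Y \<longleftrightarrow> Y \<subseteq> X \<and> card Y \<le> m \<and>
     (\<forall>j<K. count T j \<le> card {p \<in> X. cell p = j} \<longrightarrow> card {p \<in> Y. cell p = j} = count T j)"

abbreviation subinstance :: "nat set \<Rightarrow> memory" where
  "subinstance Y \<equiv> encode (remote d D (Y - F)) (X - Y) (F \<union> Y) k 0"

lemma subinstance_valid:
  assumes "Y \<subseteq> X"
  shows "clustering_instance (X \<union> F) (remote d D (Y - F)) (X - Y) (F \<union> Y) k"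
    and "card (X - Y \<union> (F \<union> Y)) = n"
proof -
  have "d a b \<le> D" if "a \<in> X \<union> F" "b \<in> X \<union> F" for a b
    using D_bound[of a b] that inst_facts(9) by auto
  then show "clustering_instance (X \<union> F) (remote d D (Y - F)) (X - Y) (F \<union> Y) k"
    using remote_instance[OF inst_facts(10) assms, of D] D_pos by auto
  have "X - Y \<union> (F \<union> Y) = X \<union> F" using assms by auto
  then show "card (X - Y \<union> (F \<union> Y)) = n" using inst_facts(9) by simp
qed

lemma wp_prepare:
  assumes s: "static s" and fr: "fresh s" and T: "nats s vT 0 = T"
  shows "wp z prepare s (\<lambda>t s'. t \<le> 700 * (n + 1)\<^sup>2 * (T + 1) \<and> static s' \<and> nats s' vT 0 = T \<and>
    reals s' rBest = reals s rBest \<and> nats s' 3 = nats s 3 \<and>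
    (\<exists>Y. guessed T Y \<and> (\<forall>p<n. nats s' aDel p = of_bool (p \<in> Y)) \<and> simulates s' (subinstance Y) s'))"
proof -
  \<comment> \<open>The mark reached by earlier calls becomes the base of the new region.\<close>
  define s1 where "s1 = nset vBase 0 (nats s vTop 0) s"
  let ?A = "{vI, vJ, vTop, vV, vQ, aCount, aDel, 20, 21, 22}"
  have st1: "static s1" using s by (auto simp: static_def s1_def nats_nset_other)
  have d1: "data s1" using st1 by (simp add: static_def)
  have "wp z (Seq clear_counts (Seq decode (Seq delete_clients write_instance))) s1
    (\<lambda>t s'. t + 10 \<le> 700 * (n + 1)\<^sup>2 * (T + 1) \<and> agree ?A {20} s1 s' \<and>
       (\<exists>Y. guessed T Y \<and> (\<forall>p<n. nats s' aDel p = of_bool (p \<in> Y)) \<and> simulates s' (subinstance Y) s'))"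
    unfolding wp_Seq
    using wp_clear_counts[OF d1]
  proof (rule wp_mono, elim conjE, goal_cases)
    case (1 t1 s2)
    note t1 = \<open>t1 \<le> _\<close> and zero = \<open>\<forall>j<n. nats s2 aCount j = 0\<close> and a1 = \<open>agree {vI, aCount} {} s1 s2\<close>
    have st2: "static s2" using static_agree[OF st1 a1] by simp
    have d2: "data s2" and K2: "nats s2 vK 0 = K" using st2 by (auto simp: static_def)
    have T2: "nats s2 vT 0 = T" using agree_nats[OF a1, of vT] T by (simp add: s1_def nats_nset)
    have "wp z decode s2 (\<lambda>t s'. t \<le> 100 * (n + 1) * (T + 1) \<and> agree {vI, vV, vQ, aCount} {} s2 s' \<and>
       (\<forall>j<n. nats s' aCount j = count T j))"
      using wp_decode[OF d2 K2 K T2] zero by (simp add: count_def)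
    then show ?case
    proof (rule wp_mono, elim conjE, goal_cases)
      case (1 t2 s3)
      note t2 = \<open>t2 \<le> _\<close> and cnt = \<open>\<forall>j<n. nats s3 aCount j = count T j\<close> and a2 = \<open>agree {vI, vV, vQ, aCount} {} s2 s3\<close>
      have st3: "static s3" using static_agree[OF st2 a2] by simp
      have d3: "data s3" and c3: "nats s3 aCell = cell" using st3 by (auto simp: static_def)
      show ?case using wp_delete_clients[OF d3]
      proof (rule wp_mono, elim conjE exE, goal_cases)
        case (1 t3 s4 Y)
        note t3 = \<open>t3 \<le> _\<close> and a3 = \<open>agree {vI, aCount, aDel} {} s3 s4\<close> and Y = \<open>Y \<subseteq> X\<close>
          and del = \<open>\<forall>p<n. nats s4 aDel p = of_bool (p \<in> Y)\<close>
        have st4: "static s4" using static_agree[OF st3 a3] by simp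
        have d4: "data s4" and D4: "reals s4 rD 0 0 = D" using st4 by (auto simp: static_def)
        have r: "\<forall>j. card {p \<in> Y. cell p = j} \<le> nats s3 aCount j \<and>
            (nats s3 aCount j \<le> card {p \<in> X. cell p = j} \<longrightarrow> card {p \<in> Y. cell p = j} = nats s3 aCount j)"
          using 1 unfolding c3 by blast
        have cj: "nats s3 aCount j = count T j" if "j < K" for j using cnt that K by simp
        have le: "card {p \<in> Y. cell p = j} \<le> count T j" if "j < K" for j
          using spec[OF r, of j] cj[OF that] by simp
        have eq: "card {p \<in> Y. cell p = j} = count T j" if "j < K" "count T j \<le> card {p \<in> X. cell p = j}" for j
          using spec[OF r, of j] cj[OF that(1)] that(2) by simp
        have finY: "finite Y" using Y inst_facts(4) finite_subset by blast
        \<comment> \<open>Every digit is below \<open>K\<close>, so the counts sum to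
          \<open>m\<close> for every guess, also for an unsuitable one.\<close>
        have "card Y = (\<Sum>j<K. card {p \<in> Y. cell p = j})"
          using finY Y cell by (intro card_fibers) auto
        also have "\<dots> \<le> (\<Sum>j<K. count T j)" using le by (intro sum_mono) auto
        also have "\<dots> = (\<Sum>j<K. card {i \<in> {..<m}. T div K ^ i mod K = j})" by (simp add: count_def)
        also have "\<dots> = card {..<m}"
          using K by (intro card_fibers[symmetric]) auto
        finally have g: "guessed T Y" using Y eq by (simp add: guessed_def)
        have a4: "agree ?A {} s1 s4"
        proof -
          have "agree {vI, vV, vQ, aCount} {} s1 s3" by (rule agree_trans[OF a1 a2]) auto
          then show ?thesis by (rule agree_trans[OF _ a3]) auto
        qed
        have B4: "nats s4 vBase 0 = nats s vTop 0" using agree_nats[OF a4, of vBase] by (simp add: s1_def nats_nset)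
        have fr4: "nats s4 (a + 20) (nats s vTop 0 + q) = 0 \<and> reals s4 (a + 20) (nats s vTop 0 + q) j = 0" for a q j
        proof -
          have "agree {vI, vV, vQ, aCount, aDel} {} s1 s4"
          proof -
            have "agree {vI, vV, vQ, aCount} {} s1 s3" by (rule agree_trans[OF a1 a2]) auto
            then show ?thesis by (rule agree_trans[OF _ a3]) auto
          qed
          then have "nats s4 (a + 20) = nats s1 (a + 20)" "reals s4 (a + 20) = reals s1 (a + 20)"
            by (auto intro: agree_nats agree_reals)
          then show ?thesis using fr by (simp add: fresh_def s1_def nats_nset_other)
        qed
        have "wp z write_instance s4 (\<lambda>t s'. t \<le> 300 * (n + 1)\<^sup>2 \<and>
            agree {vI, vJ, vTop, 20, 21, 22} {20} s4 s' \<and> simulates s' (subinstance Y) s')"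
          by (rule wp_write_instance[OF d4 _ Y D4 B4 fr4]) (use del in blast)
        then show ?case
        proof (rule wp_mono, elim conjE, goal_cases)
          case (1 t4 s5)
          note a5 = \<open>agree {vI, vJ, vTop, 20, 21, 22} {20} s4 s5\<close>
          have "agree ?A {20} s1 s5" by (rule agree_trans[OF a4 a5]) auto
          moreover have "nats s5 aDel = nats s4 aDel" using agree_nats[OF a5] by simp
          moreover have "t1 + (t2 + (t3 + t4)) + 10 \<le> 700 * (n + 1)\<^sup>2 * (T + 1)"
          proof -
            define w x y where "w = (n + 1)\<^sup>2" and "x = w * (T + 1)" and "y = (n + 1) * (T + 1)"
            have nw: "n + 1 \<le> w" by (simp add: w_def power2_eq_square)
            have wx: "w \<le> x" by (simp add: x_def)
            have yx: "y \<le> x" unfolding x_def y_def using nw by (rule mult_le_mono1)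
            have nx: "n + 1 \<le> x" using nw wx by (rule order_trans)
            have "t1 \<le> 100 * x" by (rule order_trans[OF t1 mult_le_mono2[OF nx]])
            moreover have "t3 \<le> 100 * x" by (rule order_trans[OF t3 mult_le_mono2[OF nx]])
            moreover have "t2 \<le> 100 * x"
              using t2 mult_le_mono2[OF yx, of 100] unfolding y_def mult.assoc by (rule order_trans)
            moreover have "t4 \<le> 300 * x"
              using \<open>t4 \<le> _\<close> mult_le_mono2[OF wx, of 300] unfolding w_def by (rule order_trans)
            moreover have "10 \<le> 100 * x" using nx by simp
            ultimately have "t1 + (t2 + (t3 + t4)) + 10 \<le> 100 * x + (100 * x + (100 * x + 300 * x)) + 100 * x"
              by (intro add_mono)
            then have "t1 + (t2 + (t3 + t4)) + 10 \<le> 700 * x" by simp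
            then have "t1 + (t2 + (t3 + t4)) + 10 \<le> 700 * ((n + 1)\<^sup>2 * (T + 1))" by (simp only: x_def w_def)
            then show ?thesis by (simp only: mult.assoc)
          qed
          ultimately show ?case using g del \<open>simulates s5 (subinstance Y) s5\<close>
            by (intro conjI exI[of _ Y]) simp_all
        qed
      qed
    qed
  qed
  then have "wp z (Seq clear_counts (Seq decode (Seq delete_clients write_instance))) s1
    (\<lambda>t s'. t + 10 \<le> 700 * (n + 1)\<^sup>2 * (T + 1) \<and> static s' \<and> nats s' vT 0 = T \<and>
     reals s' rBest = reals s rBest \<and> nats s' 3 = nats s 3 \<and>
       (\<exists>Y. guessed T Y \<and> (\<forall>p<n. nats s' aDel p = of_bool (p \<in> Y)) \<and> simulates s' (subinstance Y) s'))"
  proof (rule wp_mono, elim conjE, goal_cases)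
    case (1 t s')
    note a = \<open>agree ?A {20} s1 s'\<close>
    have "static s'" using static_agree[OF st1 a] by simp
    moreover have "nats s' vT 0 = T" "nats s' 3 = nats s 3"
      using agree_nats[OF a, of vT] agree_nats[OF a, of 3] T by (simp_all add: s1_def nats_nset_other)
    moreover have "reals s' rBest = reals s rBest"
      using agree_reals[OF a, of rBest] by (simp add: s1_def)
    ultimately show ?case using 1 by blast
  qed
  then show ?thesis
    unfolding prepare_def wp_Seq[of _ "assign vBase (var vTop)"] wp_NSet nval.simps s1_def[symmetric]
    by (rule wp_mono) auto
qed

text \<open>The stored cost is only an upper bound on the outlier cost: it refers to the clients
  deleted by the guess, which need not be the most expensive ones.\<close>

definition best_valid :: "memory \<Rightarrow> bool" where
  "best_valid s \<longleftrightarrow> reals s rBest 0 0 < 0 \<or>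
     (returned n s \<in> feasible F k \<and> outlier_cost z d m X (returned n s) \<le> reals s rBest 0 0)"

text \<open>Kept apart from the invariant, because it is established only by the successful guess
  and preserved from then on.\<close>

definition best_within :: "real \<Rightarrow> memory \<Rightarrow> bool" where
  "best_within b s \<longleftrightarrow> 0 \<le> reals s rBest 0 0 \<and> reals s rBest 0 0 \<le> b"

definition invariant :: "memory \<Rightarrow> bool" where
  "invariant s \<longleftrightarrow> static s \<and> fresh s \<and> best_valid s"

text \<open>Applies to any content of the output array, hence also after a failed call; the last
  clause is what a successful one adds.\<close>

lemma wp_evaluate:
  assumes s: "static s" and fr: "fresh s" and best: "best_valid s"
    and Y: "Y \<subseteq> X" "card Y \<le> m" and del: "\<forall>p<n. nats s aDel p = of_bool (p \<in> Y)"
    and C': "C' = {i. i < n \<and> nats s 23 (nats s vBase 0 + i) \<noteq> 0}"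
  shows "wp z evaluate s (\<lambda>t s'. t \<le> 500 * (n + 1)\<^sup>2 \<and> nats s' vT 0 = nats s vT 0 \<and> invariant s' \<and>
     (\<forall>b. best_within b s \<longrightarrow> best_within b s') \<and>
     (\<forall>b. card (repair F f C') \<le> k \<and> cost z d (X - Y) (repair F f C') \<le> b \<longrightarrow> best_within b s'))"
proof -
  let ?C = "repair F f C'"
  have Csub: "?C \<subseteq> F" "?C \<noteq> {}" using repair_subset f by auto
  have d: "data s" and fv: "nats s vF 0 = f" using s by (auto simp: static_def)
  show ?thesis
    unfolding evaluate_def wp_Seq
    using wp_read_candidate[OF d fv f refl C']
  proof (rule wp_mono, elim conjE, goal_cases)
    case (1 t1 s1)
    note t1 = \<open>t1 \<le> _\<close> and a1 = \<open>agree {vI, vSize, aCand} {} s s1\<close>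
      and C1 = \<open>\<forall>i<n. nats s1 aCand i = of_bool (i \<in> ?C)\<close> and size1 = \<open>nats s1 vSize 0 = card ?C\<close>
    have st1: "static s1" using static_agree[OF s a1] by simp
    have d1: "data s1" and D1: "reals s1 rD 0 0 = D" using st1 by (auto simp: static_def)
    have del1: "\<And>p. p < n \<Longrightarrow> nats s1 aDel p = of_bool (p \<in> Y)" using agree_nats[OF a1, of aDel] del by simp
    have "wp z compute_cost s1 (\<lambda>t s'. t \<le> 200 * (n + 1)\<^sup>2 \<and> agree {vI, vJ} {rCost, rMin} s1 s' \<and>
        reals s' rCost 0 0 = cost z d (X - Y) ?C)"
      by (rule wp_compute_cost[where D=D]) (use d1 del1 D1 D_bound C1 Csub in auto)
    then show ?case
    proof (rule wp_mono, elim conjE, goal_cases)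
      case (1 t2 s2)
      note t2 = \<open>t2 \<le> _\<close> and a2 = \<open>agree {vI, vJ} {rCost, rMin} s1 s2\<close>
        and cost2 = \<open>reals s2 rCost 0 0 = cost z d (X - Y) ?C\<close>
      have st2: "static s2" using static_agree[OF st1 a2] by simp
      have d2: "data s2" using st2 by (auto simp: static_def)
      have C2: "\<And>i. i < n \<Longrightarrow> nats s2 aCand i = of_bool (i \<in> ?C)" and size2: "nats s2 vSize 0 = card ?C"
        using agree_nats[OF a2, of aCand] agree_nats[OF a2, of vSize] C1 size1 by auto
      have "wp z update_best s2 (\<lambda>t s'. t \<le> 100 * (n + 1) \<and> agree {vI, 3} {rBest} s2 s' \<and>
        (if card ?C \<le> k \<and> (reals s2 rBest 0 0 < 0 \<or> cost z d (X - Y) ?C < reals s2 rBest 0 0)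
         then reals s' rBest 0 0 = cost z d (X - Y) ?C \<and> returned n s' = ?C
         else reals s' rBest 0 0 = reals s2 rBest 0 0 \<and> returned n s' = returned n s2))"
        by (rule wp_update_best) (use d2 cost2 C2 Csub size2 in auto)
      then show ?case
      proof (rule wp_mono, elim conjE, goal_cases)
        case (1 t3 s3)
        note t3 = \<open>t3 \<le> _\<close> and a3 = \<open>agree {vI, 3} {rBest} s2 s3\<close>
        have a: "agree {vI, vJ, vSize, aCand, 3} {rCost, rMin, rBest} s s3"
        proof -
          have "agree {vI, vJ, vSize, aCand} {rCost, rMin} s s2" by (rule agree_trans[OF a1 a2]) auto
          then show ?thesis by (rule agree_trans[OF _ a3]) auto
        qed
        have st3: "static s3" using static_agree[OF s a] by simp
        have fr3: "fresh s3"
        proof -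
          have "nats s3 vTop = nats s vTop" "nats s3 (x + 20) = nats s (x + 20)"
            "reals s3 (x + 20) = reals s (x + 20)" for x
            using agree_nats[OF a] agree_reals[OF a] by auto
          then show ?thesis using fr by (simp add: fresh_def)
        qed
        have r2: "returned n s2 = returned n s" "reals s2 rBest = reals s rBest"
          using agree_nats[OF a1, of 3] agree_nats[OF a2, of 3] agree_reals[OF a1, of rBest] agree_reals[OF a2, of rBest]
          by (auto simp: returned_def)
        have upd: "if card ?C \<le> k \<and> (reals s rBest 0 0 < 0 \<or> cost z d (X - Y) ?C < reals s rBest 0 0)
         then reals s3 rBest 0 0 = cost z d (X - Y) ?C \<and> returned n s3 = ?C
         else reals s3 rBest 0 0 = reals s rBest 0 0 \<and> returned n s3 = returned n s"
          using 1 unfolding r2 by blast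
        have feas: "?C \<in> feasible F k" if "card ?C \<le> k" using that Csub by (simp add: feasible_def)
        have oc: "outlier_cost z d m X ?C \<le> cost z d (X - Y) ?C"
          using outlier_cost_le[OF inst_facts(4) Y] .
        have "best_valid s3"
          using upd best feas oc unfolding best_valid_def by (auto split: if_splits)
        moreover have "best_within b s3" if "best_within b s" for b
          using upd that unfolding best_within_def by (auto split: if_splits)
        moreover have "best_within b s3" if "card ?C \<le> k \<and> cost z d (X - Y) ?C \<le> b" for b
          using upd that unfolding best_within_def by (auto split: if_splits)
        moreover have "t1 + (t2 + t3) \<le> 500 * (n + 1)\<^sup>2"
        proof -
          define w where "w = (n + 1)\<^sup>2"
          have "n + 1 \<le> w" by (simp add: w_def power2_eq_square)
          then have "t1 + (t2 + t3) \<le> 500 * w" using t1 t2[folded w_def] t3 by presburger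
          then show ?thesis by (simp only: w_def)
        qed
        moreover have "nats s3 vT 0 = nats s vT 0" using agree_nats[OF a, of vT] by simp
        ultimately show ?case using st3 fr3 by (simp add: invariant_def)
      qed
    qed
  qed
qed

text \<open>A call changes only its own region and the mark, so everything the caller relies on
  survives.\<close>

lemma after_call:
  assumes s': "static s'" "best_valid s'" and del: "\<forall>p<n. nats s' aDel p = of_bool (p \<in> Y)"
    and sim: "simulates s' r s''"
  shows "static s''" "fresh s''" "best_valid s''" "\<forall>p<n. nats s'' aDel p = of_bool (p \<in> Y)"
    "nats s'' vT 0 = nats s' vT 0" "reals s'' rBest = reals s' rBest"
    "returned n r = {i. i < n \<and> nats s'' 23 (nats s'' vBase 0 + i) \<noteq> 0}"
proof -
  have eq: "\<And>a. a < 20 \<Longrightarrow> a \<noteq> 5 \<Longrightarrow> nats s'' a = nats s' a" "\<And>a. a < 20 \<Longrightarrow> reals s'' a = reals s' a"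
    "fresh s''" and "\<And>a i. nats s'' (a + 20) (nats s' vBase 0 + i) = nats r a i"
    using sim unfolding simulates_def by blast+
  from this(4)[of 3] have r3: "\<And>i. nats s'' 23 (nats s' vBase 0 + i) = nats r 3 i" by simp
  have "agree ({20..} \<union> {5}) {20..} s' s''" using eq(1,2) by (simp add: agree_def)
  then show "static s''" using static_agree[OF s'(1)] by simp
  show "fresh s''" by fact
  show "best_valid s''" using s'(2) eq(1)[of 3] eq(2)[of rBest] by (simp add: best_valid_def returned_def)
  show "\<forall>p<n. nats s'' aDel p = of_bool (p \<in> Y)" using eq(1)[of aDel] del by simp
  show "nats s'' vT 0 = nats s' vT 0" "reals s'' rBest = reals s' rBest" using eq by auto
  show "returned n r = {i. i < n \<and> nats s'' 23 (nats s'' vBase 0 + i) \<noteq> 0}"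
    using eq(1)[of vBase] r3 by (simp add: returned_def)
qed

lemma wp_body:
  assumes P: "\<And>Y. Y \<subseteq> X \<Longrightarrow> wp z P (subinstance Y) (\<lambda>t s'. t \<le> \<tau>)"
    and s: "invariant s" and T: "nats s vT 0 = T"
  shows "wp z (Seq prepare (Seq (sim P) evaluate)) s (\<lambda>t s'. t \<le> 1200 * (n + 1)\<^sup>2 * (T + 1) + 20 * \<tau> \<and>
     nats s' vT 0 = T \<and> invariant s' \<and> (\<forall>b. best_within b s \<longrightarrow> best_within b s'))"
proof -
  have s: "static s" "fresh s" "best_valid s" using s by (auto simp: invariant_def)
  show ?thesis
    unfolding wp_Seq
    using wp_prepare[OF s(1,2) T]
  proof (rule wp_mono, elim conjE exE, goal_cases)
    case (1 t1 s1 Y)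
    note t1 = \<open>t1 \<le> _\<close> and st1 = \<open>static s1\<close> and best1 = \<open>reals s1 rBest = reals s rBest\<close>
    have bv1: "best_valid s1" using s(3) 1 by (simp add: best_valid_def returned_def)
    have Y: "Y \<subseteq> X" "card Y \<le> m" using \<open>guessed T Y\<close> by (auto simp: guessed_def)
    note del1 = \<open>\<forall>p<n. nats s1 aDel p = of_bool (p \<in> Y)\<close>
    show ?case
      using sim_wp[OF \<open>simulates s1 (subinstance Y) s1\<close> P[OF Y(1)]]
    proof (rule wp_mono, elim conjE exE, goal_cases)
      case (1 t2 s2 u r)
      note a = after_call[OF st1 bv1 del1 \<open>simulates s1 r s2\<close>]
      show ?case
        using wp_evaluate[OF a(1-3) Y a(4) a(7)]
      proof (rule wp_mono, elim conjE, goal_cases)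
        case (1 t3 s3)
        have "(n + 1)\<^sup>2 \<le> (n + 1)\<^sup>2 * (T + 1)" by simp
        then have "t1 + (t2 + t3) \<le> 1200 * (n + 1)\<^sup>2 * (T + 1) + 20 * \<tau>"
          using t1 \<open>t3 \<le> _\<close> \<open>t2 \<le> 20 * u\<close> \<open>u \<le> \<tau>\<close> unfolding mult.assoc by linarith
        moreover have "best_within b s2 = best_within b s" for b
          using a(6) best1 by (simp add: best_within_def)
        ultimately show ?case using 1 a(5) \<open>nats s1 vT 0 = T\<close> by simp
      qed
    qed
  qed
qed

text \<open>The costs form a chain: repaired set, returned set in the modified instance,
  \<open>\<beta>\<close> times the optimum there, \<open>\<beta>\<close> times the optimum after
  deleting \<open>Y\<close>. All steps except the call are certain, so the probability remains
  \<open>p\<close>.\<close>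

lemma pr_body:
  assumes P: "\<And>Y. Y \<subseteq> X \<Longrightarrow> pr z P (subinstance Y) (\<lambda>s. returned n s \<in> feasible (F \<union> Y) k \<and>
      cost z (remote d D (Y - F)) (X - Y) (returned n s) \<le> \<beta> * opt z (remote d D (Y - F)) (X - Y) (F \<union> Y) k) \<ge> p"
    and p: "p \<ge> 0" and \<beta>: "\<beta> \<ge> 0"
    and s: "invariant s" and T: "nats s vT 0 = T"
    and b: "\<And>Y. guessed T Y \<Longrightarrow> \<beta> * opt z d (X - Y) F k \<le> b"
    and fin: "\<And>Y. Y \<subseteq> X \<Longrightarrow> wp z P (subinstance Y) (\<lambda>t s'. t \<le> \<tau>)"
  shows "pr z (Seq prepare (Seq (sim P) evaluate)) s
    (\<lambda>s'. nats s' vT 0 = T \<and> invariant s' \<and> best_within b s') \<ge> p"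
proof -
  have s: "static s" "fresh s" "best_valid s" using s by (auto simp: invariant_def)
  let ?G = "\<lambda>s'. nats s' vT 0 = T \<and> invariant s' \<and> best_within b s'"
  let ?G1 = "\<lambda>s1. static s1 \<and> nats s1 vT 0 = T \<and> best_valid s1 \<and>
    (\<exists>Y. guessed T Y \<and> (\<forall>p<n. nats s1 aDel p = of_bool (p \<in> Y)) \<and> simulates s1 (subinstance Y) s1)"
  have "1 * p \<le> pr z (Seq prepare (Seq (sim P) evaluate)) s ?G"
  proof (rule pr_Seq[where ?G1.0="?G1"])
    show "1 \<le> pr z prepare s ?G1"
    proof (rule pr_wp)
      show "wp z prepare s (\<lambda>t s'. ?G1 s')"
        using wp_prepare[OF s(1,2) T]
      proof (rule wp_mono, elim conjE, goal_cases)
        case (1 t s')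
        then show ?case using s(3) by (simp add: best_valid_def returned_def)
      qed
    qed
    show "p \<le> pr z (Seq (sim P) evaluate) s1 ?G" if s1: "?G1 s1" for s1
    proof -
      from s1 obtain Y where Y: "guessed T Y" "\<forall>p<n. nats s1 aDel p = of_bool (p \<in> Y)"
        "simulates s1 (subinstance Y) s1" by blast
      have YX: "Y \<subseteq> X" "card Y \<le> m" using Y(1) by (auto simp: guessed_def)
      let ?good = "\<lambda>s. returned n s \<in> feasible (F \<union> Y) k \<and>
        cost z (remote d D (Y - F)) (X - Y) (returned n s) \<le> \<beta> * opt z (remote d D (Y - F)) (X - Y) (F \<union> Y) k"
      have "pr z (sim P) s1 (\<lambda>s2. ?good (abstraction s2)) \<ge> p"
        by (rule sim_pr[OF Y(3) P[OF YX(1)]])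
      moreover have "wp z (sim P) s1 (\<lambda>t s2. simulates s1 (abstraction s2) s2)"
        using sim_wp[OF Y(3) fin[OF YX(1)]]
        by (rule wp_mono) (use simulates_abstraction in blast)
      ultimately have "pr z (sim P) s1 (\<lambda>s2. ?good (abstraction s2) \<and> simulates s1 (abstraction s2) s2) \<ge> p"
        by (rule pr_wp_conj)
      then have "p * 1 \<le> pr z (Seq (sim P) evaluate) s1 ?G"
      proof (rule pr_Seq)
        fix s2 assume s2: "?good (abstraction s2) \<and> simulates s1 (abstraction s2) s2"
        have "static s1" "best_valid s1" using s1 by auto
        note a = after_call[OF this Y(2) conjunct2[OF s2]]
        let ?C' = "returned n (abstraction s2)"
        have "d a b \<le> D" if "a \<in> X \<union> F" "b \<in> X \<union> F" for a b
          using D_bound[of a b] that inst_facts(9) by auto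
        note rep = repair_remote[OF inst_facts(10) YX(1) _ f this, of z "?C'"]
        have "cost z d (X - Y) (repair F f ?C') \<le> cost z (remote d D (Y - F)) (X - Y) ?C'"
          using rep(2) s2 z by simp
        also have "\<dots> \<le> \<beta> * opt z (remote d D (Y - F)) (X - Y) (F \<union> Y) k" using s2 by simp
        also have "\<dots> \<le> \<beta> * opt z d (X - Y) F k"
          using \<beta> inst_facts finite_subset[OF YX(1)] by (intro mult_left_mono remote_opt_le) auto
        also have "\<dots> \<le> b" using b[OF Y(1)] .
        finally have good: "card (repair F f ?C') \<le> k \<and> cost z d (X - Y) (repair F f ?C') \<le> b"
          using rep(1) s2 z by simp
        show "1 \<le> pr z evaluate s2 ?G"
        proof (rule pr_wp)
          show "wp z evaluate s2 (\<lambda>t s'. ?G s')"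
            using wp_evaluate[OF a(1-3) YX a(4) a(7)]
          proof (rule wp_mono, elim conjE, goal_cases)
            case (1 t s')
            then show ?case using good a(5) s1 by auto
          qed
        qed
      qed simp
      then show ?thesis by simp
    qed
  qed (use p in simp)
  then show ?thesis by simp
qed

end

section \<open>The whole program\<close>

context guessing
begin

abbreviation main_loop :: "com \<Rightarrow> com" where
  "main_loop P \<equiv> For vT (RLess (ROfNat (var vT)) (rvar rM)) (Seq prepare (Seq (sim P) evaluate))"

lemma invariant_nset [simp]:
  "invariant (nset vT 0 i s) = invariant s" "best_within b (nset vT 0 i s) = best_within b s"
proof -
  have "agree {vT} {} s (nset vT 0 i s)" "agree {vT} {} (nset vT 0 i s) s"
    by (simp_all add: agree_def nats_nset_other)
  then have "static (nset vT 0 i s) = static s" using static_agree by auto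
  then show "invariant (nset vT 0 i s) = invariant s"
    by (simp add: invariant_def fresh_def best_valid_def returned_def nats_nset_other)
qed (simp add: best_within_def)

lemma main_test: "invariant s \<Longrightarrow> bval z (RLess (ROfNat (var vT)) (rvar rM)) s \<longleftrightarrow> nats s vT 0 < K ^ m"
  by (simp add: invariant_def static_def flip: of_nat_power)

lemma wp_body_bounded:
  assumes P: "\<forall>Y\<subseteq>X. wp z P (subinstance Y) (\<lambda>t s'. t \<le> \<tau>)"
    and s: "invariant s" and T: "nats s vT 0 = T" "T < K ^ m"
  shows "wp z (Seq prepare (Seq (sim P) evaluate)) s (\<lambda>t s'. t \<le> 1200 * (n + 1)\<^sup>2 * K ^ m + 20 * \<tau> \<and>
     nats s' vT 0 = T \<and> invariant s' \<and> (\<forall>b. best_within b s \<longrightarrow> best_within b s'))"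
proof -
  have body: "wp z (Seq prepare (Seq (sim P) evaluate)) s (\<lambda>t s'. t \<le> 1200 * (n + 1)\<^sup>2 * (T + 1) + 20 * \<tau> \<and>
     nats s' vT 0 = T \<and> invariant s' \<and> (\<forall>b. best_within b s \<longrightarrow> best_within b s'))"
    by (rule wp_body[OF _ s T(1)]) (use P in blast)
  have "1200 * (n + 1)\<^sup>2 * (T + 1) \<le> 1200 * (n + 1)\<^sup>2 * K ^ m"
    using T(2) by (intro mult_le_mono2) simp
  then show ?thesis by (intro wp_mono[OF body]) auto
qed

lemma wp_main_loop:
  assumes P: "\<forall>Y\<subseteq>X. wp z P (subinstance Y) (\<lambda>t s'. t \<le> \<tau>)" and s: "invariant s"
  shows "wp z (main_loop P) s (\<lambda>t s'. t \<le> 30 + K ^ m * (1200 * (n + 1)\<^sup>2 * K ^ m + 20 * \<tau> + 30))"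
proof (rule wp_For[where I="\<lambda>i. invariant" and N="K ^ m" and B="1200 * (n + 1)\<^sup>2 * K ^ m + 20 * \<tau>"], goal_cases)
  case 1
  then show ?case using s by simp
next
  case (2 i s)
  then show ?case using main_test[of s] by simp
next
  case (3 i s)
  show ?case using wp_body_bounded[OF P 3] by (rule wp_mono) auto
next
  case (4 t s)
  have "btime (RLess (ROfNat (var vT)) (rvar rM)) = 7" by simp
  note 4(1)[unfolded this]
  moreover have "K ^ m * (1200 * (n + 1)\<^sup>2 * K ^ m + 20 * \<tau> + 7 + 7) \<le> K ^ m * (1200 * (n + 1)\<^sup>2 * K ^ m + 20 * \<tau> + 30)"
    by (rule mult_le_mono2) simp
  ultimately show ?case by linarith
qed

text \<open>Before round \<open>T\<close> only the invariant is maintained, in round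
  \<open>T\<close> the call succeeds with probability at least \<open>p\<close>, and afterwards the
  bound persists with certainty.\<close>

lemma pr_main_loop:
  assumes P: "\<And>Y. Y \<subseteq> X \<Longrightarrow> pr z P (subinstance Y) (\<lambda>s. returned n s \<in> feasible (F \<union> Y) k \<and>
      cost z (remote d D (Y - F)) (X - Y) (returned n s) \<le> \<beta> * opt z (remote d D (Y - F)) (X - Y) (F \<union> Y) k) \<ge> p"
    and p: "p \<ge> 0" and \<beta>: "\<beta> \<ge> 0"
    and fin: "\<forall>Y\<subseteq>X. wp z P (subinstance Y) (\<lambda>t s'. t \<le> \<tau>)"
    and s: "invariant s" and T: "T < K ^ m"
    and b: "\<And>Y. guessed T Y \<Longrightarrow> \<beta> * opt z d (X - Y) F k \<le> b"
  shows "pr z (main_loop P) s (\<lambda>s'. invariant s' \<and> best_within b s') \<ge> p"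
proof -
  let ?c = "Seq prepare (Seq (sim P) evaluate)" and ?b = "RLess (ROfNat (var vT)) (rvar rM)"
  let ?incr = "NSet vT (NLit 0) (NAdd (NGet vT (NLit 0)) (NLit 1))"
  let ?w = "While ?b (Seq ?c ?incr)"
  let ?G = "\<lambda>s'. invariant s' \<and> best_within b s'"
  have keep: "pr z ?w s ?G \<ge> 1" if "invariant s" "best_within b s" "nats s vT 0 \<le> K ^ m" for s
  proof (rule pr_wp)
    have "wp z ?w s (\<lambda>t s'. t \<le> 1 + btime ?b + (K ^ m - nats s vT 0) *
        ((1200 * (n + 1)\<^sup>2 * K ^ m + 20 * \<tau>) + btime ?b + 7) \<and> ?G s' \<and> nats s' vT 0 = K ^ m)"
    proof (rule wp_counting_loop[where I="\<lambda>i. ?G"], goal_cases)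
      case (1 i s)
      then show ?case using main_test[of s] by simp
    next
      case (2 i s)
      then show ?case using wp_body_bounded[OF fin, of s i] by (auto elim!: wp_mono)
    qed (use that in auto)
    then show "wp z ?w s (\<lambda>t s'. ?G s')" by (rule wp_mono) simp
  qed
  \<comment> \<open>Downward induction on the counter, from the target round back to the
    start.\<close>
  have loop: "pr z ?w s ?G \<ge> p" if "i \<le> T" "invariant s" "nats s vT 0 = i" for i s
    using that
  proof (induction i arbitrary: s rule: inc_induct)
    case base
    have "p * 1 * 1 \<le> pr z (Seq (Seq ?c ?incr) ?w) s ?G"
    proof (rule pr_Seq)
      show "p * 1 \<le> pr z (Seq ?c ?incr) s (\<lambda>s'. nats s' vT 0 = Suc T \<and> ?G s')"
      proof (rule pr_Seq)
        show "p \<le> pr z ?c s (\<lambda>s'. nats s' vT 0 = T \<and> invariant s' \<and> best_within b s')"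
          by (rule pr_body[where P=P and \<beta>=\<beta> and \<tau>=\<tau>]) (use P p \<beta> base b fin in auto)
        show "1 \<le> pr z ?incr s' (\<lambda>s'. nats s' vT 0 = Suc T \<and> ?G s')"
          if "nats s' vT 0 = T \<and> invariant s' \<and> best_within b s'" for s'
          using that by (intro pr_wp) (simp add: nats_nset)
      qed simp
      show "1 \<le> pr z ?w s' ?G" if "nats s' vT 0 = Suc T \<and> ?G s'" for s'
        using that T by (intro keep) auto
    qed simp
    moreover have "bval z ?b s" using main_test[of s] base T by simp
    ultimately show ?case using pr_While[of z ?b s "Seq ?c ?incr" ?G] by simp
  next
    case (step i)
    have "1 * p \<le> pr z (Seq (Seq ?c ?incr) ?w) s ?G"
    proof (rule pr_Seq)
      show "1 \<le> pr z (Seq ?c ?incr) s (\<lambda>s'. nats s' vT 0 = Suc i \<and> invariant s')"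
      proof (rule pr_wp)
        have "i < K ^ m" using step T by simp
        with wp_body_bounded[OF fin, of s i] step
        show "wp z (Seq ?c ?incr) s (\<lambda>t s'. nats s' vT 0 = Suc i \<and> invariant s')"
          unfolding wp_Seq[of _ ?c] by (auto elim!: wp_mono simp: nats_nset simp del: wp_Seq)
      qed
      show "p \<le> pr z ?w s' ?G" if "nats s' vT 0 = Suc i \<and> invariant s'" for s'
        using that step.IH by simp
    qed (rule p)
    moreover have "bval z ?b s" using main_test[of s] step T by simp
    ultimately show ?case using pr_While[of z ?b s "Seq ?c ?incr" ?G] by simp
  qed
  have "1 * p \<le> pr z (main_loop P) s ?G"
    unfolding For_def
  proof (rule pr_Seq)
    show "1 \<le> pr z (NSet vT (NLit 0) (NLit 0)) s (\<lambda>s'. nats s' vT 0 = 0 \<and> invariant s')"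
      using s by (intro pr_wp) (simp add: nats_nset)
    show "p \<le> pr z ?w s' ?G" if "nats s' vT 0 = 0 \<and> invariant s'" for s'
      using that loop[of 0 s'] by simp
  qed (rule p)
  then show ?thesis by simp
qed

text \<open>Enumerating \<open>Y\<close> and recording the cell of each element gives the digits. No
  count exceeds its cell, as \<open>Y\<close> itself realizes all of them, so \<open>guessed\<close>
  yields equality.\<close>

lemma target_exists:
  assumes Y: "Y \<subseteq> X" "card Y = m"
  obtains T where "T < K ^ m"
    "\<And>Y'. guessed T Y' \<Longrightarrow> Y' \<subseteq> X \<and> (\<forall>j. card {p \<in> Y. cell p = j} = card {p \<in> Y'. cell p = j})"
proof -
  have finY: "finite Y" using Y(1) inst_facts(4) finite_subset by blast
  then obtain h where h: "bij_betw h {..<m} Y" using Y(2) ex_bij_betw_nat_finite atLeast0LessThan by metis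
  have "cell (h i) < K" if "i < m" for i using bij_betwE[OF h] that Y(1) cell by blast
  then obtain T where T: "T < K ^ m" "\<And>i. i < m \<Longrightarrow> T div K ^ i mod K = cell (h i)"
    using digits_exist[of m "\<lambda>i. cell (h i)" K] by blast
  have cnt: "count T j = card {p \<in> Y. cell p = j}" for j
  proof -
    have "bij_betw h {i. i < m \<and> T div K ^ i mod K = j} {p \<in> Y. cell p = j}"
      using h T(2) unfolding bij_betw_def inj_on_def by (auto simp: image_iff)
    then show ?thesis unfolding count_def by (rule bij_betw_same_card)
  qed
  show thesis
  proof (rule that[OF T(1)], intro conjI allI)
    fix Y' j assume g: "guessed T Y'"
    then show Y': "Y' \<subseteq> X" by (simp add: guessed_def)
    show "card {p \<in> Y. cell p = j} = card {p \<in> Y'. cell p = j}"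
    proof (cases "j < K")
      case True
      have "card {p \<in> Y. cell p = j} \<le> card {p \<in> X. cell p = j}"
        using Y(1) inst_facts(4) by (intro card_mono) auto
      then show ?thesis using g True cnt by (simp add: guessed_def)
    next
      case False
      then have "{p \<in> Y. cell p = j} = {}" "{p \<in> Y'. cell p = j} = {}" using Y(1) Y' cell by auto
      then show ?thesis by (simp only:)
    qed
  qed
qed

end

section \<open>Preprocessing and the complete program\<close>

context outlier_problem
begin

lemma data_encode: "data (encode d X F k m)"
  using X_less F_less inst_facts(9) unfolding data_def encode_def n[symmetric] by auto

lemma wp_preprocess:
  assumes s: "data s" and N: "N = min n (k + m + L * m)"
  shows "wp z (preprocess L) s (\<lambda>t s'. t \<le> 2000 * (n + 1)\<^sup>2 \<and>
    agree {vI, vJ, vF, vP, vK, aCell} {rD, rDist, rM, rBest} s s' \<and>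
    1 \<le> reals s' rD 0 0 \<and> (\<forall>i<n. \<forall>j<n. d i j < reals s' rD 0 0) \<and> nats s' vF 0 \<in> F \<and> nats s' vK 0 = N \<and>
    centers (reals s' rD 0 0) N (\<lambda>i. reals s' rDist i 0) (nats s' aCell) \<and>
    reals s' rM 0 0 = real N ^ m \<and> reals s' rBest 0 0 = -1)"
  unfolding preprocess_def wp_Seq
  using wp_compute_bound[OF s]
proof (rule wp_mono, elim conjE, goal_cases)
  case (1 t1 s1)
  note t1 = \<open>t1 \<le> _\<close> and a1 = \<open>agree {vI, vJ} {rD} s s1\<close> and D = \<open>1 \<le> reals s1 rD 0 0\<close>
    \<open>\<forall>i<n. \<forall>j<n. d i j < reals s1 rD 0 0\<close>
  have d1: "data s1" using data_agree[OF s a1] by simp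
  show ?case using wp_find_facility[OF d1]
  proof (rule wp_mono, elim conjE, goal_cases)
    case (1 t2 s2)
    note t2 = \<open>t2 \<le> _\<close> and a2 = \<open>agree {vI, vF} {} s1 s2\<close> and f = \<open>nats s2 vF 0 \<in> F\<close>
    have d2: "data s2" using data_agree[OF d1 a2] by simp
    have D2: "reals s2 rD 0 0 = reals s1 rD 0 0" using agree_reals[OF a2, of rD] by simp
    have "wp z (farthest_first L) s2 (\<lambda>t s'. t \<le> 1000 * (n + 1)\<^sup>2 \<and>
      agree {vI, vJ, vP, vK, aCell} {rDist} s2 s' \<and> nats s' vK 0 = N \<and>
      centers (reals s1 rD 0 0) N (\<lambda>i. reals s' rDist i 0) (nats s' aCell))"
      by (rule wp_farthest_first[OF d2 D2]) (use D N in auto)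
    then show ?case
    proof (rule wp_mono, elim conjE, goal_cases)
      case (1 t3 s3)
      note t3 = \<open>t3 \<le> _\<close> and a3 = \<open>agree {vI, vJ, vP, vK, aCell} {rDist} s2 s3\<close> and K3 = \<open>nats s3 vK 0 = N\<close>
        and cen = \<open>centers (reals s1 rD 0 0) N _ _\<close>
      have d3: "data s3" using data_agree[OF d2 a3] by simp
      show ?case using wp_compute_power[OF d3]
      proof (rule wp_mono, elim conjE, goal_cases)
        case (1 t4 s4)
        note a4 = \<open>agree {vI} {rM} s3 s4\<close>
        define s5 where "s5 = rset rBest 0 0 (-1) s4"
        have a: "agree {vI, vJ, vF, vP, vK, aCell} {rD, rDist, rM, rBest} s s5"
        proof -
          have "agree {vI, vJ, vF} {rD} s s2" by (rule agree_trans[OF a1 a2]) auto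
          then have "agree {vI, vJ, vF, vP, vK, aCell} {rD, rDist} s s3" by (rule agree_trans[OF _ a3]) auto
          then have "agree {vI, vJ, vF, vP, vK, aCell} {rD, rDist, rM, rBest} s s4" by (rule agree_trans[OF _ a4]) auto
          then show ?thesis by (simp add: s5_def)
        qed
        have "reals s5 rD = reals s1 rD" "reals s5 rDist = reals s3 rDist"
          using agree_reals[OF a2, of rD] agree_reals[OF a3, of rD] agree_reals[OF a4, of rD] agree_reals[OF a4, of rDist]
          by (auto simp: s5_def fun_eq_iff reals_rset)
        moreover have "nats s5 vF = nats s2 vF" "nats s5 vK = nats s3 vK" "nats s5 aCell = nats s3 aCell"
          using agree_nats[OF a3, of vF] agree_nats[OF a4, of vF] agree_nats[OF a4, of vK] agree_nats[OF a4, of aCell]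
          by (auto simp: s5_def)
        moreover have "reals s5 rM 0 0 = real N ^ m" "reals s5 rBest 0 0 = -1"
          using 1 K3 by (auto simp: s5_def reals_rset)
        moreover have "t1 + (t2 + (t3 + (t4 + 10))) \<le> 2000 * (n + 1)\<^sup>2"
        proof -
          define w where "w = (n + 1)\<^sup>2"
          have nw: "n + 1 \<le> w" by (simp add: w_def power2_eq_square)
          have "t2 \<le> 100 * w" by (rule order_trans[OF t2 mult_le_mono2[OF nw]])
          moreover have "t4 \<le> 100 * w" by (rule order_trans[OF \<open>t4 \<le> _\<close> mult_le_mono2[OF nw]])
          moreover have "10 \<le> 100 * w" using nw by simp
          ultimately have "t1 + (t2 + (t3 + (t4 + 10))) \<le> 100 * w + (100 * w + (1000 * w + (100 * w + 100 * w)))"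
            using t1 t3 unfolding w_def by (intro add_mono)
          then show ?thesis unfolding w_def by simp
        qed
        ultimately show ?case using a D f K3 cen by (simp add: s5_def[symmetric])
      qed
    qed
  qed
qed

text \<open>The same \<open>p\<close> occurs in assumption and conclusion: every call has size
  \<open>n\<close>, on which the required success probability depends, and only one call has to
  succeed.\<close>

lemma program_correct:
  assumes \<beta>: "\<beta> \<ge> 1" and \<epsilon>: "0 < \<epsilon>" "\<epsilon> \<le> 1" and p: "0 \<le> p" "p \<le> 1" and \<tau>: "\<tau> \<ge> 1"
    and L: "L = extra_centers z \<beta> \<epsilon>"
    and fin: "\<And>\<Gamma>' d' X' F'. clustering_instance \<Gamma>' d' X' F' k \<Longrightarrow> card (X' \<union> F') = n \<Longrightarrow>
      wp z P (encode d' X' F' k 0) (\<lambda>t s'. t \<le> \<tau>)"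
    and good: "\<And>\<Gamma>' d' X' F'. clustering_instance \<Gamma>' d' X' F' k \<Longrightarrow> card (X' \<union> F') = n \<Longrightarrow>
      pr z P (encode d' X' F' k 0) (\<lambda>s. returned n s \<in> feasible F' k \<and> cost z d' X' (returned n s) \<le> \<beta> * opt z d' X' F' k) \<ge> p"
  shows "wp z (outlier_program L P) (encode d X F k m)
      (\<lambda>t s'. t \<le> 4000 * (n + 1)\<^sup>2 * ((k + m + L * m) ^ m)\<^sup>2 * \<tau>)" (is ?time)
    and "pr z (outlier_program L P) (encode d X F k m) (\<lambda>s. returned n s \<in> feasible F k \<and>
      outlier_cost z d m X (returned n s) \<le> (\<beta> + \<epsilon>) * outlier_opt z d X F k m) \<ge> p" (is ?success)
proof -
  define N where "N = min n (k + m + L * m)"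
  let ?s = "encode d X F k m"
  let ?b = "(\<beta> + \<epsilon>) * outlier_opt z d X F k m"
  let ?main = "For vT (RLess (ROfNat (var vT)) (rvar rM)) (Seq prepare (Seq (sim P) evaluate))"
  let ?good = "\<lambda>s. returned n s \<in> feasible F k \<and> outlier_cost z d m X (returned n s) \<le> ?b"
  \<comment> \<open>Both results on the loop are packed into one postcondition, because
    \<open>guessing\<close> can be interpreted only for a given final memory of the
    preprocessing.\<close>
  define post where "post s' \<longleftrightarrow>
    wp z ?main s' (\<lambda>t s''. t \<le> 30 + N ^ m * (1200 * (n + 1)\<^sup>2 * N ^ m + 20 * \<tau> + 30)) \<and> p \<le> pr z ?main s' ?good" for s'
  have pre: "wp z (preprocess L) ?s (\<lambda>t s'. t \<le> 2000 * (n + 1)\<^sup>2 \<and> post s')"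
    using wp_preprocess[OF data_encode N_def]
  proof (rule wp_mono, elim conjE, goal_cases)
    case (1 t s1)
    note a = \<open>agree _ _ ?s s1\<close> and cen = \<open>centers _ _ _ _\<close>
    have N1: "1 \<le> N" "N \<le> n" using n_pos inst_facts(7) by (auto simp: N_def)
    interpret guessing z \<Gamma> d X F k m n "reals s1 rD 0 0" "nats s1 vF 0" N "nats s1 aCell"
      by unfold_locales (use 1 N1 centers_cell_less[OF cen] in auto)
    have "static s1" unfolding static_def using 1 data_agree[OF data_encode a] by simp
    moreover have "fresh s1"
    proof -
      have "nats s1 (x + 20) = nats ?s (x + 20)" "reals s1 (x + 20) = reals ?s (x + 20)" for x
        using agree_nats[OF a, of "x + 20"] agree_reals[OF a, of "x + 20"] by auto
      then show ?thesis by (simp add: fresh_def encode_def)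
    qed
    moreover have "best_valid s1" unfolding best_valid_def using 1 by simp
    ultimately have inv: "invariant s1" unfolding invariant_def by blast
    have finY: "wp z P (subinstance Y) (\<lambda>t s'. t \<le> \<tau>)" if "Y \<subseteq> X" for Y
      using fin[OF subinstance_valid[OF that]] .
    have goodY: "pr z P (subinstance Y) (\<lambda>s. returned n s \<in> feasible (F \<union> Y) k \<and>
      cost z (remote d (reals s1 rD 0 0) (Y - F)) (X - Y) (returned n s)
        \<le> \<beta> * opt z (remote d (reals s1 rD 0 0) (Y - F)) (X - Y) (F \<union> Y) k) \<ge> p" if "Y \<subseteq> X" for Y
      using good[OF subinstance_valid[OF that]] .
    obtain r where r: "r \<ge> 0"
      "\<And>p q. p \<in> X \<Longrightarrow> q \<in> X \<Longrightarrow> nats s1 aCell p = nats s1 aCell q \<Longrightarrow> d p q \<le> 2 * r"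
      "r = 0 \<or> (\<exists>U\<subseteq>X. k + m + L * m \<le> card U \<and> (\<forall>u\<in>U. \<forall>v\<in>U. u \<noteq> v \<longrightarrow> r \<le> d u v))"
      by (rule centers_final[OF cen N_def], rule that)
    have "\<exists>Y\<subseteq>X. card Y = m \<and> (\<forall>Y'\<subseteq>X.
        (\<forall>j. card {p \<in> Y. nats s1 aCell p = j} = card {p \<in> Y'. nats s1 aCell p = j}) \<longrightarrow>
         \<beta> * opt z d (X - Y') F k \<le> ?b)"
      by (rule good_guess[OF inst z \<beta> \<epsilon> _ r(1) r(3)[unfolded L]]) (rule r(2))
    then obtain Y where Y: "Y \<subseteq> X" "card Y = m"
      and opt: "\<forall>Y'\<subseteq>X. (\<forall>j. card {p \<in> Y. nats s1 aCell p = j} = card {p \<in> Y'. nats s1 aCell p = j}) \<longrightarrow>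
         \<beta> * opt z d (X - Y') F k \<le> ?b"
      by (elim exE conjE)
    obtain T where T: "T < N ^ m" "\<And>Y'. guessed T Y' \<Longrightarrow> Y' \<subseteq> X \<and>
        (\<forall>j. card {p \<in> Y. nats s1 aCell p = j} = card {p \<in> Y'. nats s1 aCell p = j})"
      by (rule target_exists[OF Y(1,2)], rule that)
    have "p \<le> pr z ?main s1 (\<lambda>s'. invariant s' \<and> best_within ?b s')"
    proof (rule pr_main_loop[where T=T and \<beta>=\<beta> and \<tau>=\<tau>])
      show "\<beta> * opt z d (X - Y') F k \<le> ?b" if "guessed T Y'" for Y' using T(2)[OF that] opt by blast
    qed (use goodY finY p(1) \<beta> inv T(1) in simp_all)
    then have "p \<le> pr z ?main s1 ?good"
    proof (rule pr_mono)
      fix s' assume "invariant s' \<and> best_within ?b s'"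
      then show "?good s'" unfolding invariant_def best_within_def best_valid_def by auto
    qed
    moreover have "wp z ?main s1 (\<lambda>t s''. t \<le> 30 + N ^ m * (1200 * (n + 1)\<^sup>2 * N ^ m + 20 * \<tau> + 30))"
      by (rule wp_main_loop[OF _ inv]) (use finY in blast)
    ultimately show ?case using 1 unfolding post_def by blast
  qed
  show ?success
  proof -
    have "1 * p \<le> pr z (outlier_program L P) ?s ?good"
      unfolding outlier_program_def
    proof (rule pr_Seq)
      show "1 \<le> pr z (preprocess L) ?s post" by (rule pr_wp, rule wp_mono[OF pre]) simp
    qed (use p in \<open>simp_all add: post_def\<close>)
    then show ?thesis by simp
  qed
  show ?time
    unfolding outlier_program_def wp_Seq
    using pre
  proof (rule wp_mono, elim conjE, goal_cases)
    case (1 t1 s1)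
    have "wp z ?main s1 (\<lambda>t s''. t \<le> 30 + N ^ m * (1200 * (n + 1)\<^sup>2 * N ^ m + 20 * \<tau> + 30))"
      using 1 by (simp add: post_def)
    then show ?case
    proof (rule wp_mono, goal_cases)
      case (1 t2 s2)
      define w M where "w = (n + 1)\<^sup>2" and "M = (k + m + L * m) ^ m"
      have NM: "N ^ m \<le> M" unfolding M_def N_def by (intro power_mono) auto
      have pos: "1 \<le> w" "1 \<le> M" using inst_facts(7) by (auto simp: w_def M_def)
      have le: "a * b * c * e \<le> w * M\<^sup>2 * \<tau>" if "a \<le> M" "b \<le> M" "c \<le> w" "e \<le> \<tau>" for a b c e
      proof -
        have "a * b * c * e \<le> M * M * w * \<tau>" using that by (intro mult_le_mono)
        then show ?thesis by (simp add: power2_eq_square mult.commute mult.left_commute)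
      qed
      have q: "1 \<le> w * M\<^sup>2 * \<tau>" "w \<le> w * M\<^sup>2 * \<tau>" "M * M * w \<le> w * M\<^sup>2 * \<tau>" "M * \<tau> \<le> w * M\<^sup>2 * \<tau>" "M \<le> w * M\<^sup>2 * \<tau>"
        using le[of 1 1 1 1] le[of 1 1 w 1] le[of M M w 1] le[of M 1 1 \<tau>] le[of M 1 1 1] pos \<tau> by simp_all
      have "N ^ m * (1200 * (n + 1)\<^sup>2 * N ^ m + 20 * \<tau> + 30) \<le> M * (1200 * w * M + 20 * \<tau> + 30)"
        unfolding w_def using NM by (intro mult_le_mono add_mono le_refl)
      then have "t2 \<le> 30 + M * (1200 * w * M + 20 * \<tau> + 30)"
        using 1 by (meson add_left_mono order_trans)
      also have "\<dots> = 30 + 1200 * (M * M * w) + 20 * (M * \<tau>) + 30 * M" by (simp add: algebra_simps)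
      finally have "t1 + t2 \<le> 2000 * w + (30 * 1 + 1200 * (M * M * w) + 20 * (M * \<tau>) + 30 * M)"
        using \<open>t1 \<le> _\<close> unfolding w_def by simp
      also have "\<dots> \<le> 2000 * (w * M\<^sup>2 * \<tau>) + (30 * (w * M\<^sup>2 * \<tau>) + 1200 * (w * M\<^sup>2 * \<tau>) + 20 * (w * M\<^sup>2 * \<tau>) + 30 * (w * M\<^sup>2 * \<tau>))"
        by (intro add_mono mult_le_mono2 q)
      also have "\<dots> \<le> 4000 * (w * M\<^sup>2 * \<tau>)" by simp
      finally show ?case by (simp only: w_def M_def mult.assoc)
    qed
  qed
qed

end

section \<open>Running time\<close>

text \<open>The part of \<open>1 + extra_centers\<close> that does not depend on
  \<open>\<epsilon>\<close>; the summand 2 pays for the 1 and for rounding up.\<close>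

definition center_factor :: "real \<Rightarrow> real \<Rightarrow> nat" where
  "center_factor z \<beta> = nat \<lceil>2 + (1 + 4 * \<beta> * z) powr z * 4 powr z * (2 * \<beta>)\<rceil>"

text \<open>As \<open>1 / slack\<close> is proportional to \<open>1 / \<epsilon>\<close>, its power
  contributes the exponent \<open>z\<close>, rounded up, and \<open>2 * \<beta> / \<epsilon>\<close>
  contributes one more.\<close>

lemma extra_centers_bound:
  assumes "z \<ge> 1" "\<beta> \<ge> 1" "0 < \<epsilon>" "\<epsilon> \<le> 1"
  shows "1 + real (extra_centers z \<beta> \<epsilon>) \<le> real (center_factor z \<beta>) * (1 / \<epsilon>) ^ (nat \<lceil>z\<rceil> + 1)"
proof -
  let ?q = "nat \<lceil>z\<rceil>" and ?Q = "(1 + 4 * \<beta> * z) powr z * 4 powr z * (2 * \<beta>)"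
  have inv: "1 / \<epsilon> \<ge> 1" using assms by simp
  have Q0: "?Q \<ge> 0" using assms by simp
  have "1 + 1 / slack z \<beta> \<epsilon> = 1 + 4 * \<beta> * z / \<epsilon>" by (simp add: slack_def)
  also have "\<dots> \<le> (1 + 4 * \<beta> * z) * (1 / \<epsilon>)" using inv by (simp add: add_divide_distrib)
  finally have "(1 + 1 / slack z \<beta> \<epsilon>) powr z \<le> ((1 + 4 * \<beta> * z) * (1 / \<epsilon>)) powr z"
    using assms by (intro powr_mono2) (auto simp: slack_def)
  also have "\<dots> = (1 + 4 * \<beta> * z) powr z * (1 / \<epsilon>) powr z" using assms by (simp only: powr_mult)
  also have "(1 / \<epsilon>) powr z \<le> (1 / \<epsilon>) powr real ?q" using inv by (intro powr_mono) linarith+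
  also have "(1 / \<epsilon>) powr real ?q = (1 / \<epsilon>) ^ ?q" using assms by (intro powr_realpow) simp
  finally have "(1 + 1 / slack z \<beta> \<epsilon>) powr z \<le> (1 + 4 * \<beta> * z) powr z * (1 / \<epsilon>) ^ ?q"
    by (simp add: mult_left_mono)
  then have "(1 + 1 / slack z \<beta> \<epsilon>) powr z * (4 powr z * (2 * \<beta> / \<epsilon>))
      \<le> (1 + 4 * \<beta> * z) powr z * (1 / \<epsilon>) ^ ?q * (4 powr z * (2 * \<beta> / \<epsilon>))"
    using assms by (intro mult_right_mono) auto
  also have "\<dots> = ?Q * (1 / \<epsilon>) ^ (?q + 1)" by simp
  finally have *: "(1 + 1 / slack z \<beta> \<epsilon>) powr z * 4 powr z * (2 * \<beta> / \<epsilon>) \<le> ?Q * (1 / \<epsilon>) ^ (?q + 1)"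
    by (simp only: mult.assoc)
  have pow: "(1 / \<epsilon>) ^ (?q + 1) \<ge> 1" using inv by (rule one_le_power)
  have "0 \<le> (1 + 1 / slack z \<beta> \<epsilon>) powr z * 4 powr z * (2 * \<beta> / \<epsilon>)" using assms by simp
  then have "real (extra_centers z \<beta> \<epsilon>) \<le> (1 + 1 / slack z \<beta> \<epsilon>) powr z * 4 powr z * (2 * \<beta> / \<epsilon>) + 1"
    unfolding extra_centers_def by linarith
  with * have "1 + real (extra_centers z \<beta> \<epsilon>) \<le> 2 + ?Q * (1 / \<epsilon>) ^ (?q + 1)" by linarith
  also have "\<dots> \<le> 2 * (1 / \<epsilon>) ^ (?q + 1) + ?Q * (1 / \<epsilon>) ^ (?q + 1)" using pow by linarith
  also have "\<dots> = (2 + ?Q) * (1 / \<epsilon>) ^ (?q + 1)" by (simp only: distrib_right)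
  also have "\<dots> \<le> real (center_factor z \<beta>) * (1 / \<epsilon>) ^ (?q + 1)"
    unfolding center_factor_def using pow Q0 by (intro mult_right_mono) linarith+
  finally show ?thesis .
qed

text \<open>The constant factor is moved into the exponent: for \<open>m > 0\<close> the base is at
  least 2, and a natural \<open>A\<close> is at most \<open>2 ^ A\<close>. For \<open>m = 0\<close>
  both sides are 1.\<close>

lemma center_count_bound:
  fixes k m :: nat
  assumes par: "z \<ge> 1" "\<beta> \<ge> 1" "0 < \<epsilon>" "\<epsilon> \<le> 1" and k: "k \<ge> 1"
  shows "real ((k + m + extra_centers z \<beta> \<epsilon> * m) ^ m)
    \<le> (real (k + m) / \<epsilon>) ^ ((center_factor z \<beta> + nat \<lceil>z\<rceil> + 2) * m)"
proof (cases "m = 0")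
  case False
  let ?x = "real (k + m) / \<epsilon>" and ?A = "center_factor z \<beta>" and ?q = "nat \<lceil>z\<rceil> + 1" and ?L = "extra_centers z \<beta> \<epsilon>"
  have "real (k + m) \<ge> 2" using k False by linarith
  moreover have "real (k + m) * \<epsilon> \<le> real (k + m)" using par by (intro mult_left_le) auto
  ultimately have x: "?x \<ge> 2" "?x \<ge> real (k + m)" "?x \<ge> 1 / \<epsilon>"
    using par by (auto simp: field_simps intro: order_trans)
  have "real ?A \<le> 2 ^ ?A" by (rule of_nat_less_two_power[THEN less_imp_le])
  also have "\<dots> \<le> ?x ^ ?A" using x(1) by (intro power_mono) auto
  finally have A: "real ?A \<le> ?x ^ ?A" .
  have "real (k + m + ?L * m) \<le> real (k + m) * (1 + real ?L)"
    by (simp add: algebra_simps)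
  also have "\<dots> \<le> ?x * (real ?A * (1 / \<epsilon>) ^ ?q)"
    using extra_centers_bound[OF par] x by (intro mult_mono) auto
  also have "\<dots> \<le> ?x * (?x ^ ?A * ?x ^ ?q)"
    using A x par by (intro mult_left_mono mult_mono power_mono) auto
  also have "\<dots> = ?x ^ (?A + nat \<lceil>z\<rceil> + 2)" by (simp flip: power_add power_Suc)
  finally have "real (k + m + ?L * m) ^ m \<le> (?x ^ (?A + nat \<lceil>z\<rceil> + 2)) ^ m"
    by (intro power_mono) auto
  then show ?thesis by (simp only: of_nat_power power_mult)
qed simp

lemma halts_within_wp:
  assumes "halts_within z P s b"
  shows "wp z P s (\<lambda>t s'. t \<le> nat \<lfloor>b\<rfloor>)" and "b \<ge> 1"
proof -
  have l: "lossless_spmf (exec z P s)" and t: "\<And>t s'. (t, s') \<in> set_spmf (exec z P s) \<Longrightarrow> real t \<le> b"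
    using assms by (auto simp: halts_within_def)
  show "wp z P s (\<lambda>t s'. t \<le> nat \<lfloor>b\<rfloor>)"
    unfolding wp_def using l t by (auto simp: le_nat_floor)
  have "set_spmf (exec z P s) \<noteq> {}"
    using l measure_spmf_zero_iff[of "exec z P s" UNIV] by (auto simp: lossless_spmf_def weight_spmf_def)
  then obtain t s' where ts: "(t, s') \<in> set_spmf (exec z P s)" by auto
  then have "1 \<le> real t" using exec_time_pos[OF ts] by simp
  then show "b \<ge> 1" using t[OF ts] by simp
qed

lemma succeeds_pr:
  "succeeds z P n s good \<longleftrightarrow> pr z P s good \<ge> (if deterministic P then 1 else 1 - 1 / real n)"
  by (simp add: succeeds_def pr_def)

theorem theorem2:
  fixes z \<beta> \<tau> :: real and T :: "nat \<Rightarrow> nat \<Rightarrow> real"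
  assumes "z \<ge> 1" and "\<beta> \<ge> 1"
    and "\<exists>B. clustering_approx z \<beta> B \<and> clustering_time z T B"
    and "\<exists>A c. clustering_approx z \<tau> A \<and>
           clustering_time z (\<lambda>n k. real c * real n ^ c) A"
  shows "\<exists>c::nat. \<forall>\<epsilon>>0. \<exists>Q. outlier_approx z (\<beta> + \<epsilon>) Q \<and>
           outlier_time z (\<lambda>n k m.
             real c * (real (k + m) / min 1 \<epsilon>) ^ (c * m) * real n ^ c * T n k) Q"
proof -
  from assms(3) obtain B where B: "clustering_approx z \<beta> B" "clustering_time z T B" by blast
  define e where "e = center_factor z \<beta> + nat \<lceil>z\<rceil> + 2"
  \<comment> \<open>16000 is 4000 times the 4 from \<open>n + 1 \<le> 2 * n\<close> squared, and
    \<open>2 * e\<close> stems from the squared number of guesses. One constant serves as factor and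
    as both exponents; it must be chosen before \<open>\<epsilon>\<close>.\<close>
  define c where "c = 16000 + 2 * e"
  have "\<exists>Q. outlier_approx z (\<beta> + \<epsilon>) Q \<and>
     outlier_time z (\<lambda>n k m. real c * (real (k + m) / min 1 \<epsilon>) ^ (c * m) * real n ^ c * T n k) Q"
    if "\<epsilon> > 0" for \<epsilon>
  proof -
    \<comment> \<open>The estimates require an error of at most 1; for larger
      \<open>\<epsilon>\<close> the stronger guarantee suffices.\<close>
    define \<delta> where "\<delta> = min 1 \<epsilon>"
    have \<delta>: "0 < \<delta>" "\<delta> \<le> 1" "\<delta> \<le> \<epsilon>" using that by (auto simp: \<delta>_def)
    define L where "L = extra_centers z \<beta> \<delta>"
    have main: "succeeds z (outlier_program L B) (card (X \<union> F)) (encode d X F k m)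
          (\<lambda>s. let C = returned (card (X \<union> F)) s in
             C \<in> feasible F k \<and> outlier_cost z d m X C \<le> (\<beta> + \<epsilon>) * outlier_opt z d X F k m) \<and>
       halts_within z (outlier_program L B) (encode d X F k m)
         (real c * (real (k + m) / \<delta>) ^ (c * m) * real (card (X \<union> F)) ^ c * T (card (X \<union> F)) k)"
      if inst: "outlier_instance \<Gamma> d X F k m" for \<Gamma> d X F k m
    proof -
      define n where "n = card (X \<union> F)"
      interpret outlier_problem z \<Gamma> d X F k m n by unfold_locales (use inst n_def assms(1) in auto)
      let ?t = "T n k" and ?p = "if deterministic B then 1 else 1 - 1 / real n"
      define \<tau> where "\<tau> = nat \<lfloor>?t\<rfloor>"
      have halt: "halts_within z B (encode d' X' F' k 0) ?t"
        if "clustering_instance \<Gamma>' d' X' F' k" "card (X' \<union> F') = n" for \<Gamma>' d' X' F'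
        using B(2) that unfolding clustering_time_def by metis
      have t1: "?t \<ge> 1" using halts_within_wp(2)[OF halt[OF inst_facts(10)]] n_def by simp
      then have \<tau>: "1 \<le> \<tau>" "real \<tau> \<le> ?t" unfolding \<tau>_def by linarith+
      have fin: "wp z B (encode d' X' F' k 0) (\<lambda>t s'. t \<le> \<tau>)"
        if "clustering_instance \<Gamma>' d' X' F' k" "card (X' \<union> F') = n" for \<Gamma>' d' X' F'
        unfolding \<tau>_def using halts_within_wp(1)[OF halt[OF that]] .
      have good: "pr z B (encode d' X' F' k 0) (\<lambda>s. returned n s \<in> feasible F' k \<and>
          cost z d' X' (returned n s) \<le> \<beta> * opt z d' X' F' k) \<ge> ?p"
        if "clustering_instance \<Gamma>' d' X' F' k" "card (X' \<union> F') = n" for \<Gamma>' d' X' F'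
      proof -
        have "succeeds z B (card (X' \<union> F')) (encode d' X' F' k 0)
          (\<lambda>s. let C = returned (card (X' \<union> F')) s in C \<in> feasible F' k \<and> cost z d' X' C \<le> \<beta> * opt z d' X' F' k)"
          using B(1) that(1) unfolding clustering_approx_def by blast
        then show ?thesis unfolding succeeds_pr that(2) Let_def .
      qed
      have p: "0 \<le> ?p" "?p \<le> 1" using n_pos by auto
      note correct = program_correct[OF assms(2) \<delta>(1,2) p \<tau>(1) L_def fin good]
      have "succeeds z (outlier_program L B) n (encode d X F k m) (\<lambda>s. returned n s \<in> feasible F k \<and>
          outlier_cost z d m X (returned n s) \<le> (\<beta> + \<epsilon>) * outlier_opt z d X F k m)"
        unfolding succeeds_pr deterministic_outlier_program
      proof (rule pr_mono[OF correct(2)])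
        fix s assume s: "returned n s \<in> feasible F k \<and>
          outlier_cost z d m X (returned n s) \<le> (\<beta> + \<delta>) * outlier_opt z d X F k m"
        have "outlier_opt z d X F k m \<in> outlier_cost z d m X ` feasible F k"
          unfolding outlier_opt_def using inst_facts by (intro Min_in) (auto simp: finite_feasible feasible_nonempty)
        then have "0 \<le> outlier_opt z d X F k m"
          using outlier_cost_attained[OF inst_facts(4,8)] cost_nonneg by (metis imageE)
        then have "(\<beta> + \<delta>) * outlier_opt z d X F k m \<le> (\<beta> + \<epsilon>) * outlier_opt z d X F k m"
          using \<delta>(3) by (intro mult_right_mono) auto
        with s show "returned n s \<in> feasible F k \<and>
          outlier_cost z d m X (returned n s) \<le> (\<beta> + \<epsilon>) * outlier_opt z d X F k m" by simp
      qed
      moreover have "halts_within z (outlier_program L B) (encode d X F k m)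
         (real c * (real (k + m) / \<delta>) ^ (c * m) * real n ^ c * T n k)"
      proof -
        let ?x = "real (k + m) / \<delta>" and ?M = "(k + m + L * m) ^ m"
        have k1: "k \<ge> 1" using inst_facts(7) .
        have x1: "?x \<ge> 1" using k1 \<delta> by (simp add: field_simps)
        have n1: "real n \<ge> 1" using n_pos by simp
        have M: "real ?M \<le> ?x ^ (e * m)"
          unfolding L_def e_def by (rule center_count_bound[OF assms(1,2) \<delta>(1,2) k1])
        have "real (4000 * (n + 1)\<^sup>2 * ?M\<^sup>2 * \<tau>) = 4000 * (real n + 1)\<^sup>2 * (real ?M)\<^sup>2 * real \<tau>"
          by simp
        also have "\<dots> \<le> 4000 * (2 * real n)\<^sup>2 * (?x ^ (e * m))\<^sup>2 * ?t"
          using M \<tau>(2) n1 by (intro mult_mono power_mono) auto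
        also have "\<dots> = 16000 * ?x ^ (2 * e * m) * real n ^ 2 * ?t"
          by (simp add: power_mult_distrib mult.assoc flip: power_mult) (simp add: ac_simps)
        also have "\<dots> \<le> real c * ?x ^ (c * m) * real n ^ c * ?t"
        proof (intro mult_mono)
          show "?x ^ (2 * e * m) \<le> ?x ^ (c * m)" using x1 by (intro power_increasing) (auto simp: c_def)
          show "real n ^ 2 \<le> real n ^ c" using n1 by (intro power_increasing) (auto simp: c_def)
        qed (use x1 n1 t1 in \<open>auto simp: c_def\<close>)
        finally have "real t \<le> real c * ?x ^ (c * m) * real n ^ c * ?t"
          if "t \<le> 4000 * (n + 1)\<^sup>2 * ?M\<^sup>2 * \<tau>" for t
          using that of_nat_mono[OF that, where ?'a=real] by linarith
        then show ?thesis
          using correct(1) unfolding wp_def halts_within_def by fast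
      qed
      ultimately show ?thesis unfolding n_def Let_def by blast
    qed
    show ?thesis
      by (intro exI[of _ "outlier_program L B"] conjI)
        (use main in \<open>auto simp: outlier_approx_def outlier_time_def \<delta>_def\<close>)
  qed
  then show ?thesis by blast
qed

end
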